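(* Let $\mathcal Q^\pm\in\mathcal C^1([a,b],\mathbb R^{2\times2})$, let $r\ge0$, and let $W_B\in\mathbb R^{2\times4}$ satisfy $\operatorname{rank}(W_B)=2$ and $W_B\Sigma W_B^\top\ge0$. If $W_B$ satisfies $W_B\Sigma W_B^\top>0$, then the port-Hamiltonian operator $$D(A_{\mathcal Q_0})=\left\{x\in X:\ \mathcal Q_0x\in D(\mathcal J_0),\ f_{I,\mathcal Q_0x}=r\,e_{I,\mathcal Q_0x},\ W_B\begin{bmatrix}f_{\partial,\mathcal Q_0x}\\ e_{\partial,\mathcal Q_0x}\end{bmatrix}=0\right\},\qquad A_{\mathcal Q_0}x=\mathcal J_0(\mathcal Q_0x),$$ generates an exponentially stable $C_0$-semigroup on $(X,\|\cdot\|_{\mathcal Q_0})$.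
   Context: Let $a<0<b$ and $X=L^2([a,b],\mathbb R^2)$. Let $c_0=\mathbf 1_{[a,0)}$, $\overline c_0=\mathbf 1_{(0,b]}$. Let $\mathcal Q_0=c_0\mathcal Q^-+\overline c_0\mathcal Q^+\in\mathcal L(X)$ be a coercive matrix multiplication operator, where $\mathcal Q^\pm$ are symmetric $2\times2$-matrix-valued functions on $[a,b]$ and there are constants $0<m\le M$ with $mI\le\mathcal Q^\pm(z)\le MI$ for almost all $z\in[a,b]$. $X$ is endowed with $\langle x,y\rangle_{\mathcal Q_0}=\frac12\int_a^by^\top(z)\mathcal Q_0(z)x(z)\,dz$ and its norm $\|\cdot\|_{\mathcal Q_0}$ (the energy space). The operator $\mathcal J_0$ on $X$ has domain $D(\mathcal J_0)=\{e=(e_1,e_2)\in X: e_1|_{(a,0)}\in H^1((a,0),\mathbb R),\ e_1|_{(0,b)}\in H^1((0,b),\mathbb R),\ e_2\in H^1([a,b],\mathbb R)\}$ and $\mathcal J_0e=(\mathbf d_0e_2,-\mathbf d_0^*e_1)$; here $\mathbf d_0e_2=-\frac{d}{dz}e_2$, and $\mathbf d_0^*e_1\in L^2([a,b],\mathbb R)$ is the function equal to $\frac{d}{dz}e_1$ on $(a,0)$ and on $(0,b)$. So $\mathcal J_0$ acts as $P_1\frac{d}{dz}$ on each of $(a,0)$, $(0,b)$, with $P_1=\begin{bmatrix}0&-1\\-1&0\end{bmatrix}$. For $e\in D(\mathcal J_0)$ the boundary port variables are $f_{\partial,e}=\frac1{\sqrt2}(P_1e(b)-P_1e(a))\in\mathbb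 R^2$, $e_{\partial,e}=\frac1{\sqrt2}(e(b)+e(a))\in\mathbb R^2$, and the interface port variables are $f_{I,e}=e_2(0)\in\mathbb R$, $e_{I,e}=e_1(0^-)-e_1(0^+)\in\mathbb R$. $\Sigma=\begin{bmatrix}0&I\\ I&0\end{bmatrix}\in\mathbb R^{4\times4}$ with $2\times 2$ identity blocks. $M>0$ ($M\ge0$) for a matrix means positive (semi)definite. A $C_0$-semigroup $(T(t))_{t\ge0}$ is exponentially stable if there are $M\ge1$, $\alpha>0$ with $\|T(t)\|\le Me^{-\alpha t}$ for all $t\ge0$. *)

theory Defs
  imports "HOL-Analysis.Analysis"
begin

subsection \<open>The space of square-integrable functions\<close>

definition sq_integrable :: "(real \<Rightarrow> real^2) \<Rightarrow> bool" where
  "sq_integrable f \<longleftrightarrow>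
     f \<in> borel_measurable lborel \<and> integrable lborel (\<lambda>z. (norm (f z))\<^sup>2)"

lemma sq_integrable_zero: "sq_integrable (\<lambda>z. 0)"
  by (simp add: sq_integrable_def)

lemma sq_integrable_scaleR:
  assumes "sq_integrable f"
  shows "sq_integrable (\<lambda>z. c *\<^sub>R f z)"
  using assms by (auto simp: sq_integrable_def power_mult_distrib)

lemma sq_integrable_add:
  assumes "sq_integrable f" "sq_integrable g"
  shows "sq_integrable (\<lambda>z. f z + g z)"
proof -
  have [measurable]: "f \<in> borel_measurable lborel" "g \<in> borel_measurable lborel"
    using assms by (auto simp: sq_integrable_def)
  have "integrable lborel (\<lambda>z. (norm (f z + g z))\<^sup>2)"
  proof (rule Bochner_Integration.integrable_bound)
    show "integrable lborel (\<lambda>z. 2 * (norm (f z))\<^sup>2 + 2 * (norm (g z))\<^sup>2)"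
      using assms by (auto simp: sq_integrable_def)
    show "(\<lambda>z. (norm (f z + g z))\<^sup>2) \<in> borel_measurable lborel"
      by measurable
    have "(norm (f z + g z))\<^sup>2 \<le> 2 * (norm (f z))\<^sup>2 + 2 * (norm (g z))\<^sup>2" for z
    proof -
      have "(norm (f z + g z))\<^sup>2 \<le> (norm (f z) + norm (g z))\<^sup>2"
        by (simp add: norm_triangle_ineq power_mono)
      also have "\<dots> \<le> 2 * (norm (f z))\<^sup>2 + 2 * (norm (g z))\<^sup>2"
        using sum_squares_bound[of "norm (f z)" "norm (g z)"] by (simp add: power2_sum)
      finally show ?thesis .
    qed
    then show "AE z in lborel. norm ((norm (f z + g z))\<^sup>2)
        \<le> norm (2 * (norm (f z))\<^sup>2 + 2 * (norm (g z))\<^sup>2)"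
      by simp
  qed
  then show ?thesis
    by (simp add: sq_integrable_def)
qed

definition ae_eq :: "(real \<Rightarrow> real^2) \<Rightarrow> (real \<Rightarrow> real^2) \<Rightarrow> bool" where
  "ae_eq f g \<longleftrightarrow> sq_integrable f \<and> sq_integrable g \<and> (AE z in lborel. f z = g z)"

quotient_type L2R2 = "real \<Rightarrow> real^2" / partial: ae_eq
proof (rule part_equivpI)
  show "\<exists>f. ae_eq f f"
    using sq_integrable_zero by (auto simp: ae_eq_def)
  show "symp ae_eq"
    by (rule sympI) (auto simp: ae_eq_def elim: AE_mp)
  show "transp ae_eq"
    by (rule transpI) (auto simp: ae_eq_def elim: AE_mp)
qed

instantiation L2R2 :: real_vector
begin

lift_definition zero_L2R2 :: L2R2 is "\<lambda>z. 0"
  by (simp add: ae_eq_def sq_integrable_zero)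

lift_definition plus_L2R2 :: "L2R2 \<Rightarrow> L2R2 \<Rightarrow> L2R2" is "\<lambda>f g z. f z + g z"
  by (auto simp: ae_eq_def sq_integrable_add elim: AE_mp)

lift_definition scaleR_L2R2 :: "real \<Rightarrow> L2R2 \<Rightarrow> L2R2" is "\<lambda>c f z. c *\<^sub>R f z"
  by (auto simp: ae_eq_def sq_integrable_scaleR elim: AE_mp)

lift_definition uminus_L2R2 :: "L2R2 \<Rightarrow> L2R2" is "\<lambda>f z. - f z"
  using sq_integrable_scaleR[where c = "-1"]
  by (auto simp: ae_eq_def elim: AE_mp)

definition minus_L2R2 :: "L2R2 \<Rightarrow> L2R2 \<Rightarrow> L2R2" where
  "minus_L2R2 x y = x + (- y)"

instance
proof
  fix x y z :: L2R2 and c d :: real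
  show "x + y + z = x + (y + z)"
    by transfer (auto simp: ae_eq_def add.assoc intro!: sq_integrable_add)
  show "x + y = y + x"
    by transfer (auto simp: ae_eq_def add.commute intro!: sq_integrable_add)
  show "0 + x = x"
    by transfer (auto simp: ae_eq_def)
  show "- x + x = 0"
    by transfer (auto simp: ae_eq_def sq_integrable_zero)
  show "x - y = x + - y"
    by (rule minus_L2R2_def)
  show "c *\<^sub>R (x + y) = c *\<^sub>R x + c *\<^sub>R y"
    by transfer
      (auto simp: ae_eq_def scaleR_right_distrib intro!: sq_integrable_add sq_integrable_scaleR)
  show "(c + d) *\<^sub>R x = c *\<^sub>R x + d *\<^sub>R x"
    by transfer
      (auto simp: ae_eq_def scaleR_left_distrib intro!: sq_integrable_add sq_integrable_scaleR)
  show "c *\<^sub>R d *\<^sub>R x = (c * d) *\<^sub>R x"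
    by transfer (auto simp: ae_eq_def intro!: sq_integrable_scaleR)
  show "1 *\<^sub>R x = x"
    by transfer (auto simp: ae_eq_def)
qed

end

text \<open>
  The space \<open>L\<^sup>2([a,b], \<real>\<^sup>2)\<close>, realised as the subspace of those classes in \<open>L\<^sup>2(\<real>, \<real>\<^sup>2)\<close>
  that vanish almost everywhere outside \<open>[a,b]\<close>.
\<close>
definition L2_space :: "real \<Rightarrow> real \<Rightarrow> L2R2 set" where
  "L2_space a b = {x. AE z in lborel. z \<notin> {a..b} \<longrightarrow> rep_L2R2 x z = 0}"

definition component :: "L2R2 \<Rightarrow> 2 \<Rightarrow> real \<Rightarrow> real" where
  "component x i = (\<lambda>z. rep_L2R2 x z $ i)"

subsection \<open>The Sobolev space \<open>H\<^sup>1\<close> on an open interval\<close>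

definition sq_integrable_on :: "real \<Rightarrow> real \<Rightarrow> (real \<Rightarrow> real) \<Rightarrow> bool" where
  "sq_integrable_on c d f \<longleftrightarrow>
     set_borel_measurable lborel {c<..<d} f \<and>
     set_integrable lborel {c<..<d} (\<lambda>z. (f z)\<^sup>2)"

text \<open>
  \<open>\<phi>\<close> is a continuously differentiable function with compact support in \<open>(c,d)\<close> (extended by
  zero to the real line) and \<open>\<phi>'\<close> is its derivative.
\<close>
definition test_function :: "real \<Rightarrow> real \<Rightarrow> (real \<Rightarrow> real) \<Rightarrow> (real \<Rightarrow> real) \<Rightarrow> bool" where
  "test_function c d \<phi> \<phi>' \<longleftrightarrow>
     (\<forall>z. (\<phi> has_real_derivative \<phi>' z) (at z)) \<and> continuous_on UNIV \<phi>' \<and>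
     (\<exists>K. compact K \<and> K \<subseteq> {c<..<d} \<and> (\<forall>z. z \<notin> K \<longrightarrow> \<phi> z = 0))"

definition has_weak_deriv :: "real \<Rightarrow> real \<Rightarrow> (real \<Rightarrow> real) \<Rightarrow> (real \<Rightarrow> real) \<Rightarrow> bool" where
  "has_weak_deriv c d f g \<longleftrightarrow>
     sq_integrable_on c d f \<and> sq_integrable_on c d g \<and>
     (\<forall>\<phi> \<phi>'. test_function c d \<phi> \<phi>' \<longrightarrow>
        (LINT z:{c<..<d}|lborel. f z * \<phi>' z) = - (LINT z:{c<..<d}|lborel. g z * \<phi> z))"

definition H1 :: "real \<Rightarrow> real \<Rightarrow> (real \<Rightarrow> real) set" where
  "H1 c d = {f. \<exists>g. has_weak_deriv c d f g}"

definition weak_deriv :: "real \<Rightarrow> real \<Rightarrow> (real \<Rightarrow> real) \<Rightarrow> real \<Rightarrow> real" where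
  "weak_deriv c d f = (SOME g. has_weak_deriv c d f g)"

text \<open>
  The value at \<open>p \<in> [c,d]\<close> of the representative of \<open>f \<in> H\<^sup>1(c,d)\<close> that is continuous on the
  closed interval; \<open>p = c\<close> and \<open>p = d\<close> give the one-sided boundary values.
\<close>
definition pt_value :: "real \<Rightarrow> real \<Rightarrow> (real \<Rightarrow> real) \<Rightarrow> real \<Rightarrow> real" where
  "pt_value c d f p =
     (THE y. \<exists>F. continuous_on {c..d} F \<and>
        (AE z in lborel. z \<in> {c<..<d} \<longrightarrow> F z = f z) \<and> F p = y)"

subsection \<open>The operator \<open>J\<^sub>0\<close> and the port variables\<close>

definition dom_J0 :: "real \<Rightarrow> real \<Rightarrow> L2R2 set" where
  "dom_J0 a b = {e \<in> L2_space a b.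
     component e 1 \<in> H1 a 0 \<and> component e 1 \<in> H1 0 b \<and> component e 2 \<in> H1 a b}"

definition d0 :: "real \<Rightarrow> real \<Rightarrow> (real \<Rightarrow> real) \<Rightarrow> real \<Rightarrow> real" where
  "d0 a b f z = - weak_deriv a b f z"

definition d0_adj :: "real \<Rightarrow> real \<Rightarrow> (real \<Rightarrow> real) \<Rightarrow> real \<Rightarrow> real" where
  "d0_adj a b f z = (if z < 0 then weak_deriv a 0 f z else weak_deriv 0 b f z)"

definition J0 :: "real \<Rightarrow> real \<Rightarrow> L2R2 \<Rightarrow> L2R2" where
  "J0 a b e = abs_L2R2 (\<lambda>z. if z \<in> {a<..<0} \<union> {0<..<b}
     then vector [d0 a b (component e 2) z, - d0_adj a b (component e 1) z] else 0)"

definition P1 :: "real^2^2" where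
  "P1 = vector [vector [0, -1], vector [-1, 0]]"

definition val_a :: "real \<Rightarrow> real \<Rightarrow> L2R2 \<Rightarrow> real^2" where
  "val_a a b e = vector [pt_value a 0 (component e 1) a, pt_value a b (component e 2) a]"

definition val_b :: "real \<Rightarrow> real \<Rightarrow> L2R2 \<Rightarrow> real^2" where
  "val_b a b e = vector [pt_value 0 b (component e 1) b, pt_value a b (component e 2) b]"

definition f_bd :: "real \<Rightarrow> real \<Rightarrow> L2R2 \<Rightarrow> real^2" where
  "f_bd a b e = (1 / sqrt 2) *\<^sub>R (P1 *v val_b a b e - P1 *v val_a a b e)"

definition e_bd :: "real \<Rightarrow> real \<Rightarrow> L2R2 \<Rightarrow> real^2" where
  "e_bd a b e = (1 / sqrt 2) *\<^sub>R (val_b a b e + val_a a b e)"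

definition f_I :: "real \<Rightarrow> real \<Rightarrow> L2R2 \<Rightarrow> real" where
  "f_I a b e = pt_value a b (component e 2) 0"

definition e_I :: "real \<Rightarrow> real \<Rightarrow> L2R2 \<Rightarrow> real" where
  "e_I a b e = pt_value a 0 (component e 1) 0 - pt_value 0 b (component e 1) 0"

subsection \<open>Matrices\<close>

definition pos_semidef :: "real^'n^'n \<Rightarrow> bool" where
  "pos_semidef A \<longleftrightarrow> transpose A = A \<and> (\<forall>v. 0 \<le> v \<bullet> (A *v v))"

definition pos_def :: "real^'n^'n \<Rightarrow> bool" where
  "pos_def A \<longleftrightarrow> transpose A = A \<and> (\<forall>v. v \<noteq> 0 \<longrightarrow> 0 < v \<bullet> (A *v v))"

definition Sigma_mat :: "real^4^4" where
  "Sigma_mat = vector [vector [0, 0, 1, 0], vector [0, 0, 0, 1],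
                       vector [1, 0, 0, 0], vector [0, 1, 0, 0]]"

definition stack :: "real^2 \<Rightarrow> real^2 \<Rightarrow> real^4" where
  "stack f e = vector [f $ 1, f $ 2, e $ 1, e $ 2]"

subsection \<open>The coefficient \<open>Q\<^sub>0\<close> and the energy space\<close>

definition C1_on :: "real \<Rightarrow> real \<Rightarrow> (real \<Rightarrow> real^2^2) \<Rightarrow> bool" where
  "C1_on a b Q \<longleftrightarrow>
     (\<exists>Q'. (\<forall>z\<in>{a..b}. (Q has_vector_derivative Q' z) (at z within {a..b})) \<and>
       continuous_on {a..b} Q')"

definition Q0 :: "real \<Rightarrow> real \<Rightarrow> (real \<Rightarrow> real^2^2) \<Rightarrow> (real \<Rightarrow> real^2^2) \<Rightarrow> real \<Rightarrow> real^2^2" where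
  "Q0 a b Qm Qp z = indicator {a..<0} z *\<^sub>R Qm z + indicator {0<..b} z *\<^sub>R Qp z"

definition mult_op :: "(real \<Rightarrow> real^2^2) \<Rightarrow> L2R2 \<Rightarrow> L2R2" where
  "mult_op Q x = abs_L2R2 (\<lambda>z. Q z *v rep_L2R2 x z)"

definition energy_inner :: "real \<Rightarrow> real \<Rightarrow> (real \<Rightarrow> real^2^2) \<Rightarrow> L2R2 \<Rightarrow> L2R2 \<Rightarrow> real" where
  "energy_inner a b Q x y =
     1/2 * (LINT z:{a..b}|lborel. rep_L2R2 y z \<bullet> (Q z *v rep_L2R2 x z))"

definition energy_norm :: "real \<Rightarrow> real \<Rightarrow> (real \<Rightarrow> real^2^2) \<Rightarrow> L2R2 \<Rightarrow> real" where
  "energy_norm a b Q x = sqrt (energy_inner a b Q x x)"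

subsection \<open>The port-Hamiltonian operator\<close>

definition dom_A ::
  "real \<Rightarrow> real \<Rightarrow> (real \<Rightarrow> real^2^2) \<Rightarrow> (real \<Rightarrow> real^2^2) \<Rightarrow> real \<Rightarrow> real^4^2 \<Rightarrow> L2R2 set" where
  "dom_A a b Qm Qp r W = {x \<in> L2_space a b.
     (let e = mult_op (Q0 a b Qm Qp) x in
        e \<in> dom_J0 a b \<and> f_I a b e = r * e_I a b e \<and>
        W *v stack (f_bd a b e) (e_bd a b e) = 0)}"

definition op_A ::
  "real \<Rightarrow> real \<Rightarrow> (real \<Rightarrow> real^2^2) \<Rightarrow> (real \<Rightarrow> real^2^2) \<Rightarrow> L2R2 \<Rightarrow> L2R2" where
  "op_A a b Qm Qp x = J0 a b (mult_op (Q0 a b Qm Qp) x)"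

subsection \<open>Strongly continuous semigroups\<close>

text \<open>
  Here \<open>X\<close> is a linear subspace of a real vector space and \<open>N\<close> is the norm under consideration
  on \<open>X\<close>. The values of operators outside \<open>X\<close> (or outside their domain) are irrelevant.
\<close>

definition bounded_op_on :: "'v::real_vector set \<Rightarrow> ('v \<Rightarrow> real) \<Rightarrow> ('v \<Rightarrow> 'v) \<Rightarrow> bool" where
  "bounded_op_on X N S \<longleftrightarrow>
     (\<forall>x\<in>X. S x \<in> X) \<and>
     (\<forall>x\<in>X. \<forall>y\<in>X. S (x + y) = S x + S y) \<and>
     (\<forall>c. \<forall>x\<in>X. S (c *\<^sub>R x) = c *\<^sub>R S x) \<and>
     (\<exists>C. \<forall>x\<in>X. N (S x) \<le> C * N x)"

text \<open>The operator norm; as in \<^const>\<open>onorm\<close>, the quotient at \<open>x = 0\<close> is \<open>0\<close>.\<close>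
definition op_norm_on :: "'v::real_vector set \<Rightarrow> ('v \<Rightarrow> real) \<Rightarrow> ('v \<Rightarrow> 'v) \<Rightarrow> real" where
  "op_norm_on X N S = (SUP x\<in>X. N (S x) / N x)"

definition C0_semigroup ::
  "'v::real_vector set \<Rightarrow> ('v \<Rightarrow> real) \<Rightarrow> (real \<Rightarrow> 'v \<Rightarrow> 'v) \<Rightarrow> bool" where
  "C0_semigroup X N T \<longleftrightarrow>
     (\<forall>t\<ge>0. bounded_op_on X N (T t)) \<and>
     (\<forall>x\<in>X. T 0 x = x) \<and>
     (\<forall>s\<ge>0. \<forall>t\<ge>0. \<forall>x\<in>X. T (s + t) x = T s (T t x)) \<and>
     (\<forall>x\<in>X. ((\<lambda>t. N (T t x - x)) \<longlongrightarrow> 0) (at_right 0))"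

text \<open>The pair \<open>(x, y)\<close> lies in the graph of the infinitesimal generator of \<open>T\<close>.\<close>
definition generator_graph ::
  "'v::real_vector set \<Rightarrow> ('v \<Rightarrow> real) \<Rightarrow> (real \<Rightarrow> 'v \<Rightarrow> 'v) \<Rightarrow> ('v \<times> 'v) set" where
  "generator_graph X N T = {(x, y). x \<in> X \<and> y \<in> X \<and>
     ((\<lambda>t. N ((1 / t) *\<^sub>R (T t x - x) - y)) \<longlongrightarrow> 0) (at_right 0)}"

definition generates ::
  "'v::real_vector set \<Rightarrow> ('v \<Rightarrow> real) \<Rightarrow> 'v set \<Rightarrow> ('v \<Rightarrow> 'v) \<Rightarrow> (real \<Rightarrow> 'v \<Rightarrow> 'v) \<Rightarrow> bool" where
  "generates X N D A T \<longleftrightarrow>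
     C0_semigroup X N T \<and> generator_graph X N T = {(x, A x) |x. x \<in> D}"

definition exponentially_stable ::
  "'v::real_vector set \<Rightarrow> ('v \<Rightarrow> real) \<Rightarrow> (real \<Rightarrow> 'v \<Rightarrow> 'v) \<Rightarrow> bool" where
  "exponentially_stable X N T \<longleftrightarrow>
     (\<exists>M\<ge>1. \<exists>\<alpha>>0. \<forall>t\<ge>0. op_norm_on X N (T t) \<le> M * exp (- \<alpha> * t))"

end

theory Submission
  imports Defs
begin

text \<open>
  Let \<open>e = \<Q>\<^sub>0 x\<close>. To the energy, add a small multiple of a multiplier term:
  \<open>V(x) = \<integral> x\<^sup>T (\<Q>\<^sub>0 / 2 + \<epsilon> w P\<^sub>1) x\<close>, with \<open>w = - exp (- k z)\<close> on \<open>(a,0)\<close> and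
  \<open>w = exp (k z)\<close> on \<open>(0,b)\<close>. Since \<open>P\<^sub>1\<^sup>2 = 1\<close>, the additional term contributes \<open>\<epsilon> \<integral> w x\<^sup>T (\<Q>\<^sub>0 x)'\<close> to the derivative along
  solutions. Integrated by parts, this is at most \<open>- c \<parallel>x\<parallel>\<^sup>2\<close> (for large \<open>k\<close>) plus boundary terms,
  which have the good sign at the interface and are absorbed at \<open>a\<close> and \<open>b\<close> by the dissipation
  \<open>f\<^sub>\<partial> \<bullet> e\<^sub>\<partial> \<le> - \<kappa> (|e(a)|\<^sup>2 + |e(b)|\<^sup>2)\<close> that \<open>W \<Sigma> W\<^sup>T > 0\<close> provides.

  So for small \<open>\<epsilon>\<close>, \<open>V\<close> is the square of an equivalent Hilbert norm in which \<open>A + \<alpha>\<close> is dissipative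
  for some \<open>\<alpha> > 0\<close>. Moreover \<open>A\<close> is onto: \<open>A x = y\<close> is solved by integrating \<open>y\<close>, and the three
  integration constants are determined by an injective linear system. The Lumer-Phillips theorem
  (proved by the implicit Euler scheme) then yields generation and exponential decay at once.
\<close>

text \<open>The energy alone yields no decay rate: its derivative along solutions involves only the
  values at \<open>a\<close>, 0 and \<open>b\<close>, not the state in between. The multiplier makes
  boundary damping visible in the interior. Its weight must jump at 0, because \<open>e_1\<close>
  does: the densities e^T Q^(-1) e at 0- and 0+ are unrelated, and only with w = -1 on the left and
  w = 1 on the right of 0 do both enter with a minus sign. The growth of |w| away from 0 lets w'
  dominate the derivatives of the coefficients.

  On the abstract side, <Ax, x> \<le> -\<alpha> <x, x> and surjectivity of \<open>A\<close> put 0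
  into the resolvent set. Every l \<ge> 0 is then reached by steps of length \<alpha>/2, and in a
  Hilbert space density of the domain follows as well. The Euler scheme is dyadic, so that
  consecutive approximations differ by splitting each step into two halves, with an error geometric
  in the level.\<close>

subsection \<open>Semigroups generated by strictly dissipative operators\<close>

text \<open>Semidefinite on the whole type only: \<open>L2R2\<close> consists of functions on the
  whole line, while the weights used later vanish outside [a,b]. Definiteness is demanded on a
  subspace in \<open>hilbert_subspace\<close>.\<close>

locale semi_inner_space =
  fixes ip :: "'v::real_vector \<Rightarrow> 'v \<Rightarrow> real"
  assumes ip_commute: "ip x y = ip y x"
    and ip_add_left: "ip (x + y) z = ip x z + ip y z"
    and ip_scale_left: "ip (c *\<^sub>R x) y = c * ip x y"
    and ip_nonneg: "0 \<le> ip x x"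
begin

definition nrm :: "'v \<Rightarrow> real" where
  "nrm x = sqrt (ip x x)"

lemma ip_add_right: "ip z (x + y) = ip z x + ip z y"
  by (metis ip_add_left ip_commute)

lemma ip_scale_right: "ip y (c *\<^sub>R x) = c * ip y x"
  by (metis ip_scale_left ip_commute)

lemma ip_minus_left: "ip (- x) y = - ip x y"
  using ip_scale_left[of "-1" x y] by simp

lemma ip_minus_right: "ip y (- x) = - ip y x"
  using ip_scale_right[of y "-1" x] by simp

lemma ip_diff_left: "ip (x - y) z = ip x z - ip y z"
  using ip_add_left[of x "- y" z] by (simp add: ip_minus_left)

lemma ip_diff_right: "ip z (x - y) = ip z x - ip z y"
  using ip_add_right[of z x "- y"] by (simp add: ip_minus_right)

lemmas ip_simps = ip_add_left ip_add_right ip_diff_left ip_diff_right ip_scale_left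
  ip_scale_right ip_minus_left ip_minus_right

lemma nrm_nonneg [simp]: "0 \<le> nrm x"
  by (simp add: nrm_def ip_nonneg)

lemma nrm_sq: "(nrm x)\<^sup>2 = ip x x"
  by (simp add: nrm_def ip_nonneg)

lemma nrm_scale: "nrm (c *\<^sub>R x) = \<bar>c\<bar> * nrm x"
  by (simp add: nrm_def ip_simps real_sqrt_mult flip: mult.assoc)

lemma nrm_zero [simp]: "nrm 0 = 0"
  using nrm_scale[of 0 0] by simp

lemma nrm_minus [simp]: "nrm (- x) = nrm x"
  by (simp add: nrm_def ip_simps)

lemma nrm_diff_commute: "nrm (x - y) = nrm (y - x)"
  by (metis minus_diff_eq nrm_minus)

lemma ip_le: "ip x y \<le> nrm x * nrm y"
proof -
  have *: "(ip x y)\<^sup>2 \<le> ip x x * ip y y"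
  proof (cases "ip y y = 0")
    case True
    have "2 * t * ip x y \<le> ip x x" for t
      using ip_nonneg[of "x - t *\<^sub>R y"] True by (simp add: ip_simps ip_commute algebra_simps)
    \<comment> \<open>This \<open>t\<close> turns the inequality into
      \<open>ip x x + 1 \<le> ip x x\<close>, unless \<open>ip x y = 0\<close>.\<close>
    from this[of "(ip x x + 1) / (2 * ip x y)"] have "ip x y = 0"
      by (cases "ip x y = 0") auto
    then show ?thesis
      using True by simp
  next
    case False
    then have p: "0 < ip y y"
      using ip_nonneg[of y] by simp
    have "0 \<le> ip (ip y y *\<^sub>R x - ip x y *\<^sub>R y) (ip y y *\<^sub>R x - ip x y *\<^sub>R y)"
      by (rule ip_nonneg)
    also have "\<dots> = ip y y * (ip x x * ip y y - (ip x y)\<^sup>2)"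
      by (simp add: ip_simps ip_commute[of y x] algebra_simps power2_eq_square)
    finally show ?thesis
      using p by (simp add: zero_le_mult_iff)
  qed
  have "ip x y \<le> sqrt ((ip x y)\<^sup>2)"
    by simp
  also have "\<dots> \<le> sqrt (ip x x * ip y y)"
    using * by (rule real_sqrt_le_mono)
  finally show ?thesis
    by (simp add: nrm_def real_sqrt_mult)
qed

lemma nrm_triangle: "nrm (x + y) \<le> nrm x + nrm y"
proof (rule power2_le_imp_le)
  have "(nrm (x + y))\<^sup>2 = (nrm x)\<^sup>2 + (nrm y)\<^sup>2 + 2 * ip x y"
    by (simp add: nrm_sq ip_simps ip_commute)
  also have "\<dots> \<le> (nrm x + nrm y)\<^sup>2"
    using ip_le[of x y] by (simp add: power2_sum)
  finally show "(nrm (x + y))\<^sup>2 \<le> (nrm x + nrm y)\<^sup>2" .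
qed simp

lemma nrm_triangle_sub: "nrm (x - z) \<le> nrm (x - y) + nrm (y - z)"
  using nrm_triangle[of "x - y" "y - z"] by simp

lemma nrm_diff_le: "nrm (x - y) \<le> nrm x + nrm y"
  using nrm_triangle[of x "- y"] by simp

lemma nrm_le_add_diff: "nrm x \<le> nrm y + nrm (x - y)"
  using nrm_triangle[of y "x - y"] by simp

end

text \<open>Completeness is phrased with squared distances because it will come from integrals of
  squares.\<close>

locale hilbert_subspace = semi_inner_space ip
  for ip :: "'v::real_vector \<Rightarrow> 'v \<Rightarrow> real" +
  fixes X :: "'v set"
  assumes subspace_X: "subspace X"
    and ip_definite: "x \<in> X \<Longrightarrow> ip x x = 0 \<Longrightarrow> x = 0"
    and complete_X: "\<lbrakk>\<And>n. s n \<in> X;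
        \<And>e. 0 < e \<Longrightarrow> \<exists>K. \<forall>m\<ge>K. \<forall>n\<ge>K. ip (s m - s n) (s m - s n) < e\<rbrakk>
      \<Longrightarrow> \<exists>l\<in>X. (\<lambda>n::nat. ip (s n - l) (s n - l)) \<longlonglongrightarrow> 0"
begin

lemmas X_zero [simp] = subspace_0[OF subspace_X]
lemmas X_add [intro, simp] = subspace_add[OF subspace_X]
lemmas X_diff [intro, simp] = subspace_diff[OF subspace_X]
lemmas X_scale [intro, simp] = subspace_scale[OF subspace_X]

lemma nrm_eq_zeroD: "x \<in> X \<Longrightarrow> nrm x = 0 \<Longrightarrow> x = 0"
  using ip_definite nrm_sq[of x] by simp

lemma limit_unique:
  assumes "(\<lambda>n. nrm (s n - x)) \<longlonglongrightarrow> 0" "(\<lambda>n. nrm (s n - y)) \<longlonglongrightarrow> 0" "x \<in> X" "y \<in> X"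
  shows "x = y"
proof -
  have "(\<lambda>n::nat. nrm (s n - x) + nrm (s n - y)) \<longlonglongrightarrow> 0 + 0"
    by (intro tendsto_intros assms)
  moreover have "nrm (x - y) \<le> nrm (s n - x) + nrm (s n - y)" for n
    using nrm_triangle_sub[of x y "s n"] nrm_diff_commute[of x "s n"] by simp
  ultimately have "nrm (x - y) \<le> 0 + 0"
    by (intro LIMSEQ_le_const) auto
  then show ?thesis
    using nrm_eq_zeroD[of "x - y"] assms nrm_nonneg[of "x - y"] by simp
qed

lemma nrm_complete:
  assumes "\<And>n. s n \<in> X" and "\<And>e. 0 < e \<Longrightarrow> \<exists>K. \<forall>m\<ge>K. \<forall>n\<ge>K. (nrm (s m - s n))\<^sup>2 < e"
  shows "\<exists>l\<in>X. (\<lambda>n::nat. nrm (s n - l)) \<longlonglongrightarrow> 0"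
proof -
  obtain l where "l \<in> X" "(\<lambda>n. ip (s n - l) (s n - l)) \<longlonglongrightarrow> 0"
    using complete_X[of s] assms by (auto simp: nrm_sq)
  then have "(\<lambda>n. sqrt (ip (s n - l) (s n - l))) \<longlonglongrightarrow> sqrt 0"
    by (intro tendsto_real_sqrt)
  then show ?thesis
    using \<open>l \<in> X\<close> by (auto simp: nrm_def)
qed

text \<open>Serves twice: for the fixed point iteration in \<open>surj_step\<close> and for the
  Euler approximations in \<open>euler_limit_D2\<close>. The explicit rate is kept because its case
  \<open>n = 0\<close> later compares the semigroup with a single Euler step.\<close>

lemma geometric_limit:
  assumes s: "\<And>n::nat. s n \<in> X" and d: "\<And>n. nrm (s (Suc n) - s n) \<le> C * (1/2)^n"
  shows "\<exists>l\<in>X. \<forall>n. nrm (s n - l) \<le> 2 * C * (1/2)^n"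
proof -
  have C: "0 \<le> C"
    using d[of 0] order_trans[OF nrm_nonneg] by simp
  \<comment> \<open>The subtracted remainder of the geometric series is what lets the induction
    close.\<close>
  have tail: "nrm (s (n + p) - s n) \<le> 2 * C * (1/2)^n - 2 * C * (1/2)^(n + p)" for n p
  proof (induction p)
    case (Suc p)
    show ?case
      using Suc nrm_triangle_sub[of "s (Suc (n + p))" "s n" "s (n + p)"] d[of "n + p"] by simp
  qed simp
  have tail': "nrm (s m - s n) \<le> 2 * C * (1/2)^n" if "n \<le> m" for m n
  proof -
    have "0 \<le> 2 * C * (1/2)^m"
      using C by simp
    then show ?thesis
      using tail[of n "m - n"] that by simp
  qed
  have z: "(\<lambda>n. 2 * C * (1/2)^n) \<longlonglongrightarrow> 0"
    by (rule tendsto_mult_right_zero[OF LIMSEQ_realpow_zero]) auto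
  have "\<exists>l\<in>X. (\<lambda>n. nrm (s n - l)) \<longlonglongrightarrow> 0"
  proof (rule nrm_complete[OF s])
    fix e :: real assume e: "0 < e"
    have "(\<lambda>n. (2 * C * (1/2)^n)\<^sup>2) \<longlonglongrightarrow> 0\<^sup>2"
      using z by (rule tendsto_power)
    then have "\<forall>\<^sub>F n in sequentially. (2 * C * (1/2)^n)\<^sup>2 < e"
      using e by (intro order_tendstoD(2)[where y = "0\<^sup>2"]) auto
    then obtain K where K: "(2 * C * (1/2)^K)\<^sup>2 < e \<and> (\<forall>n\<ge>K. (2 * C * (1/2)^n)\<^sup>2 < e)"
      by (auto simp: eventually_sequentially)
    have "(nrm (s m - s n))\<^sup>2 < e" if "K \<le> m" "K \<le> n" for m n
    proof (cases "n \<le> m")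
      case True
      then show ?thesis
        using power_mono[OF tail', of n m 2] K that by (fastforce intro: le_less_trans)
    next
      case False
      then show ?thesis
        using power_mono[OF tail', of m n 2] K that nrm_diff_commute[of "s m" "s n"]
        by (fastforce intro: le_less_trans)
    qed
    then show "\<exists>K. \<forall>m\<ge>K. \<forall>n\<ge>K. (nrm (s m - s n))\<^sup>2 < e"
      by blast
  qed
  then obtain l where l: "l \<in> X" "(\<lambda>n. nrm (s n - l)) \<longlonglongrightarrow> 0"
    by blast
  have "nrm (s n - l) \<le> 2 * C * (1/2)^n" for n
  proof -
    have "(\<lambda>m. 2 * C * (1/2)^n + nrm (s m - l)) \<longlonglongrightarrow> 2 * C * (1/2)^n + 0"
      by (intro tendsto_intros l)
    moreover have "nrm (s n - l) \<le> 2 * C * (1/2)^n + nrm (s m - l)" if "n \<le> m" for m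
      using nrm_triangle_sub[of "s n" l "s m"] nrm_diff_commute[of "s n" "s m"] tail'[OF that]
      by simp
    ultimately show ?thesis
      by (intro LIMSEQ_le_const[where a = "nrm (s n - l)"]) auto
  qed
  with l show ?thesis
    by blast
qed

end

text \<open>Strict dissipativity and surjectivity of \<open>A\<close> itself stand in for the range
  condition and the density of the domain in the Lumer-Phillips theorem; both are derived
  below.\<close>

locale dissipative_operator = hilbert_subspace ip X
  for ip :: "'v::real_vector \<Rightarrow> 'v \<Rightarrow> real" and X :: "'v set" +
  fixes D :: "'v set" and A :: "'v \<Rightarrow> 'v" and \<alpha> :: real
  assumes subspace_D: "subspace D"
    and D_subset: "D \<subseteq> X"
    and A_in: "x \<in> D \<Longrightarrow> A x \<in> X"
    and A_add: "x \<in> D \<Longrightarrow> y \<in> D \<Longrightarrow> A (x + y) = A x + A y"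
    and A_scale: "x \<in> D \<Longrightarrow> A (c *\<^sub>R x) = c *\<^sub>R A x"
    and alpha_pos: "0 < \<alpha>"
    and dissipative: "x \<in> D \<Longrightarrow> ip (A x) x \<le> - \<alpha> * ip x x"
    and A_surj: "y \<in> X \<Longrightarrow> \<exists>x\<in>D. A x = y"
begin

section \<open>Ranges of the shifted operators l - A\<close>

lemmas D_zero [simp] = subspace_0[OF subspace_D]
lemmas D_add [intro, simp] = subspace_add[OF subspace_D]
lemmas D_diff [intro, simp] = subspace_diff[OF subspace_D]
lemmas D_scale [intro, simp] = subspace_scale[OF subspace_D]

lemma D_in_X [simp, intro]: "x \<in> D \<Longrightarrow> x \<in> X"
  using D_subset by blast

lemma A_diff: "x \<in> D \<Longrightarrow> y \<in> D \<Longrightarrow> A (x - y) = A x - A y"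
  using A_add[of x "(-1) *\<^sub>R y"] A_scale[of y "-1"] D_scale[of y "-1"] by simp

text \<open>Pair \<open>l *\<^sub>R u - h *\<^sub>R A u\<close> with \<open>u\<close> and divide by
  the norm. The two coefficients stay separate because three cases occur: \<open>h = 1\<close> for
  the resolvent equation, \<open>l = 1\<close> for an Euler step, and \<open>l = 0\<close>,
  \<open>h = 1\<close> as a bound for the inverse of \<open>A\<close>.\<close>

lemma coercive: 
  assumes "u \<in> D" "0 \<le> l" "0 \<le> h"
  shows "(l + h * \<alpha>) * nrm u \<le> nrm (l *\<^sub>R u - h *\<^sub>R A u)"
proof (cases "nrm u = 0")
  case False
  then have pos: "0 < nrm u"
    using nrm_nonneg[of u] by linarith
  have "(l + h * \<alpha>) * (nrm u * nrm u) \<le> ip (l *\<^sub>R u - h *\<^sub>R A u) u"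
    using mult_left_mono[OF dissipative[OF assms(1)] assms(3)] nrm_sq[of u]
    by (simp add: ip_simps algebra_simps power2_eq_square)
  also have "\<dots> \<le> nrm (l *\<^sub>R u - h *\<^sub>R A u) * nrm u"
    by (rule ip_le)
  finally show ?thesis
    using pos by (simp flip: mult.assoc)
qed simp

text \<open>Continuation in the parameter: m u - A u = y is the fixed point equation u = (l -
  A)^(-1) (y + (l - m) u), whose right side has Lipschitz constant at most (m - l) / (l + \<alpha>)
  \<le> 1/2. The admissible step \<alpha>/2 does not depend on \<open>l\<close>, so finitely many
  steps reach any parameter.\<close>

lemma surj_step:
  assumes l: "0 \<le> l" and surj: "\<And>y. y \<in> X \<Longrightarrow> \<exists>u\<in>D. l *\<^sub>R u - A u = y"
    and m: "l \<le> m" "m \<le> l + \<alpha> / 2" and y: "y \<in> X"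
  shows "\<exists>u\<in>D. m *\<^sub>R u - A u = y"
proof -
  obtain R where R: "\<And>x. x \<in> X \<Longrightarrow> R x \<in> D \<and> l *\<^sub>R R x - A (R x) = x"
    using surj by metis
  define P where "P u = R (y + (l - m) *\<^sub>R u)" for u
  have P: "P u \<in> D" "l *\<^sub>R P u - A (P u) = y + (l - m) *\<^sub>R u" if "u \<in> X" for u
    using R[of "y + (l - m) *\<^sub>R u"] that y by (auto simp: P_def)
  have contr: "nrm (P u - P v) \<le> 1/2 * nrm (u - v)" if "u \<in> X" "v \<in> X" for u v
  proof -
    have "l *\<^sub>R (P u - P v) - 1 *\<^sub>R A (P u - P v) =
        (l *\<^sub>R P u - A (P u)) - (l *\<^sub>R P v - A (P v))"
      using P that by (simp add: A_diff algebra_simps)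
    also have "\<dots> = (l - m) *\<^sub>R (u - v)"
      using P that by (simp add: algebra_simps)
    finally have "(l + \<alpha>) * nrm (P u - P v) \<le> (m - l) * nrm (u - v)"
      using coercive[of "P u - P v" l 1] P that l m by (simp add: nrm_scale)
    also have "\<dots> \<le> ((l + \<alpha>) / 2) * nrm (u - v)"
      using m l by (intro mult_right_mono) auto
    finally have "(l + \<alpha>) * nrm (P u - P v) \<le> (l + \<alpha>) * (1/2 * nrm (u - v))"
      by simp
    then show ?thesis
      using alpha_pos l by (simp only: mult_le_cancel_left_pos)
  qed
  define s where "s n = (P ^^ n) 0" for n
  have s: "s n \<in> X" for n
    by (induction n) (auto simp: s_def P)
  have "nrm (s (Suc n) - s n) \<le> nrm (s 1 - s 0) * (1/2)^n" for n
  proof (induction n)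
    case (Suc n)
    have "nrm (s (Suc (Suc n)) - s (Suc n)) \<le> 1/2 * nrm (s (Suc n) - s n)"
      using contr[OF s s, of "Suc n" n] by (simp add: s_def)
    then show ?case
      using Suc by simp
  qed simp
  then obtain u where u: "u \<in> X" "\<And>n. nrm (s n - u) \<le> 2 * nrm (s 1 - s 0) * (1/2)^n"
    using geometric_limit[of s, OF s] by blast
  have lim: "(\<lambda>n. 2 * nrm (s 1 - s 0) * (1/2)^n) \<longlonglongrightarrow> 0"
    by (rule tendsto_mult_right_zero[OF LIMSEQ_realpow_zero]) auto
  have lim1: "(\<lambda>n. nrm (s n - u)) \<longlonglongrightarrow> 0"
    by (rule tendsto_sandwich[OF _ _ tendsto_const lim]) (use u(2) in \<open>auto simp del: One_nat_def\<close>)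
  \<comment> \<open>Shifted by one index, the iterates are \<open>P (s n)\<close>, which tend to
    \<open>P u\<close> by contraction.\<close>
  have lim2: "(\<lambda>n. nrm (s n - P u)) \<longlonglongrightarrow> 0"
  proof (rule LIMSEQ_imp_Suc, rule tendsto_sandwich[OF _ _ tendsto_const lim1])
    have "nrm (s (Suc n) - P u) \<le> nrm (s n - u)" for n
      using contr[OF s u(1), of n] nrm_nonneg[of "s n - u"]
      unfolding s_def funpow.simps o_apply by linarith
    then show "\<forall>\<^sub>F n in sequentially. nrm (s (Suc n) - P u) \<le> nrm (s n - u)"
      by simp
  qed simp
  have "P u = u"
    by (rule limit_unique[OF lim2 lim1]) (use P u in auto)
  then show ?thesis
    using P[OF u(1)] by (intro bexI[of _ u]) (auto simp: algebra_simps)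
qed

lemma surj:
  assumes "0 \<le> l" "y \<in> X"
  shows "\<exists>u\<in>D. l *\<^sub>R u - A u = y"
proof -
  have "\<forall>l y. 0 \<le> l \<and> l \<le> real n * (\<alpha> / 2) \<and> y \<in> X \<longrightarrow> (\<exists>u\<in>D. l *\<^sub>R u - A u = y)" for n
  proof (induction n)
    case 0
    have "\<exists>u\<in>D. - A u = y" if y: "y \<in> X" for y
    proof -
      obtain x where "x \<in> D" "A x = y"
        using A_surj[OF y] by blast
      then show ?thesis
        using A_scale[of x "-1"] D_scale[of x "-1"] by (intro bexI[of _ "(-1) *\<^sub>R x"]) auto
    qed
    then show ?case
      by auto
  next
    case (Suc n)
    show ?case
    proof (intro allI impI)
      fix l y assume *: "0 \<le> l \<and> l \<le> real (Suc n) * (\<alpha> / 2) \<and> y \<in> X"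
      show "\<exists>u\<in>D. l *\<^sub>R u - A u = y"
      proof (cases "l \<le> real n * (\<alpha> / 2)")
        case True
        then show ?thesis
          using Suc * by blast
      next
        case False
        have n: "0 \<le> real n * (\<alpha> / 2)"
          using alpha_pos by simp
        have IH: "\<exists>u\<in>D. (real n * (\<alpha> / 2)) *\<^sub>R u - A u = z" if "z \<in> X" for z
          using Suc n that by blast
        have "l \<le> real n * (\<alpha> / 2) + \<alpha> / 2"
          using * by (simp add: algebra_simps)
        then show ?thesis
          using False * by (intro surj_step[OF n IH]) auto
      qed
    qed
  qed
  moreover obtain n where "l / (\<alpha> / 2) \<le> real n"
    using real_arch_simple by blast
  moreover from this have "l \<le> real n * (\<alpha> / 2)"
    using alpha_pos by (simp add: pos_divide_le_eq)
  ultimately show ?thesis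
    using assms by blast
qed

section \<open>The resolvent as an implicit Euler step\<close>

text \<open>\<open>res h\<close> is the resolvent \<open>(1 - h A)\<^sup>-\<^sup>1\<close>, one step of the implicit Euler scheme.\<close>
definition res :: "real \<Rightarrow> 'v \<Rightarrow> 'v" where
  "res h x = (if h = 0 then x else SOME u. u \<in> D \<and> u - h *\<^sub>R A u = x)"

lemma res_0 [simp]: "res 0 x = x"
  by (simp add: res_def)

lemma res_props:
  assumes "0 < h" "x \<in> X"
  shows "res h x \<in> D" "res h x - h *\<^sub>R A (res h x) = x"
proof -
  obtain u where "u \<in> D" "(1/h) *\<^sub>R u - A u = (1/h) *\<^sub>R x"
    using surj[of "1/h" "(1/h) *\<^sub>R x"] assms by auto
  moreover have "u - h *\<^sub>R A u = x"
  proof -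
    have "u - h *\<^sub>R A u = h *\<^sub>R ((1/h) *\<^sub>R u - A u)"
      using assms(1) by (simp add: scaleR_diff_right)
    then show ?thesis
      using calculation assms(1) by simp
  qed
  ultimately have "\<exists>u. u \<in> D \<and> u - h *\<^sub>R A u = x"
    by blast
  from someI_ex[OF this] show "res h x \<in> D" "res h x - h *\<^sub>R A (res h x) = x"
    using assms by (auto simp: res_def)
qed

lemma res_unique:
  assumes h: "0 \<le> h" and u: "u \<in> D" "u - h *\<^sub>R A u = x"
  shows "res h x = u"
proof (cases "h = 0")
  case False
  then have h: "0 < h"
    using h by simp
  have x: "x \<in> X"
    using u A_in[of u] by auto
  let ?d = "res h x - u"
  have d: "?d \<in> D"
    using res_props[OF h x] u by auto
  have "1 *\<^sub>R ?d - h *\<^sub>R A ?d = (res h x - h *\<^sub>R A (res h x)) - (u - h *\<^sub>R A u)"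
    using res_props[OF h x] u by (simp add: A_diff algebra_simps)
  then have "(1 + h * \<alpha>) * nrm ?d \<le> 0"
    using coercive[OF d, of 1 h] h u(2) res_props(2)[OF h x] by simp
  moreover have "0 < 1 + h * \<alpha>"
    using h alpha_pos by (simp add: add_pos_pos)
  ultimately have "nrm ?d = 0"
    using nrm_nonneg[of ?d] by (simp add: mult_le_0_iff)
  then show ?thesis
    using nrm_eq_zeroD[of ?d] d by auto
qed (use u in simp)

lemma res_in_X [simp]: "0 \<le> h \<Longrightarrow> x \<in> X \<Longrightarrow> res h x \<in> X"
  using res_props(1)[of h x] by (cases "h = 0") auto

lemma res_in_D [simp]: "0 \<le> h \<Longrightarrow> x \<in> D \<Longrightarrow> res h x \<in> D"
  using res_props(1)[of h x] by (cases "h = 0") auto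

lemma res_add:
  assumes "0 \<le> h" "x \<in> X" "y \<in> X"
  shows "res h (x + y) = res h x + res h y"
proof (cases "h = 0")
  case False
  then have h: "0 < h"
    using assms by simp
  have "res h x + res h y - h *\<^sub>R A (res h x + res h y) =
      (res h x - h *\<^sub>R A (res h x)) + (res h y - h *\<^sub>R A (res h y))"
    using res_props[OF h] assms by (simp add: A_add algebra_simps)
  then show ?thesis
    using res_props[OF h] assms by (intro res_unique) auto
qed simp

lemma res_scale:
  assumes "0 \<le> h" "x \<in> X"
  shows "res h (c *\<^sub>R x) = c *\<^sub>R res h x"
proof (cases "h = 0")
  case False
  then have h: "0 < h"
    using assms by simp
  have "c *\<^sub>R res h x - h *\<^sub>R A (c *\<^sub>R res h x) = c *\<^sub>R (res h x - h *\<^sub>R A (res h x))"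
    using res_props[OF h] assms by (simp add: A_scale algebra_simps)
  then show ?thesis
    using res_props[OF h] assms by (intro res_unique) auto
qed simp

lemma res_diff:
  assumes "0 \<le> h" "x \<in> X" "y \<in> X"
  shows "res h (x - y) = res h x - res h y"
proof -
  have "res h (x + (-1) *\<^sub>R y) = res h x + (-1) *\<^sub>R res h y"
    by (simp only: res_add res_scale assms X_scale)
  then show ?thesis
    by simp
qed

text \<open>The gain 1 + h \<alpha> per Euler step is the source of the decay exp (-\<alpha>
  t).\<close>

lemma res_bound:
  assumes "0 \<le> h" "x \<in> X"
  shows "(1 + h * \<alpha>) * nrm (res h x) \<le> nrm x"
proof (cases "h = 0")
  case False
  then show ?thesis
    using coercive[of "res h x" 1 h] res_props[of h x] assms by simp
qed simp

lemma res_contr: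
  assumes "0 \<le> h" "x \<in> X"
  shows "nrm (res h x) \<le> nrm x"
proof -
  have "1 * nrm (res h x) \<le> (1 + h * \<alpha>) * nrm (res h x)"
    using assms alpha_pos by (intro mult_right_mono) auto
  then show ?thesis
    using res_bound[OF assms] by simp
qed

text \<open>The equation u - h A u = x shows that A u = (u - x) / h lies in \<open>D\<close> again,
  so \<open>A\<close> may be applied to both sides.\<close>

lemma A_res:
  assumes "0 \<le> h" "x \<in> D"
  shows "A (res h x) = res h (A x)"
proof (cases "h = 0")
  case False
  then have h: "0 < h"
    using assms by simp
  let ?u = "res h x"
  have u: "?u \<in> D" "?u - h *\<^sub>R A ?u = x"
    using res_props[OF h] assms by auto
  have Au: "A ?u = (1/h) *\<^sub>R (?u - x)"
    using arg_cong[OF u(2), of "\<lambda>v. (1/h) *\<^sub>R v"] h by (simp add: algebra_simps)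
  then have "A ?u \<in> D"
    using u assms by simp
  moreover have "A (?u - h *\<^sub>R A ?u) = A ?u - h *\<^sub>R A (A ?u)"
    using u(1) calculation by (simp add: A_diff A_scale)
  ultimately show ?thesis
    using u h by (intro res_unique[symmetric]) auto
qed simp

lemma res_commute:
  assumes "0 \<le> h" "0 \<le> k" "x \<in> X"
  shows "res h (res k x) = res k (res h x)"
proof (cases "h = 0 \<or> k = 0")
  case False
  then have h: "0 < h" and k: "0 < k"
    using assms by auto
  let ?v = "res k x"
  let ?u = "res h ?v"
  have v: "?v \<in> D" "?v - k *\<^sub>R A ?v = x"
    using res_props[OF k] assms by auto
  have u: "?u \<in> D" "?u - h *\<^sub>R A ?u = ?v" "A ?u = res h (A ?v)"
    using res_props[OF h, of ?v] v A_res[of h ?v] h by auto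
  have "?u - k *\<^sub>R A ?u = res h x"
    using u(3) v A_in[OF v(1)] h res_diff[of h ?v "k *\<^sub>R A ?v"] res_scale[of h "A ?v" k] by auto
  then show ?thesis
    using res_unique[of k ?u "res h x"] k u(1) by simp
qed auto

text \<open>Domain of the square of \<open>A\<close>. The defect of composing two Euler steps is a
  multiple of A^2 u, so quantitative estimates are proved on this set and extended by
  density.\<close>

definition D2 :: "'v set" where
  "D2 = {x \<in> D. A x \<in> D}"

lemma res_D2 [simp]: "0 \<le> h \<Longrightarrow> x \<in> D2 \<Longrightarrow> res h x \<in> D2"
  by (auto simp: D2_def A_res)

lemma res_D_D2: "0 < h \<Longrightarrow> x \<in> D \<Longrightarrow> res h x \<in> D2"
  using res_props(1)[of h "A x"] A_in by (auto simp: D2_def A_res)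

lemma D2_D: "x \<in> D2 \<Longrightarrow> x \<in> D"
  by (simp add: D2_def)

lemma AA_res: "0 \<le> h \<Longrightarrow> x \<in> D2 \<Longrightarrow> A (A (res h x)) = res h (A (A x))"
  by (auto simp: D2_def A_res)

lemma AA_in: "x \<in> D2 \<Longrightarrow> A (A x) \<in> X"
  by (auto simp: D2_def intro: A_in)

text \<open>Expanding (1 - h A)(1 - k A) = 1 - (h + k) A + h k A^2 shows that u =
  \<open>res h (res k x)\<close> solves the equation for \<open>res (h + k)\<close> with right-hand
  side x - h k A^2 u; contractivity bounds the difference.\<close>

lemma res_add_time:
  assumes hk: "0 \<le> h" "0 \<le> k" and x: "x \<in> D2"
  shows "nrm (res (h + k) x - res h (res k x)) \<le> h * k * nrm (A (A x))"
proof (cases "h = 0 \<or> k = 0")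
  case False
  then have h: "0 < h" and k: "0 < k"
    using hk by auto
  let ?v = "res k x"
  let ?u = "res h ?v"
  let ?z = "res h (res k (A (A x)))"
  have v: "?v \<in> D2" "?u \<in> D2"
    using x hk by auto
  have z: "A (A ?u) = ?z" "?z \<in> X"
    using x hk AA_res[of h ?v] AA_res[of k x] v AA_in by auto
  have 1: "?u - h *\<^sub>R A ?u = ?v" "?v - k *\<^sub>R A ?v = x"
    using res_props[OF h, of ?v] res_props[OF k, of x] v x by (auto simp: D2_def)
  have "A ?v = A ?u - h *\<^sub>R A (A ?u)"
    using arg_cong[OF 1(1), of A] v by (auto simp: D2_def A_diff A_scale)
  with 1 have "?u - h *\<^sub>R A ?u - k *\<^sub>R (A ?u - h *\<^sub>R ?z) = x"
    using z by simp
  then have "?u - (h + k) *\<^sub>R A ?u = x - (h * k) *\<^sub>R ?z"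
    by (simp add: algebra_simps)
  then have "res (h + k) (x - (h * k) *\<^sub>R ?z) = ?u"
    using v hk by (intro res_unique) (auto simp: D2_def)
  then have "res (h + k) x - res (h + k) ((h * k) *\<^sub>R ?z) = ?u"
    using res_diff[of "h + k" x "(h * k) *\<^sub>R ?z"] hk x z(2) D2_D by auto
  then have "res (h + k) x - ?u = res (h + k) ((h * k) *\<^sub>R ?z)"
    by (simp add: algebra_simps)
  then have "nrm (res (h + k) x - ?u) \<le> nrm ((h * k) *\<^sub>R ?z)"
    using res_contr[of "h + k" "(h * k) *\<^sub>R ?z"] hk z by simp
  also have "\<dots> = h * k * nrm ?z"
    using hk by (simp add: nrm_scale)
  also have "nrm ?z \<le> nrm (A (A x))"
    using res_contr[of h "res k (A (A x))"] res_contr[of k "A (A x)"] hk AA_in[OF x] by simp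
  finally show ?thesis
    using hk by (simp add: mult_left_mono)
qed auto

subsection \<open>Powers of the resolvent\<close>

lemma respow_in_X [simp]: "0 \<le> h \<Longrightarrow> x \<in> X \<Longrightarrow> (res h ^^ n) x \<in> X"
  by (induction n) auto

lemma respow_D2 [simp]: "0 \<le> h \<Longrightarrow> x \<in> D2 \<Longrightarrow> (res h ^^ n) x \<in> D2"
  by (induction n) auto

lemma respow_add:
  "0 \<le> h \<Longrightarrow> x \<in> X \<Longrightarrow> y \<in> X \<Longrightarrow> (res h ^^ n) (x + y) = (res h ^^ n) x + (res h ^^ n) y"
  by (induction n) (auto simp: res_add)

lemma respow_scale: "0 \<le> h \<Longrightarrow> x \<in> X \<Longrightarrow> (res h ^^ n) (c *\<^sub>R x) = c *\<^sub>R (res h ^^ n) x"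
  by (induction n) (auto simp: res_scale)

lemma respow_diff:
  "0 \<le> h \<Longrightarrow> x \<in> X \<Longrightarrow> y \<in> X \<Longrightarrow> (res h ^^ n) (x - y) = (res h ^^ n) x - (res h ^^ n) y"
  by (induction n) (auto simp: res_diff)

lemma respow_bound:
  assumes h: "0 \<le> h" and x: "x \<in> X"
  shows "(1 + h * \<alpha>) ^ n * nrm ((res h ^^ n) x) \<le> nrm x"
proof (induction n)
  case (Suc n)
  have "(1 + h * \<alpha>) ^ Suc n * nrm ((res h ^^ Suc n) x) =
      (1 + h * \<alpha>) ^ n * ((1 + h * \<alpha>) * nrm (res h ((res h ^^ n) x)))"
    by simp
  also have "\<dots> \<le> (1 + h * \<alpha>) ^ n * nrm ((res h ^^ n) x)"
    using h alpha_pos x by (intro mult_left_mono res_bound) auto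
  finally show ?case
    using Suc by simp
qed simp

lemma respow_contr: "0 \<le> h \<Longrightarrow> x \<in> X \<Longrightarrow> nrm ((res h ^^ n) x) \<le> nrm x"
proof (induction n)
  case (Suc n)
  then show ?case
    using res_contr[of h "(res h ^^ n) x"] by simp
qed simp

lemma respow_AA: "0 \<le> h \<Longrightarrow> x \<in> D2 \<Longrightarrow> A (A ((res h ^^ n) x)) = (res h ^^ n) (A (A x))"
  by (induction n) (auto simp: AA_res)

lemma respow_commute:
  assumes "0 \<le> h" "0 \<le> k" "x \<in> X"
  shows "res h ((res k ^^ n) x) = (res k ^^ n) (res h x)"
proof (induction n)
  case (Suc n)
  then show ?case
    using res_commute[of h k "(res k ^^ n) x"] assms by simp
qed simp

text \<open>Contractivity adds the \<open>n\<close> local defects without amplification, and A^2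
  commutes with resolvents, so one constant serves along the whole iteration. Taken at
  \<open>h = k\<close> this compares consecutive dyadic levels; with different \<open>h\<close> and
  \<open>k\<close> it yields the semigroup law.\<close>

lemma respow_add_time:
  assumes hk: "0 \<le> h" "0 \<le> k" and x: "x \<in> D2"
  shows "nrm ((res (h + k) ^^ n) x - (res h ^^ n) ((res k ^^ n) x)) \<le> real n * (h * k * nrm (A (A x)))"
proof (induction n)
  case (Suc n)
  let ?y = "(res h ^^ n) ((res k ^^ n) x)"
  have y: "?y \<in> D2"
    using hk x by simp
  have X: "?y \<in> X" "x \<in> X"
    using y x D2_D by auto
  have eq: "(res h ^^ Suc n) ((res k ^^ Suc n) x) = res h (res k ?y)"
    using hk X by (simp add: respow_commute)
  have "nrm (res (h + k) ((res (h + k) ^^ n) x) - res (h + k) ?y) \<le> nrm ((res (h + k) ^^ n) x - ?y)"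
    using res_contr[of "h + k" "(res (h + k) ^^ n) x - ?y"] hk X by (simp add: res_diff)
  moreover have "nrm (res (h + k) ?y - res h (res k ?y)) \<le> h * k * nrm (A (A x))"
  proof -
    have "nrm (A (A ?y)) \<le> nrm (A (A x))"
      using hk x AA_in[OF x] respow_contr[of h "(res k ^^ n) (A (A x))" n]
        respow_contr[of k "A (A x)" n] by (simp add: respow_AA)
    then show ?thesis
      using res_add_time[OF hk y] mult_left_mono[of _ _ "h * k"] hk by (meson order_trans mult_nonneg_nonneg)
  qed
  ultimately show ?case
    using Suc nrm_triangle_sub[of "res (h + k) ((res (h + k) ^^ n) x)" "res h (res k ?y)" "res (h + k) ?y"]
    unfolding eq by (simp add: algebra_simps)
qed simp

lemma respow_double: "0 \<le> h \<Longrightarrow> x \<in> X \<Longrightarrow> (res h ^^ (2 * n)) x = (res h ^^ n) ((res h ^^ n) x)"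
  by (simp add: mult_2 funpow_add)

subsection \<open>Density\<close>

text \<open>Density of the domain comes from dissipativity: the defects p_n = x - res h_n x have
  decreasing norms and satisfy a Pythagorean inequality, so they converge in norm; the limit is then
  shown to vanish.\<close>

lemma res_limit:
  assumes x: "x \<in> X"
  shows "(\<lambda>n. nrm (res (1 / real (Suc n)) x - x)) \<longlonglongrightarrow> 0"
proof -
  define h where "h n = 1 / real (Suc n)" for n
  define p where "p n = x - res (h n) x" for n
  have h: "0 < h n" for n
    by (simp add: h_def)
  have pX: "p n \<in> X" for n
    using x h[of n] by (simp add: p_def less_imp_le)
  \<comment> \<open>Apply dissipativity to the difference of two resolvents; \<open>A\<close> maps
    each of them to a multiple of its own defect.\<close>
  have key: "(nrm (p m - p n))\<^sup>2 \<le> (nrm (p m))\<^sup>2 - (nrm (p n))\<^sup>2" if "m < n" for m n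
  proof -
    let ?a = "real (Suc n)" and ?b = "real (Suc m)"
    let ?u = "res (h n) x" and ?v = "res (h m) x"
    have uv: "?u \<in> D" "?v \<in> D"
      using res_props[OF h x] by auto
    have A: "A (res (h k) x) = - (real (Suc k) *\<^sub>R p k)" for k
    proof -
      have "p k = - (h k *\<^sub>R A (res (h k) x))"
        using res_props(2)[OF h x, of k] by (simp add: p_def algebra_simps)
      then show ?thesis
        by (simp add: h_def del: of_nat_Suc)
    qed
    have "ip (A (?u - ?v)) (?u - ?v) \<le> 0"
      using dissipative[of "?u - ?v"] uv alpha_pos ip_nonneg[of "?u - ?v"]
      by (smt (verit) D_diff mult_nonneg_nonneg mult_minus_left)
    moreover have "?u - ?v = p m - p n"
      by (simp add: p_def)
    moreover have "A (?u - ?v) = ?b *\<^sub>R p m - ?a *\<^sub>R p n"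
      using uv A by (simp add: A_diff)
    ultimately have "ip (?b *\<^sub>R p m - ?a *\<^sub>R p n) (p m - p n) \<le> 0"
      by simp
    then have 1: "?b * ip (p m) (p m) + ?a * ip (p n) (p n) \<le> (?a + ?b) * ip (p m) (p n)"
      by (simp add: ip_simps ip_commute[of "p n" "p m"] algebra_simps del: of_nat_Suc)
    have 2: "(nrm (p m - p n))\<^sup>2 = ip (p m) (p m) + ip (p n) (p n) - 2 * ip (p m) (p n)"
      by (simp add: nrm_sq ip_simps ip_commute[of "p n" "p m"])
    have ab: "?b < ?a" "0 < ?b"
      using that by auto
    have "(?a - ?b) * (nrm (p m - p n))\<^sup>2 \<le> (?a + ?b) * (nrm (p m - p n))\<^sup>2"
      using ab by (intro mult_right_mono) auto
    also have "\<dots> \<le> (?a - ?b) * ((nrm (p m))\<^sup>2 - (nrm (p n))\<^sup>2)"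
      using 1 unfolding 2 unfolding nrm_sq by (simp add: algebra_simps del: of_nat_Suc)
    finally show ?thesis
      using ab by (simp del: of_nat_Suc)
  qed
  have dec: "decseq (\<lambda>n. (nrm (p n))\<^sup>2)"
    unfolding decseq_def
  proof (intro allI impI)
    fix m n :: nat assume "m \<le> n"
    then show "(nrm (p n))\<^sup>2 \<le> (nrm (p m))\<^sup>2"
      using key[of m n] zero_le_power2[of "nrm (p m - p n)"]
      by (cases "m = n") (simp, linarith)
  qed
  obtain L where L: "(\<lambda>n. (nrm (p n))\<^sup>2) \<longlonglongrightarrow> L" "\<And>n. L \<le> (nrm (p n))\<^sup>2"
    using decseq_convergent[OF dec, of 0] zero_le_power2 by blast
  have "\<exists>l\<in>X. (\<lambda>n. nrm (p n - l)) \<longlonglongrightarrow> 0"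
  proof (rule nrm_complete[OF pX])
    fix e :: real assume e: "0 < e"
    obtain K where K: "\<forall>n\<ge>K. (nrm (p n))\<^sup>2 < L + e"
      using order_tendstoD(2)[OF L(1), of "L + e"] e by (auto simp: eventually_sequentially)
    have "(nrm (p m - p n))\<^sup>2 < e" if "K \<le> m" "K \<le> n" for m n
      using key[of m n] key[of n m] K[rule_format, OF that(1)] K[rule_format, OF that(2)] L(2)[of m] L(2)[of n]
        nrm_diff_commute[of "p m" "p n"] e
      by (cases m n rule: linorder_cases) auto
    then show "\<exists>K. \<forall>m\<ge>K. \<forall>n\<ge>K. (nrm (p m - p n))\<^sup>2 < e"
      by blast
  qed
  then obtain l where l: "l \<in> X" "(\<lambda>n. nrm (p n - l)) \<longlonglongrightarrow> 0"
    by blast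
  obtain v where v: "v \<in> D" "A v = - l"
    using A_surj[OF X_scale[OF l(1), of "-1"]] by auto
  text \<open>\<open>A (h res\<^sub>h x) = res\<^sub>h x - x \<rightarrow> - l\<close> while \<open>h res\<^sub>h x \<rightarrow> 0\<close>, so \<open>l = 0\<close> as \<open>A\<close> is closed.\<close>
  have hl: "h \<longlonglongrightarrow> 0"
    unfolding h_def by (rule LIMSEQ_Suc[OF lim_1_over_n])
  have "\<alpha> * nrm v \<le> nrm (p n - l) + \<alpha> * (h n * nrm x)" for n
  proof -
    let ?y = "h n *\<^sub>R res (h n) x"
    have y: "?y \<in> D" "A ?y = - p n"
      using res_props[OF h x, of n] by (auto simp: A_scale p_def algebra_simps)
    have "\<alpha> * nrm (?y - v) \<le> nrm (p n - l)"
      using coercive[of "?y - v" 0 1] y v by (simp add: A_diff)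
    moreover have "nrm ?y \<le> h n * nrm x"
      using res_contr[of "h n" x] h[of n] x by (simp add: nrm_scale less_imp_le)
    moreover have "nrm v \<le> nrm (?y - v) + nrm ?y"
      using nrm_triangle_sub[of v 0 ?y] nrm_diff_commute[of v ?y] by simp
    then have "\<alpha> * nrm v \<le> \<alpha> * nrm (?y - v) + \<alpha> * nrm ?y"
      using alpha_pos by (simp flip: distrib_left)
    moreover have "\<alpha> * nrm ?y \<le> \<alpha> * (h n * nrm x)"
      using alpha_pos calculation(2) by (intro mult_left_mono) auto
    ultimately show ?thesis
      by linarith
  qed
  moreover have "(\<lambda>n. nrm (p n - l) + \<alpha> * (h n * nrm x)) \<longlonglongrightarrow> 0 + \<alpha> * (0 * nrm x)"
    by (intro tendsto_intros l hl)
  ultimately have "\<alpha> * nrm v \<le> 0 + \<alpha> * (0 * nrm x)"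
    by (intro LIMSEQ_le_const[where a = "\<alpha> * nrm v"]) auto
  then have "nrm v = 0"
    using alpha_pos nrm_nonneg[of v] by (simp add: mult_le_0_iff)
  then have "v = 0"
    using nrm_eq_zeroD v by auto
  then have "l = 0"
    using v A_scale[of 0 0] by simp
  then show ?thesis
    using l(2) nrm_diff_commute[of x] by (simp add: p_def h_def)
qed

text \<open>Applying the resolvent twice lands in \<open>D2\<close>, and since it commutes with
  \<open>A\<close>, the same approximation is close in the graph norm whenever \<open>x\<close> lies
  in \<open>D\<close>.\<close>

lemma dense_D2:
  assumes x: "x \<in> X" and e: "0 < e"
  obtains y where "y \<in> D2" "nrm (y - x) < e" "x \<in> D \<Longrightarrow> nrm (A y - A x) < e"
proof -
  have approx: "\<exists>h>0. nrm (res h (res h z) - z) < e \<and> nrm (res h (res h w) - w) < e" 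
    if z: "z \<in> X" and w: "w \<in> X" for z w
  proof -
    have "\<forall>\<^sub>F n in sequentially. nrm (res (1 / real (Suc n)) z - z) < e / 2 \<and>
        nrm (res (1 / real (Suc n)) w - w) < e / 2"
      using e by (intro eventually_conj order_tendstoD(2)[OF res_limit] z w) auto
    then obtain n where n: "nrm (res (1 / real (Suc n)) z - z) < e / 2"
      "nrm (res (1 / real (Suc n)) w - w) < e / 2"
      by (auto simp: eventually_sequentially)
    let ?h = "1 / real (Suc n)"
    have "nrm (res ?h (res ?h v) - v) < e" if "v \<in> X" "nrm (res ?h v - v) < e / 2" for v
    proof -
      have "nrm (res ?h (res ?h v) - res ?h v) \<le> nrm (res ?h v - v)"
        using res_contr[of ?h "res ?h v - v"] that by (simp add: res_diff)
      then show ?thesis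
        using nrm_triangle_sub[of "res ?h (res ?h v)" v "res ?h v"] that by simp
    qed
    then show ?thesis
      using n z w by (intro exI[of _ ?h]) auto
  qed
  obtain h where h: "0 < h" "nrm (res h (res h x) - x) < e"
    "x \<in> D \<Longrightarrow> nrm (res h (res h (A x)) - A x) < e"
    using approx[OF x x] approx[OF x A_in[of x]] by (cases "x \<in> D") blast+
  show thesis
  proof (rule that[of "res h (res h x)"])
    show "res h (res h x) \<in> D2"
      using h x by (intro res_D_D2 res_props) auto
    show "nrm (A (res h (res h x)) - A x) < e" if "x \<in> D"
      using h that by (simp add: A_res)
  qed (use h in auto)
qed

subsection \<open>The semigroup\<close>

text \<open>With 2^k steps, level k + 1 splits each step of level k into two halves, which is
  exactly what \<open>respow_add_time\<close> compares.\<close>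

definition euler :: "nat \<Rightarrow> real \<Rightarrow> 'v \<Rightarrow> 'v" where
  "euler k t = res (t / 2^k) ^^ (2^k)"

lemma euler_in_X [simp]: "0 \<le> t \<Longrightarrow> x \<in> X \<Longrightarrow> euler k t x \<in> X"
  by (simp add: euler_def)

lemma euler_contr: "0 \<le> t \<Longrightarrow> x \<in> X \<Longrightarrow> nrm (euler k t x) \<le> nrm x"
  by (simp add: euler_def respow_contr)

lemma euler_diff:
  "0 \<le> t \<Longrightarrow> x \<in> X \<Longrightarrow> y \<in> X \<Longrightarrow> euler k t (x - y) = euler k t x - euler k t y"
  by (simp add: euler_def respow_diff)

lemma euler_step:
  assumes t: "0 \<le> t" and x: "x \<in> D2"
  shows "nrm (euler (Suc k) t x - euler k t x) \<le> (t\<^sup>2 / 4 * nrm (A (A x))) * (1/2)^k"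
proof -
  let ?h = "t / 2^Suc k"
  have h: "0 \<le> ?h" "?h + ?h = t / 2^k"
    using t by auto
  have "euler (Suc k) t x = (res ?h ^^ (2^k)) ((res ?h ^^ (2^k)) x)"
    using respow_double[OF h(1), of x "2^k"] x D2_D by (simp add: euler_def)
  then have "nrm (euler (Suc k) t x - euler k t x) \<le> real (2^k) * (?h * ?h * nrm (A (A x)))"
    using respow_add_time[OF h(1) h(1) x, of "2^k"] 
    unfolding h(2) by (simp add: euler_def nrm_diff_commute)
  also have "\<dots> = (t\<^sup>2 / 4 * nrm (A (A x))) * (1/2)^k"
    by (simp add: power2_eq_square power_divide field_simps)
  finally show ?thesis .
qed

lemma euler_limit_D2:
  assumes "0 \<le> t" "x \<in> D2"
  shows "\<exists>l\<in>X. \<forall>k. nrm (euler k t x - l) \<le> 2 * (t\<^sup>2 / 4 * nrm (A (A x))) * (1/2)^k"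
  by (rule geometric_limit[of "\<lambda>k. euler k t x", OF euler_in_X[OF assms(1) D_in_X[OF D2_D[OF assms(2)]]]
        euler_step[OF assms]])

lemma half_power_tendsto: "(\<lambda>k. c * (1/2::real)^k) \<longlonglongrightarrow> 0"
  by (rule tendsto_mult_right_zero[OF LIMSEQ_realpow_zero]) auto

lemma euler_limit:
  assumes t: "0 \<le> t" and x: "x \<in> X"
  shows "\<exists>l\<in>X. (\<lambda>k. nrm (euler k t x - l)) \<longlonglongrightarrow> 0"
proof (rule nrm_complete)
  fix e :: real assume e: "0 < e"
  define d where "d = sqrt e / 4"
  have d: "0 < d"
    using e by (simp add: d_def)
  obtain y where y: "y \<in> D2" "nrm (y - x) < d"
    using dense_D2[OF x d] by blast
  obtain l where l: "l \<in> X" "\<And>k. nrm (euler k t y - l) \<le> 2 * (t\<^sup>2 / 4 * nrm (A (A y))) * (1/2)^k"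
    using euler_limit_D2[OF t y(1)] by blast
  obtain K where K: "\<And>k. k \<ge> K \<Longrightarrow> 2 * (t\<^sup>2 / 4 * nrm (A (A y))) * (1/2)^k < d"
    using order_tendstoD(2)[OF half_power_tendsto d] unfolding eventually_sequentially by blast
  have *: "nrm (euler k t x - l) < 2 * d" if "K \<le> k" for k
  proof -
    have "nrm (euler k t x - euler k t y) \<le> nrm (x - y)"
      using euler_contr[of t "x - y" k] euler_diff[of t x y k] t x y D2_D by simp
    then show ?thesis
      using nrm_triangle_sub[of "euler k t x" l "euler k t y"] l(2)[of k] K[OF that] y(2)
        nrm_diff_commute[of x y] by simp
  qed
  have "(nrm (euler m t x - euler n t x))\<^sup>2 < e" if "K \<le> m" "K \<le> n" for m n
  proof -
    have "nrm (euler m t x - euler n t x) < 4 * d"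
      using *[OF that(1)] *[OF that(2)] nrm_triangle_sub[of "euler m t x" "euler n t x" l]
        nrm_diff_commute[of l "euler n t x"] by simp
    then have "(nrm (euler m t x - euler n t x))\<^sup>2 < (4 * d)\<^sup>2"
      by (intro power_strict_mono) auto
    then show ?thesis
      using e by (simp add: d_def)
  qed
  then show "\<exists>K. \<forall>m\<ge>K. \<forall>n\<ge>K. (nrm (euler m t x - euler n t x))\<^sup>2 < e"
    by blast
qed (use assms in auto)

definition semi :: "real \<Rightarrow> 'v \<Rightarrow> 'v" where
  "semi t x = (SOME l. l \<in> X \<and> (\<lambda>k. nrm (euler k t x - l)) \<longlonglongrightarrow> 0)"

lemma semi_limit:
  assumes "0 \<le> t" "x \<in> X"
  shows "semi t x \<in> X" "(\<lambda>k. nrm (euler k t x - semi t x)) \<longlonglongrightarrow> 0"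
proof -
  have "\<exists>l. l \<in> X \<and> (\<lambda>k. nrm (euler k t x - l)) \<longlonglongrightarrow> 0"
    using euler_limit[OF assms] by blast
  from someI_ex[OF this]
  show "semi t x \<in> X" "(\<lambda>k. nrm (euler k t x - semi t x)) \<longlonglongrightarrow> 0"
    unfolding semi_def by blast+
qed

lemma semi_unique:
  assumes "0 \<le> t" "x \<in> X" "l \<in> X" "(\<lambda>k. nrm (euler k t x - l)) \<longlonglongrightarrow> 0"
  shows "semi t x = l"
  by (rule limit_unique[OF semi_limit(2)[OF assms(1,2)] assms(4) semi_limit(1)[OF assms(1,2)] assms(3)])

lemma semi_0: "x \<in> X \<Longrightarrow> semi 0 x = x"
proof (rule semi_unique)
  have "(res 0 ^^ n) x = x" for n
    by (induction n) auto
  then show "(\<lambda>k. nrm (euler k 0 x - x)) \<longlonglongrightarrow> 0"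
    by (simp add: euler_def)
qed auto

lemma semi_add:
  assumes "0 \<le> t" "x \<in> X" "y \<in> X"
  shows "semi t (x + y) = semi t x + semi t y"
proof (rule semi_unique)
  have "(\<lambda>k. nrm (euler k t x - semi t x) + nrm (euler k t y - semi t y)) \<longlonglongrightarrow> 0 + 0"
    using assms by (intro tendsto_intros semi_limit)
  then have lim: "(\<lambda>k. nrm (euler k t x - semi t x) + nrm (euler k t y - semi t y)) \<longlonglongrightarrow> 0"
    by simp
  have "nrm (euler k t (x + y) - (semi t x + semi t y)) \<le>
      nrm (euler k t x - semi t x) + nrm (euler k t y - semi t y)" for k
    using nrm_triangle[of "euler k t x - semi t x" "euler k t y - semi t y"] assms
    by (simp add: euler_def respow_add algebra_simps)
  then show "(\<lambda>k. nrm (euler k t (x + y) - (semi t x + semi t y))) \<longlonglongrightarrow> 0"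
    by (intro tendsto_sandwich[OF _ _ tendsto_const lim]) auto
qed (use assms semi_limit in auto)

lemma semi_scale:
  assumes "0 \<le> t" "x \<in> X"
  shows "semi t (c *\<^sub>R x) = c *\<^sub>R semi t x"
proof (rule semi_unique)
  have "(\<lambda>k. \<bar>c\<bar> * nrm (euler k t x - semi t x)) \<longlonglongrightarrow> \<bar>c\<bar> * 0"
    using assms by (intro tendsto_intros semi_limit)
  then show "(\<lambda>k. nrm (euler k t (c *\<^sub>R x) - c *\<^sub>R semi t x)) \<longlonglongrightarrow> 0"
    using assms by (simp add: euler_def respow_scale flip: scaleR_diff_right nrm_scale)
qed (use assms semi_limit in auto)

lemma semi_diff:
  assumes "0 \<le> t" "x \<in> X" "y \<in> X"
  shows "semi t (x - y) = semi t x - semi t y"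
proof -
  have "semi t (x + (-1) *\<^sub>R y) = semi t x + (-1) *\<^sub>R semi t y"
    by (simp only: semi_add semi_scale assms X_scale)
  then show ?thesis
    by simp
qed

lemma nrm_limit_le:
  assumes "(\<lambda>k. nrm (s k - l)) \<longlonglongrightarrow> 0" "(\<lambda>k. B k) \<longlonglongrightarrow> b" "\<And>k::nat. nrm (s k) \<le> B k"
  shows "nrm l \<le> b"
proof -
  have "(\<lambda>k. B k + nrm (s k - l)) \<longlonglongrightarrow> b + 0"
    by (intro tendsto_intros assms)
  moreover have "nrm l \<le> B k + nrm (s k - l)" for k
    using nrm_le_add_diff[of l "s k"] assms(3)[of k] nrm_diff_commute[of l "s k"] by simp
  ultimately have "nrm l \<le> b + 0"
    by (intro LIMSEQ_le_const[where a = "nrm l"]) auto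
  then show ?thesis
    by simp
qed

lemma semi_contr:
  assumes "0 \<le> t" "x \<in> X"
  shows "nrm (semi t x) \<le> nrm x"
  by (rule nrm_limit_le[OF semi_limit(2)[OF assms] tendsto_const euler_contr[OF assms]])

text \<open>The Euler bounds (1 + t \<alpha> / n)^(-n), along n = 2^k, converge to the
  exponential.\<close>

lemma semi_exp:
  assumes t: "0 \<le> t" and x: "x \<in> X"
  shows "nrm (semi t x) \<le> exp (- \<alpha> * t) * nrm x"
proof (rule nrm_limit_le[OF semi_limit(2)[OF t x]])
  let ?c = "\<lambda>k::nat. (1 + t * \<alpha> / real (2^k)) ^ (2^k)"
  have pos: "0 < ?c k" for k
    using t alpha_pos by (intro zero_less_power) (simp add: add_pos_nonneg)
  have "(\<lambda>n. (1 + t * \<alpha> / real n) ^ n) \<longlonglongrightarrow> exp (t * \<alpha>)"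
    by (rule tendsto_exp_limit_sequentially)
  moreover have "filterlim (\<lambda>k::nat. 2^k :: nat) sequentially sequentially"
    by (rule filterlim_subseq) (auto simp: strict_mono_def)
  ultimately have "?c \<longlonglongrightarrow> exp (t * \<alpha>)"
    by (rule filterlim_compose)
  then have "(\<lambda>k. inverse (?c k) * nrm x) \<longlonglongrightarrow> inverse (exp (t * \<alpha>)) * nrm x"
    by (intro tendsto_intros) auto
  then show "(\<lambda>k. inverse (?c k) * nrm x) \<longlonglongrightarrow> exp (- \<alpha> * t) * nrm x"
    by (simp add: exp_minus mult.commute)
  show "nrm (euler k t x) \<le> inverse (?c k) * nrm x" for k
    using respow_bound[of "t / 2^k" x "2^k"] t x pos[of k]
    by (simp add: euler_def field_simps)
qed

text \<open>Euler approximations satisfy the semigroup law only up to a defect, which on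
  \<open>D2\<close> is at most s t |A^2 y| / 2^k at level k. Density and contractivity remove the
  restriction to \<open>D2\<close>.\<close>

lemma semi_semigroup:
  assumes s: "0 \<le> s" and t: "0 \<le> t" and x: "x \<in> X"
  shows "semi (s + t) x = semi s (semi t x)"
proof -
  have D2: "semi (s + t) y = semi s (semi t y)" if y: "y \<in> D2" for y
  proof (rule semi_unique)
    have yX: "y \<in> X"
      using y D2_D by auto
    have T: "semi t y \<in> X"
      using semi_limit t yX by auto
    let ?b = "\<lambda>k. (s * t * nrm (A (A y))) * (1/2)^k + nrm (euler k t y - semi t y)
        + nrm (euler k s (semi t y) - semi s (semi t y))"
    have "?b \<longlonglongrightarrow> 0 + 0 + 0"
      using s t yX T by (intro tendsto_add half_power_tendsto semi_limit)
    then have lim: "?b \<longlonglongrightarrow> 0"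
      by simp
    have "nrm (euler k (s + t) y - semi s (semi t y)) \<le> ?b k" for k
    proof -
      have "nrm (euler k (s + t) y - euler k s (euler k t y)) \<le>
          real (2^k) * (s / 2^k * (t / 2^k) * nrm (A (A y)))"
        using respow_add_time[of "s / 2^k" "t / 2^k" y "2^k"] s t y
        by (simp add: euler_def add_divide_distrib)
      also have "\<dots> = (s * t * nrm (A (A y))) * (1/2)^k"
        by (simp add: field_simps)
      finally have 1: "nrm (euler k (s + t) y - euler k s (euler k t y)) \<le> (s * t * nrm (A (A y))) * (1/2)^k" .
      have 2: "nrm (euler k s (euler k t y) - euler k s (semi t y)) \<le> nrm (euler k t y - semi t y)"
        using euler_contr[of s "euler k t y - semi t y" k] s t yX T by (simp add: euler_diff)
      show ?thesis
        using 1 2 nrm_triangle_sub[of "euler k (s + t) y" "semi s (semi t y)" "euler k s (euler k t y)"]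
          nrm_triangle_sub[of "euler k s (euler k t y)" "semi s (semi t y)" "euler k s (semi t y)"]
        by linarith
    qed
    then show "(\<lambda>k. nrm (euler k (s + t) y - semi s (semi t y))) \<longlonglongrightarrow> 0"
      by (intro tendsto_sandwich[OF _ _ tendsto_const lim]) auto
  qed (use y D2_D s t semi_limit in auto)
  let ?d = "semi (s + t) x - semi s (semi t x)"
  have d: "?d \<in> X"
    using s t x semi_limit by auto
  have "nrm ?d \<le> 2 * e" if e: "0 < e" for e
  proof -
    obtain y where y: "y \<in> D2" "nrm (y - x) < e"
      using dense_D2[OF x e] by blast
    have yX: "y \<in> X" "x - y \<in> X"
      using y D2_D x by auto
    have "?d = semi (s + t) (x - y) - semi s (semi t (x - y))"
      using D2[OF y(1)] s t x yX semi_limit by (simp add: semi_diff)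
    also have "nrm \<dots> \<le> nrm (x - y) + nrm (x - y)"
      using nrm_diff_le[of "semi (s + t) (x - y)" "semi s (semi t (x - y))"] 
        semi_contr[of "s + t" "x - y"] semi_contr[of s "semi t (x - y)"] semi_contr[of t "x - y"]
        s t yX semi_limit(1)[of t "x - y"] by simp
    finally show ?thesis
      using y nrm_diff_commute[of x y] by simp
  qed
  \<comment> \<open>With this tolerance the estimate reads
    \<open>nrm ?d \<le> nrm ?d / 2\<close>.\<close>
  from this[of "nrm ?d / 4"] have "nrm ?d = 0"
    using nrm_nonneg[of ?d] by (cases "nrm ?d = 0") auto
  then show ?thesis
    using nrm_eq_zeroD[OF d] by simp
qed

text \<open>An Euler step moves \<open>x\<close> by res h x - x = h res h (A x), and contractivity
  passes this on to later steps, so 2^k steps of length t / 2^k move it by at most t |A x|.\<close>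

lemma semi_sub_id:
  assumes t: "0 \<le> t" and x: "x \<in> D"
  shows "nrm (semi t x - x) \<le> t * nrm (A x)"
proof -
  have pow: "nrm ((res h ^^ n) x - x) \<le> real n * (h * nrm (A x))" if h: "0 \<le> h" for h n
  proof (induction n)
    case (Suc n)
    have "nrm (res h x - x) \<le> h * nrm (A x)"
    proof (cases "h = 0")
      case False
      then have "res h x - x = h *\<^sub>R res h (A x)"
        using res_props(2)[of h x] h x A_res[of h x] by (auto simp: algebra_simps)
      then show ?thesis
        using h res_contr[of h "A x"] A_in[OF x] by (simp add: nrm_scale mult_left_mono)
    qed simp
    moreover have "nrm (res h ((res h ^^ n) x) - res h x) \<le> nrm ((res h ^^ n) x - x)"
      using res_contr[of h "(res h ^^ n) x - x"] h x by (simp add: res_diff)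
    ultimately show ?case
      using Suc nrm_triangle_sub[of "res h ((res h ^^ n) x)" x "res h x"] by (simp add: algebra_simps)
  qed simp
  have "nrm (euler k t x - x) \<le> t * nrm (A x)" for k
    using pow[of "t / 2^k" "2^k"] t by (simp add: euler_def)
  then show ?thesis
    using semi_limit(2)[OF t D_in_X[OF x]]
    by (intro nrm_limit_le[where s = "\<lambda>k. euler k t x - x" and l = "semi t x - x", OF _ tendsto_const]) simp_all
qed

text \<open>A single Euler step is the link: level 0 of the scheme differs from the semigroup by
  O(t^2), and res t x - x - t A x = t^2 res t (A^2 x).\<close>

lemma semi_derivative_D2:
  assumes t: "0 < t" and x: "x \<in> D2"
  shows "nrm ((1/t) *\<^sub>R (semi t x - x) - A x) \<le> 2 * t * nrm (A (A x))"
proof -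
  have xX: "x \<in> X" "x \<in> D" "A x \<in> D"
    using x by (auto simp: D2_def)
  obtain l where l: "l \<in> X" "\<And>k. nrm (euler k t x - l) \<le> 2 * (t\<^sup>2 / 4 * nrm (A (A x))) * (1/2)^k"
    using euler_limit_D2[of t x] t x by auto
  have "(\<lambda>k. nrm (euler k t x - l)) \<longlonglongrightarrow> 0"
    by (rule tendsto_sandwich[OF _ _ tendsto_const
          half_power_tendsto[of "2 * (t\<^sup>2 / 4 * nrm (A (A x)))"]])
      (intro always_eventually allI l nrm_nonneg)+
  then have "l = semi t x"
    using semi_unique[of t x l] t xX l by simp
  then have 1: "nrm (res t x - semi t x) \<le> t\<^sup>2 / 2 * nrm (A (A x))"
    using l(2)[of 0] by (simp add: euler_def)
  have r: "res t y - y = t *\<^sub>R res t (A y)" if "y \<in> D" for y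
    using res_props(2)[of t y] t that A_res[of t y] by (auto simp: algebra_simps)
  have "res t x - x - t *\<^sub>R A x = t *\<^sub>R (res t (A x) - A x)"
    using r[of x] xX by (simp add: algebra_simps)
  also have "\<dots> = t\<^sup>2 *\<^sub>R res t (A (A x))"
    using r[of "A x"] xX by (simp add: power2_eq_square)
  finally have 2: "nrm (res t x - x - t *\<^sub>R A x) \<le> t\<^sup>2 * nrm (A (A x))"
    using res_contr[of t "A (A x)"] t AA_in[OF x] by (simp add: nrm_scale mult_left_mono)
  have "semi t x - x - t *\<^sub>R A x = (semi t x - res t x) + (res t x - x - t *\<^sub>R A x)"
    by simp
  then have "nrm (semi t x - x - t *\<^sub>R A x) \<le> nrm (semi t x - res t x) + nrm (res t x - x - t *\<^sub>R A x)"
    by (simp only: nrm_triangle)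
  also have "\<dots> \<le> 2 * t\<^sup>2 * nrm (A (A x))"
    using 1 2 nrm_diff_commute[of "res t x" "semi t x"]
      mult_nonneg_nonneg[OF zero_le_power2[of t] nrm_nonneg[of "A (A x)"]] by linarith
  finally have "(1/t) * nrm (semi t x - x - t *\<^sub>R A x) \<le> (1/t) * (2 * t\<^sup>2 * nrm (A (A x)))"
    using t by (intro mult_left_mono) auto
  moreover have "(1/t) * nrm (semi t x - x - t *\<^sub>R A x) = nrm ((1/t) *\<^sub>R (semi t x - x) - A x)"
    using t nrm_scale[of "1/t" "semi t x - x - t *\<^sub>R A x"] by (simp add: scaleR_diff_right)
  ultimately show ?thesis
    using t by (simp add: power2_eq_square)
qed

text \<open>Approximate \<open>x\<close> by \<open>y0\<close> in the graph norm. The difference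
  quotient of x - y0 is bounded uniformly in t by |A (x - y0)|, so \<open>y0\<close> can be fixed
  before t tends to 0.\<close>

lemma semi_derivative:
  assumes x: "x \<in> D"
  shows "((\<lambda>t. nrm ((1/t) *\<^sub>R (semi t x - x) - A x)) \<longlongrightarrow> 0) (at_right 0)"
proof (rule tendstoI)
  fix e :: real assume e: "0 < e"
  have xX: "x \<in> X"
    using x by auto
  obtain y0 where y0: "y0 \<in> D2" "nrm (y0 - x) < e / 4" "nrm (A y0 - A x) < e / 4"
    using dense_D2[OF xX, of "e / 4"] e x by auto
  let ?d = "x - y0"
  have dD: "?d \<in> D" "A ?d = A x - A y0"
    using x y0 D2_D A_diff by auto
  \<comment> \<open>Chosen so that the second-order error \<open>2 * t * nrm (A (A y0))\<close> is
    at most e / 4.\<close>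
  define \<delta> where "\<delta> = e / 8 / (nrm (A (A y0)) + 1)"
  have \<delta>: "0 < \<delta>"
    using e nrm_nonneg[of "A (A y0)"] by (simp add: \<delta>_def add_nonneg_pos)
  have "nrm ((1/t) *\<^sub>R (semi t x - x) - A x) < e" if t: "0 < t" "t < \<delta>" for t
  proof -
    have eq: "(1/t) *\<^sub>R (semi t x - x) - A x =
       (1/t) *\<^sub>R (semi t ?d - ?d) + (((1/t) *\<^sub>R (semi t y0 - y0) - A y0) + (A y0 - A x))"
    proof -
      have sd: "semi t ?d = semi t x - semi t y0"
        using t xX y0 D2_D by (intro semi_diff) auto
      show ?thesis
        unfolding sd by (simp add: algebra_simps)
    qed
    have "nrm ((1/t) *\<^sub>R (semi t ?d - ?d)) = (1/t) * nrm (semi t ?d - ?d)"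
      using t by (simp only: nrm_scale) simp
    also have "\<dots> \<le> (1/t) * (t * nrm (A ?d))"
      using t by (intro mult_left_mono semi_sub_id dD) auto
    also have "\<dots> = nrm (A x - A y0)"
      using t dD by simp
    finally have 1: "nrm ((1/t) *\<^sub>R (semi t ?d - ?d)) \<le> e / 4"
      using y0(3) nrm_diff_commute[of "A x" "A y0"] by linarith
    have "t * nrm (A (A y0)) \<le> \<delta> * (nrm (A (A y0)) + 1)"
      using t by (intro mult_mono) auto
    also have "\<dots> = e / 8"
      using nrm_nonneg[of "A (A y0)"] unfolding \<delta>_def
      by (subst nonzero_eq_divide_eq[symmetric]) linarith+
    finally have 2: "nrm ((1/t) *\<^sub>R (semi t y0 - y0) - A y0) \<le> e / 4"
      using semi_derivative_D2[OF t(1) y0(1)] by simp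
    show ?thesis
      using 1 2 y0(3) e nrm_triangle[of "(1/t) *\<^sub>R (semi t ?d - ?d)" "((1/t) *\<^sub>R (semi t y0 - y0) - A y0) + (A y0 - A x)"]
        nrm_triangle[of "(1/t) *\<^sub>R (semi t y0 - y0) - A y0" "A y0 - A x"]
      unfolding eq by linarith
  qed
  then have "\<forall>\<^sub>F t in at_right 0. nrm ((1/t) *\<^sub>R (semi t x - x) - A x) < e"
    using \<delta> by (auto simp: eventually_at_right intro!: exI[of _ \<delta>])
  then show "\<forall>\<^sub>F t in at_right 0. dist (nrm ((1/t) *\<^sub>R (semi t x - x) - A x)) 0 < e"
    by (simp add: dist_real_def)
qed

lemma semi_continuous:
  assumes x: "x \<in> X"
  shows "((\<lambda>t. nrm (semi t x - x)) \<longlongrightarrow> 0) (at_right 0)"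
proof (rule tendstoI)
  fix e :: real assume e: "0 < e"
  obtain y where y: "y \<in> D2" "nrm (y - x) < e / 4"
    using dense_D2[OF x, of "e / 4"] e by auto
  have yX: "y \<in> D" "y \<in> X"
    using y D2_D by auto
  define \<delta> where "\<delta> = e / 4 / (nrm (A y) + 1)"
  have \<delta>: "0 < \<delta>"
    using e nrm_nonneg[of "A y"] by (simp add: \<delta>_def add_nonneg_pos)
  have "nrm (semi t x - x) < e" if t: "0 < t" "t < \<delta>" for t
  proof -
    have "t * nrm (A y) \<le> \<delta> * (nrm (A y) + 1)"
      using t by (intro mult_mono) auto
    also have "\<dots> = e / 4"
      using nrm_nonneg[of "A y"] unfolding \<delta>_def
      by (subst nonzero_eq_divide_eq[symmetric]) linarith+
    finally have 1: "nrm (semi t y - y) \<le> e / 4"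
      using semi_sub_id[of t y] t yX by simp
    have 2: "nrm (semi t x - semi t y) \<le> nrm (x - y)"
      using semi_contr[of t "x - y"] semi_diff[of t x y] t x yX by simp
    show ?thesis
      using 1 2 y e nrm_triangle_sub[of "semi t x" x "semi t y"] nrm_triangle_sub[of "semi t y" x y]
        nrm_diff_commute[of x y] by linarith
  qed
  then have "\<forall>\<^sub>F t in at_right 0. nrm (semi t x - x) < e"
    using \<delta> by (auto simp: eventually_at_right intro!: exI[of _ \<delta>])
  then show "\<forall>\<^sub>F t in at_right 0. dist (nrm (semi t x - x)) 0 < e"
    by (simp add: dist_real_def)
qed

text \<open>Solving u - A u = x - y gives a competitor in \<open>D\<close>. If (x, y) belongs to the
  generator, then d = x - u satisfies T(t) d = (1 + t) d up to o(t), which contractivity allows only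
  for d = 0. Hence the generator is no larger than \<open>A\<close>.\<close>

lemma semi_generator:
  assumes x: "x \<in> X" and y: "y \<in> X"
    and lim: "((\<lambda>t. nrm ((1/t) *\<^sub>R (semi t x - x) - y)) \<longlongrightarrow> 0) (at_right 0)"
  shows "x \<in> D \<and> y = A x"
proof -
  define u where "u = res 1 (x - y)"
  have u: "u \<in> D" "u - A u = x - y"
    using res_props[of 1 "x - y"] x y by (auto simp: u_def)
  let ?d = "x - u"
  have d: "?d \<in> X"
    using x u by auto
  have "((\<lambda>t. nrm ((1/t) *\<^sub>R (semi t x - x) - y) + nrm ((1/t) *\<^sub>R (semi t u - u) - A u)) \<longlongrightarrow> 0 + 0) (at_right 0)"
    by (intro tendsto_intros lim semi_derivative u)
  moreover have "\<forall>\<^sub>F t in at_right 0. nrm ?d \<le>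
     nrm ((1/t) *\<^sub>R (semi t x - x) - y) + nrm ((1/t) *\<^sub>R (semi t u - u) - A u)"
  proof (rule eventually_mono[OF eventually_at_right_less])
    fix t :: real assume t: "0 < t"
    let ?p = "(1/t) *\<^sub>R (semi t x - x) - y" and ?q = "(1/t) *\<^sub>R (semi t u - u) - A u"
    have "y - A u = ?d"
      using u(2) by (simp add: algebra_simps)
    moreover have sd: "semi t ?d = semi t x - semi t u"
      using t x u by (intro semi_diff) auto
    have "?p - ?q = (1/t) *\<^sub>R (semi t ?d - ?d) - (y - A u)"
      unfolding sd by (simp add: algebra_simps)
    ultimately have "?p - ?q = (1/t) *\<^sub>R (semi t ?d - ?d) - ?d"
      by simp
    then have "t *\<^sub>R (?p - ?q) = t *\<^sub>R ((1/t) *\<^sub>R (semi t ?d - ?d) - ?d)"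
      by simp
    also have "\<dots> = semi t ?d - (1 + t) *\<^sub>R ?d"
      using t by (simp add: scaleR_diff_right scaleR_left_distrib)
    finally have "t *\<^sub>R (?p - ?q) = semi t ?d - (1 + t) *\<^sub>R ?d" .
    then have eq: "(1 + t) *\<^sub>R ?d = semi t ?d - t *\<^sub>R (?p - ?q)"
      by simp
    have "(1 + t) * nrm ?d = nrm ((1 + t) *\<^sub>R ?d)"
      using t by (simp add: nrm_scale)
    also have "\<dots> \<le> nrm (semi t ?d) + nrm (t *\<^sub>R (?p - ?q))"
      unfolding eq by (rule nrm_diff_le)
    also have "\<dots> \<le> nrm ?d + t * (nrm ?p + nrm ?q)"
      using t semi_contr[of t ?d] d nrm_diff_le[of ?p ?q] by (simp only: nrm_scale) 
        (intro add_mono mult_mono, auto)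
    finally have "t * nrm ?d \<le> t * (nrm ?p + nrm ?q)"
      unfolding distrib_right by linarith
    then show "nrm ?d \<le> nrm ?p + nrm ?q"
      using t by simp
  qed
  ultimately have "nrm ?d \<le> 0 + 0"
    by (intro tendsto_lowerbound[where F = "at_right 0"]) auto
  then have "nrm ?d = 0"
    using nrm_nonneg[of ?d] by simp
  then have "x = u"
    using nrm_eq_zeroD[OF d] by simp
  then show ?thesis
    using u by (auto simp: algebra_simps)
qed

text \<open>\<open>nrm\<close> is the norm in which contraction and decay were proved;
  \<open>N\<close> is merely comparable to it. Limits to 0 are the same for both, and the decay
  estimate loses the factor C / c.\<close>

lemma generates_stable_semigroup:
  assumes c: "0 < c" and C: "0 < C"
    and N: "\<And>x. x \<in> X \<Longrightarrow> c * nrm x \<le> N x" "\<And>x. x \<in> X \<Longrightarrow> N x \<le> C * nrm x"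
  shows "generates X N D A semi \<and> exponentially_stable X N semi"
proof -
  have N0: "0 \<le> N x" if "x \<in> X" for x
    using N(1)[OF that] c nrm_nonneg[of x] by (meson mult_nonneg_nonneg less_imp_le order_trans)

  have Nlim: "((\<lambda>t. N (f t)) \<longlongrightarrow> 0) (at_right 0) \<longleftrightarrow> ((\<lambda>t. nrm (f t)) \<longlongrightarrow> 0) (at_right 0)"
    if f: "\<And>t. 0 < t \<Longrightarrow> f t \<in> X" for f :: "real \<Rightarrow> 'v"
  proof
    assume "((\<lambda>t. N (f t)) \<longlongrightarrow> 0) (at_right 0)"
    then have l: "((\<lambda>t. (1/c) * N (f t)) \<longlongrightarrow> 0) (at_right 0)"
      by (rule tendsto_mult_right_zero)
    show "((\<lambda>t. nrm (f t)) \<longlongrightarrow> 0) (at_right 0)"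
      by (rule tendsto_sandwich[OF _ eventually_mono[OF eventually_at_right_less] tendsto_const l])
        (use N(1)[OF f] c in \<open>auto simp: field_simps\<close>)
  next
    assume "((\<lambda>t. nrm (f t)) \<longlongrightarrow> 0) (at_right 0)"
    then have l: "((\<lambda>t. C * nrm (f t)) \<longlongrightarrow> 0) (at_right 0)"
      by (rule tendsto_mult_right_zero)
    show "((\<lambda>t. N (f t)) \<longlongrightarrow> 0) (at_right 0)"
      by (rule tendsto_sandwich[OF eventually_mono[OF eventually_at_right_less]
            eventually_mono[OF eventually_at_right_less] tendsto_const l])
        (use N0[OF f] N(2)[OF f] in auto)
  qed
  have bound: "N (semi t x) \<le> (C / c) * exp (- \<alpha> * t) * N x" if t: "0 \<le> t" and x: "x \<in> X" for t x
  proof -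
    have "N (semi t x) \<le> C * nrm (semi t x)"
      using N(2) semi_limit(1)[OF t x] by blast
    also have "\<dots> \<le> C * (exp (- \<alpha> * t) * nrm x)"
      using C semi_exp[OF t x] by (intro mult_left_mono) auto
    also have "\<dots> \<le> C * (exp (- \<alpha> * t) * (N x / c))"
      using C c N(1)[OF x] by (intro mult_left_mono) (auto simp: field_simps)
    finally show ?thesis
      by simp
  qed
  have sg: "C0_semigroup X N semi"
    unfolding C0_semigroup_def bounded_op_on_def
  proof (intro conjI allI ballI impI)
    fix t :: real assume t: "0 \<le> t"
    show "\<exists>B. \<forall>x\<in>X. N (semi t x) \<le> B * N x"
      using bound[OF t] by blast
  next
    fix x assume "x \<in> X"
    then show "((\<lambda>t. N (semi t x - x)) \<longlongrightarrow> 0) (at_right 0)"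
      using semi_continuous semi_limit(1) by (subst Nlim) auto
  qed (auto simp: semi_limit semi_add semi_scale semi_0 semi_semigroup)
  have gr: "generator_graph X N semi = {(x, A x) |x. x \<in> D}"
  proof -
    have *: "((\<lambda>t. N ((1/t) *\<^sub>R (semi t x - x) - y)) \<longlongrightarrow> 0) (at_right 0) \<longleftrightarrow>
        ((\<lambda>t. nrm ((1/t) *\<^sub>R (semi t x - x) - y)) \<longlongrightarrow> 0) (at_right 0)"
      if "x \<in> X" "y \<in> X" for x y
      using that semi_limit(1) by (intro Nlim) auto
    show ?thesis
    proof (intro set_eqI iffI)
      fix z assume "z \<in> generator_graph X N semi"
      then show "z \<in> {(x, A x) |x. x \<in> D}"
        using semi_generator[of "fst z" "snd z"] *[of "fst z" "snd z"]
        by (cases z) (simp add: generator_graph_def)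
    next
      fix z assume "z \<in> {(x, A x) |x. x \<in> D}"
      then show "z \<in> generator_graph X N semi"
        using semi_derivative * A_in by (fastforce simp: generator_graph_def)
    qed
  qed
  have "op_norm_on X N (semi t) \<le> max 1 (C / c) * exp (- \<alpha> * t)" if t: "0 \<le> t" for t
    unfolding op_norm_on_def
  proof (rule cSUP_least)
    show "X \<noteq> {}"
      using X_zero by blast
    fix x assume x: "x \<in> X"
    have "N (semi t x) \<le> max 1 (C / c) * exp (- \<alpha> * t) * N x"
      using N0[OF x] by (intro order_trans[OF bound[OF t x]] mult_right_mono) auto
    \<comment> \<open>When \<open>N x = 0\<close> the quotient is 0 by the convention for
      division.\<close>
    then show "N (semi t x) / N x \<le> max 1 (C / c) * exp (- \<alpha> * t)"
      using N0[OF x] by (cases "N x = 0") (auto simp: pos_divide_le_eq)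
  qed
  then have "exponentially_stable X N semi"
    unfolding exponentially_stable_def using alpha_pos
    by (intro exI[of _ "max 1 (C / c)"] conjI exI[of _ \<alpha>]) auto
  then show ?thesis
    using sg gr by (simp add: generates_def)
qed

end

subsection \<open>The space of square-integrable functions\<close>

definition sqi :: "(real \<Rightarrow> real) \<Rightarrow> bool" where
  "sqi f \<longleftrightarrow> f \<in> borel_measurable lborel \<and> integrable lborel (\<lambda>z. (f z)\<^sup>2)"

lemma sqi_measurable: "sqi f \<Longrightarrow> f \<in> borel_measurable borel"
  by (simp add: sqi_def)

lemma sqi_mult_integrable:
  assumes "sqi f" "sqi g"
  shows "integrable lborel (\<lambda>z. f z * g z)"
proof (rule Bochner_Integration.integrable_bound)
  show "integrable lborel (\<lambda>z. (f z)\<^sup>2 + (g z)\<^sup>2)"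
    using assms by (auto simp: sqi_def)
  show "(\<lambda>z. f z * g z) \<in> borel_measurable lborel"
    using assms by (auto simp: sqi_def)
  have "\<bar>u * v\<bar> \<le> u\<^sup>2 + v\<^sup>2" for u v :: real
    using zero_le_power2[of "\<bar>u\<bar> - \<bar>v\<bar>"] zero_le_power2[of u] zero_le_power2[of v]
      mult_nonneg_nonneg[OF abs_ge_zero[of u] abs_ge_zero[of v]]
    unfolding power2_diff abs_mult power2_abs by linarith
  then show "AE z in lborel. norm (f z * g z) \<le> norm ((f z)\<^sup>2 + (g z)\<^sup>2)"
    by simp
qed

lemma sqi_bounded_mult:
  assumes "sqi f" "h \<in> borel_measurable borel" "\<And>z. \<bar>h z\<bar> \<le> B"
  shows "sqi (\<lambda>z. h z * f z)"
  unfolding sqi_def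
proof
  show "(\<lambda>z. h z * f z) \<in> borel_measurable lborel"
    using assms by (auto simp: sqi_def)
  show "integrable lborel (\<lambda>z. (h z * f z)\<^sup>2)"
  proof (rule Bochner_Integration.integrable_bound)
    show "integrable lborel (\<lambda>z. B\<^sup>2 * (f z)\<^sup>2)"
      using assms by (auto simp: sqi_def)
    show "(\<lambda>z. (h z * f z)\<^sup>2) \<in> borel_measurable lborel"
      using assms by (auto simp: sqi_def)
    have "(h z * f z)\<^sup>2 \<le> B\<^sup>2 * (f z)\<^sup>2" for z
      using power_mono[OF assms(3)[of z], of 2] by (simp add: power_mult_distrib mult_right_mono)
    then show "AE z in lborel. norm ((h z * f z)\<^sup>2) \<le> norm (B\<^sup>2 * (f z)\<^sup>2)"
      by simp
  qed
qed

lemma sqi_add: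
  assumes "sqi f" "sqi g"
  shows "sqi (\<lambda>z. f z + g z)"
proof -
  have "integrable lborel (\<lambda>z. (f z)\<^sup>2 + (g z)\<^sup>2 + 2 * (f z * g z))"
    using assms sqi_mult_integrable[OF assms]
    by (intro Bochner_Integration.integrable_add integrable_mult_right) (auto simp: sqi_def)
  then show ?thesis
    using assms by (auto simp: sqi_def power2_sum mult.assoc)
qed

lemma sqi_minus: "sqi f \<Longrightarrow> sqi (\<lambda>z. - f z)"
  by (auto simp: sqi_def)

lemma sqi_diff: "sqi f \<Longrightarrow> sqi g \<Longrightarrow> sqi (\<lambda>z. f z - g z)"
  using sqi_add[of f "\<lambda>z. - g z"] sqi_minus[of g] by simp

lemma sqi_cong_AE:
  assumes "sqi f" "g \<in> borel_measurable borel" "AE z in lborel. f z = g z"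
  shows "sqi g"
proof -
  have "integrable lborel (\<lambda>z. (f z)\<^sup>2) \<longleftrightarrow> integrable lborel (\<lambda>z. (g z)\<^sup>2)"
    using assms by (intro integrable_cong_AE) (auto simp: sqi_def elim: AE_mp)
  then show ?thesis
    using assms by (simp add: sqi_def)
qed

lemma sqi_indicator:
  assumes "sqi f" "S \<in> sets borel"
  shows "sqi (\<lambda>z. indicator S z * f z)"
  by (rule sqi_bounded_mult[OF assms(1) borel_measurable_indicator[OF assms(2)], of 1])
    (simp split: split_indicator)

lemma power2_norm_vec2: "(norm (v::real^2))\<^sup>2 = (v $ 1)\<^sup>2 + (v $ 2)\<^sup>2"
  by (simp only: power2_norm_eq_inner inner_vec_def sum_2) (simp add: power2_eq_square)

lemma borel_measurable_vec2_iff: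
  "(F :: real \<Rightarrow> real^2) \<in> borel_measurable borel \<longleftrightarrow>
     (\<lambda>z. F z $ 1) \<in> borel_measurable borel \<and> (\<lambda>z. F z $ 2) \<in> borel_measurable borel"
  by (subst borel_measurable_euclidean_space) (simp add: Basis_vec_def inner_axis forall_2)

lemma sq_integrable_iff:
  "sq_integrable F \<longleftrightarrow> sqi (\<lambda>z. F z $ 1) \<and> sqi (\<lambda>z. F z $ 2)"
proof
  assume F: "sq_integrable F"
  then have m: "(\<lambda>z. F z $ 1) \<in> borel_measurable borel" "(\<lambda>z. F z $ 2) \<in> borel_measurable borel"
    using borel_measurable_vec2_iff[of F] by (auto simp: sq_integrable_def)
  have "integrable lborel (\<lambda>z. (F z $ i)\<^sup>2)" if "i = 1 \<or> i = 2" for i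
  proof (rule Bochner_Integration.integrable_bound)
    show "integrable lborel (\<lambda>z. (norm (F z))\<^sup>2)"
      using F by (simp add: sq_integrable_def)
    show "AE z in lborel. norm ((F z $ i)\<^sup>2) \<le> norm ((norm (F z))\<^sup>2)"
      using that by (auto simp: power2_norm_vec2)
  qed (use m that in auto)
  then show "sqi (\<lambda>z. F z $ 1) \<and> sqi (\<lambda>z. F z $ 2)"
    using m by (simp add: sqi_def)
next
  assume "sqi (\<lambda>z. F z $ 1) \<and> sqi (\<lambda>z. F z $ 2)"
  then show "sq_integrable F"
    using borel_measurable_vec2_iff[of F] by (simp add: sq_integrable_def sqi_def power2_norm_vec2)
qed

text \<open>Riesz-Fischer for a rapidly Cauchy sequence. The factors 4^j are outweighed by (1/8)^j,
  so the series of 4^j |f_(j+1) - f_j|^2 has finite integral and converges almost everywhere; there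
  the increments are O(2^(-j)).\<close>

lemma sqi_limit_of_fast_subsequence:
  fixes f :: "nat \<Rightarrow> real \<Rightarrow> real"
  assumes f: "\<And>n. sqi (f n)"
    and d: "\<And>j. (LINT z|lborel. (f (Suc j) z - f j z)\<^sup>2) \<le> (1/8)^j"
  shows "\<exists>g. g \<in> borel_measurable borel \<and> (AE z in lborel. (\<lambda>j. f j z) \<longlonglongrightarrow> g z)"
proof -
  have [measurable]: "f n \<in> borel_measurable borel" for n
    using f by (rule sqi_measurable)
  let ?d = "\<lambda>j z. 4^j * (f (Suc j) z - f j z)\<^sup>2"
  have int: "integrable lborel (\<lambda>z. (f (Suc j) z - f j z)\<^sup>2)" for j
    using sqi_diff[OF f f, of "Suc j" j] by (simp add: sqi_def)
  have "(\<integral>\<^sup>+z. (\<Sum>j. ennreal (?d j z)) \<partial>lborel) = (\<Sum>j. \<integral>\<^sup>+z. ennreal (?d j z) \<partial>lborel)"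
    by (rule nn_integral_suminf) measurable
  also have "\<dots> \<le> (\<Sum>j. ennreal ((1/2)^j))"
  proof (rule suminf_le)
    fix j
    have "(\<integral>\<^sup>+z. ennreal (?d j z) \<partial>lborel) = ennreal (LINT z|lborel. ?d j z)"
      using int by (intro nn_integral_eq_integral) auto
    also have "(LINT z|lborel. ?d j z) \<le> 4^j * (1/8)^j"
      using d[of j] by simp
    also have "(4::real)^j * (1/8)^j = (1/2)^j"
      by (simp flip: power_mult_distrib)
    finally show "(\<integral>\<^sup>+z. ennreal (?d j z) \<partial>lborel) \<le> ennreal ((1/2)^j)"
      by (simp add: ennreal_leI)
  qed auto
  also have "\<dots> = ennreal (\<Sum>j. (1/2)^j)"
    by (intro suminf_ennreal2) (auto intro: summable_geometric)
  finally have "(\<integral>\<^sup>+z. (\<Sum>j. ennreal (?d j z)) \<partial>lborel) \<noteq> \<infinity>"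
    by (auto simp: top_unique)
  then have "AE z in lborel. (\<Sum>j. ennreal (?d j z)) \<noteq> \<infinity>"
    by (intro nn_integral_noteq_infinite) auto
  then have ae: "AE z in lborel. convergent (\<lambda>j. f j z)"
  proof (rule AE_mp, intro AE_I2 impI)
    fix z assume fin: "(\<Sum>j. ennreal (?d j z)) \<noteq> \<infinity>"
    have "summable (\<lambda>j. ?d j z)"
      using fin by (intro summable_suminf_not_top) auto
    then have "(\<lambda>j. ?d j z) \<longlonglongrightarrow> 0"
      by (rule summable_LIMSEQ_zero)
    then have "Bseq (\<lambda>j. ?d j z)"
      by (intro convergent_imp_Bseq) (auto simp: convergent_def)
    then obtain C where C: "\<And>j. norm (?d j z) \<le> C" "0 < C"
      by (auto simp: Bseq_def)
    have le: "norm (f (Suc j) z - f j z) \<le> sqrt C * (1/2)^j" for j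
    proof (rule power2_le_imp_le)
      have "(f (Suc j) z - f j z)\<^sup>2 \<le> C * (1/4)^j"
        using C(1)[of j] by (simp add: power_one_over field_simps)
      also have "\<dots> = (sqrt C * (1/2)^j)\<^sup>2"
      proof -
        have "((1/2::real)^j)\<^sup>2 = (1/4)^j"
          by (simp add: power2_eq_square flip: power_mult_distrib)
        then show ?thesis
          using C(2) by (simp add: power_mult_distrib)
      qed
      finally show "(norm (f (Suc j) z - f j z))\<^sup>2 \<le> (sqrt C * (1/2)^j)\<^sup>2"
        by simp
    qed (use C in simp)
    have "summable (\<lambda>j. sqrt C * (1/2)^j)"
      by (intro summable_mult summable_geometric) simp
    from summable_comparison_test'[OF this le]
    have "summable (\<lambda>j. f (Suc j) z - f j z)" .
    then have "convergent (\<lambda>n. f 0 z + (\<Sum>j<n. f (Suc j) z - f j z))"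
      by (intro convergent_add convergent_const) (simp add: summable_iff_convergent)
    then show "convergent (\<lambda>j. f j z)"
      using sum_lessThan_telescope[of "\<lambda>j. f j z"] by simp
  qed
  have "(\<lambda>z. lim (\<lambda>j. f j z)) \<in> borel_measurable borel"
    by measurable
  moreover have "AE z in lborel. (\<lambda>j. f j z) \<longlonglongrightarrow> lim (\<lambda>j. f j z)"
    using ae by (auto simp: convergent_LIMSEQ_iff)
  ultimately show ?thesis
    by blast
qed

lemma sqi_complete:
  fixes f :: "nat \<Rightarrow> real \<Rightarrow> real"
  assumes f: "\<And>n. sqi (f n)"
    and cau: "\<And>e. 0 < e \<Longrightarrow> \<exists>K. \<forall>m\<ge>K. \<forall>n\<ge>K. (LINT z|lborel. (f m z - f n z)\<^sup>2) < e"
  shows "\<exists>g. sqi g \<and> (\<lambda>n. LINT z|lborel. (f n z - g z)\<^sup>2) \<longlonglongrightarrow> 0"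
proof -
  have [measurable]: "f n \<in> borel_measurable borel" for n
    using f by (rule sqi_measurable)
  have "\<forall>j. \<exists>K. \<forall>m\<ge>K. \<forall>n\<ge>K. (LINT z|lborel. (f m z - f n z)\<^sup>2) < (1/8)^j"
    using cau by simp
  then obtain K where K: "\<And>j m n. K j \<le> m \<Longrightarrow> K j \<le> n \<Longrightarrow> (LINT z|lborel. (f m z - f n z)\<^sup>2) < (1/8)^j"
    by metis
  \<comment> \<open>Summing all thresholds up to \<open>j\<close> makes \<open>r j\<close> and
    \<open>r (Suc j)\<close> both dominate \<open>K j\<close>; the added \<open>j\<close> sends the
    indices to infinity.\<close>
  define r where "r j = j + (\<Sum>i\<le>j. K i)" for j
  have r: "K j \<le> r j" "K j \<le> r (Suc j)" "j \<le> r j" for j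
  proof -
    have "K j \<le> (\<Sum>i\<le>j. K i)"
      by (rule member_le_sum) auto
    then show "K j \<le> r j" "K j \<le> r (Suc j)" "j \<le> r j"
      by (auto simp: r_def)
  qed
  obtain g where g[measurable]: "g \<in> borel_measurable borel"
    and lim: "AE z in lborel. (\<lambda>j. f (r j) z) \<longlonglongrightarrow> g z"
    using sqi_limit_of_fast_subsequence[of "\<lambda>j. f (r j)"] f K[OF r(2) r(1)] less_imp_le by blast
  \<comment> \<open>Fatou's lemma transfers the Cauchy bound to the almost everywhere limit of the
    subsequence.\<close>
  have fatou: "integrable lborel (\<lambda>z. (f n z - g z)\<^sup>2) \<and> (LINT z|lborel. (f n z - g z)\<^sup>2) \<le> e"
    if e: "0 < e" and N: "\<And>m. N \<le> m \<Longrightarrow> (LINT z|lborel. (f n z - f m z)\<^sup>2) < e" for n N e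
  proof -
    have "(\<integral>\<^sup>+z. ennreal ((f n z - g z)\<^sup>2) \<partial>lborel) =
        (\<integral>\<^sup>+z. liminf (\<lambda>j. ennreal ((f n z - f (r j) z)\<^sup>2)) \<partial>lborel)"
    proof (rule nn_integral_cong_AE, rule AE_mp[OF lim], intro AE_I2 impI)
      fix z assume "(\<lambda>j. f (r j) z) \<longlonglongrightarrow> g z"
      then have "(\<lambda>j. ennreal ((f n z - f (r j) z)\<^sup>2)) \<longlonglongrightarrow> ennreal ((f n z - g z)\<^sup>2)"
        by (intro tendsto_intros)
      then show "ennreal ((f n z - g z)\<^sup>2) = liminf (\<lambda>j. ennreal ((f n z - f (r j) z)\<^sup>2))"
        by (intro lim_imp_Liminf[symmetric]) auto
    qed
    also have "\<dots> \<le> liminf (\<lambda>j. \<integral>\<^sup>+z. ennreal ((f n z - f (r j) z)\<^sup>2) \<partial>lborel)"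
      by (intro nn_integral_liminf) measurable
    also have "\<dots> \<le> limsup (\<lambda>j. \<integral>\<^sup>+z. ennreal ((f n z - f (r j) z)\<^sup>2) \<partial>lborel)"
      by (rule Liminf_le_Limsup) auto
    also have "\<dots> \<le> ennreal e"
    proof (rule Limsup_bounded, rule eventually_mono[OF eventually_ge_at_top[of N]])
      fix j assume j: "N \<le> j"
      have "(\<integral>\<^sup>+z. ennreal ((f n z - f (r j) z)\<^sup>2) \<partial>lborel) = ennreal (LINT z|lborel. (f n z - f (r j) z)\<^sup>2)"
        using sqi_diff[OF f f, of n "r j"] by (intro nn_integral_eq_integral) (auto simp: sqi_def)
      also have "\<dots> \<le> ennreal e"
        using N[of "r j"] j r(3)[of j] by (intro ennreal_leI) simp
      finally show "(\<integral>\<^sup>+z. ennreal ((f n z - f (r j) z)\<^sup>2) \<partial>lborel) \<le> ennreal e" .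
    qed
    finally have le: "(\<integral>\<^sup>+z. ennreal ((f n z - g z)\<^sup>2) \<partial>lborel) \<le> ennreal e" .
    have int: "integrable lborel (\<lambda>z. (f n z - g z)\<^sup>2)"
    proof (rule integrableI_bounded)
      show "(\<integral>\<^sup>+z. ennreal (norm ((f n z - g z)\<^sup>2)) \<partial>lborel) < \<infinity>"
        using le_less_trans[OF le] by simp
    qed measurable
    moreover have "(LINT z|lborel. (f n z - g z)\<^sup>2) \<le> e"
      using le e nn_integral_eq_integral[OF int] by (simp add: ennreal_le_iff)
    ultimately show ?thesis
      by blast
  qed
  obtain N0 where "\<forall>m\<ge>N0. \<forall>n\<ge>N0. (LINT z|lborel. (f m z - f n z)\<^sup>2) < 1"
    using cau[of 1] by auto
  then have "sqi (\<lambda>z. f N0 z - g z)"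
    using fatou[of 1 N0 N0] by (simp add: sqi_def)
  then have g_sqi: "sqi g"
    using sqi_diff[OF f, of "\<lambda>z. f N0 z - g z" N0] by simp
  have "(\<lambda>n. LINT z|lborel. (f n z - g z)\<^sup>2) \<longlonglongrightarrow> 0"
  proof (rule LIMSEQ_I)
    fix e :: real assume e: "0 < e"
    obtain N where N: "\<forall>m\<ge>N. \<forall>n\<ge>N. (LINT z|lborel. (f m z - f n z)\<^sup>2) < e / 2"
      using cau[of "e / 2"] e by auto
    have "(LINT z|lborel. (f n z - g z)\<^sup>2) < e" if "N \<le> n" for n
      using fatou[of "e / 2" N n] N that e by auto
    moreover have "0 \<le> (LINT z|lborel. (f n z - g z)\<^sup>2)" for n
      by (rule integral_nonneg_AE) simp
    ultimately show "\<exists>N. \<forall>n\<ge>N. norm ((LINT z|lborel. (f n z - g z)\<^sup>2) - 0) < e"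
      by auto
  qed
  then show ?thesis
    using g_sqi by blast
qed

subsection \<open>Representatives\<close>

lemma sq_integrable_rep: "sq_integrable (rep_L2R2 x)"
  using Quotient3_rep_reflp[OF Quotient3_L2R2, of x] by (simp add: ae_eq_def)

lemma rep_abs:
  assumes "sq_integrable f"
  shows "AE z in lborel. rep_L2R2 (abs_L2R2 f) z = f z"
  using Quotient3_rep_abs[OF Quotient3_L2R2, of f] assms by (simp add: ae_eq_def)

lemma L2R2_eqI:
  assumes "AE z in lborel. rep_L2R2 x z = rep_L2R2 y z"
  shows "x = y"
proof -
  have "ae_eq (rep_L2R2 x) (rep_L2R2 y)"
    using assms by (simp add: ae_eq_def sq_integrable_rep)
  then have "abs_L2R2 (rep_L2R2 x) = abs_L2R2 (rep_L2R2 y)"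
    by (rule Quotient3_rel_abs[OF Quotient3_L2R2])
  then show ?thesis
    by (simp add: Quotient3_abs_rep[OF Quotient3_L2R2])
qed

lemma component_sqi: "sqi (component x i)"
proof -
  have "i = 1 \<or> i = 2"
    by (rule exhaust_2)
  then show ?thesis
    using sq_integrable_rep[of x] by (auto simp: sq_integrable_iff component_def)
qed

lemma component_measurable [measurable]: "component x i \<in> borel_measurable borel"
  by (rule sqi_measurable[OF component_sqi])

lemma L2R2_eqI_component:
  assumes "AE z in lborel. component x 1 z = component y 1 z"
    and "AE z in lborel. component x 2 z = component y 2 z"
  shows "x = y"
proof (rule L2R2_eqI)
  show "AE z in lborel. rep_L2R2 x z = rep_L2R2 y z"
    using assms by eventually_elim (simp add: component_def vec_eq_iff forall_2)
qed

lemma component_abs: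
  assumes "sq_integrable f"
  shows "AE z in lborel. component (abs_L2R2 f) i z = f z $ i"
  using rep_abs[OF assms] by eventually_elim (simp add: component_def)

text \<open>Equality holds only almost everywhere, since \<open>rep_L2R2\<close> picks a
  representative of each class independently.\<close>

lemma component_add: "AE z in lborel. component (x + y) i z = component x i z + component y i z"
proof -
  have "AE z in lborel. component (abs_L2R2 (\<lambda>z. rep_L2R2 x z + rep_L2R2 y z)) i z =
      (rep_L2R2 x z + rep_L2R2 y z) $ i"
    by (intro component_abs sq_integrable_add sq_integrable_rep)
  then show ?thesis
    by (simp add: plus_L2R2_def) (simp add: component_def)
qed

lemma component_scale: "AE z in lborel. component (c *\<^sub>R x) i z = c * component x i z"
proof -
  have "AE z in lborel. component (abs_L2R2 (\<lambda>z. c *\<^sub>R rep_L2R2 x z)) i z =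
      (c *\<^sub>R rep_L2R2 x z) $ i"
    by (intro component_abs sq_integrable_scaleR sq_integrable_rep)
  then show ?thesis
    by (simp add: scaleR_L2R2_def) (simp add: component_def)
qed

lemma component_zero: "AE z in lborel. component 0 i z = 0"
  using component_abs[OF sq_integrable_zero, of i] by (simp add: zero_L2R2_def)

lemma component_diff: "AE z in lborel. component (x - y) i z = component x i z - component y i z"
  using component_add[of x "(-1) *\<^sub>R y" i] component_scale[of "-1" y i]
  by eventually_elim simp

lemma L2_space_iff:
  "x \<in> L2_space a b \<longleftrightarrow>
     (AE z in lborel. z \<notin> {a..b} \<longrightarrow> component x 1 z = 0 \<and> component x 2 z = 0)"
  by (simp add: L2_space_def component_def vec_eq_iff forall_2)

lemma subspace_L2_space: "subspace (L2_space a b)"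
proof (rule subspaceI)
  show "0 \<in> L2_space a b"
    unfolding L2_space_iff using component_zero[of 1] component_zero[of 2] by eventually_elim simp
  fix x y assume *: "x \<in> L2_space a b" "y \<in> L2_space a b"
  then show "x + y \<in> L2_space a b"
    unfolding L2_space_iff using component_add[of x y 1] component_add[of x y 2]
    by eventually_elim simp
next
  fix c x assume "x \<in> L2_space a b"
  then show "c *\<^sub>R x \<in> L2_space a b"
    unfolding L2_space_iff using component_scale[of c x 1] component_scale[of c x 2]
    by eventually_elim simp
qed

lemma sq_integrable_vector:
  assumes "sqi f" "sqi g"
  shows "sq_integrable (\<lambda>z. vector [f z, g z])"
  using assms by (simp add: sq_integrable_iff)

subsection \<open>Weighted inner products\<close>

text \<open>The inner product with the symmetric weight matrix \<open>((p, q), (q, s))\<close>.\<close>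
definition wip :: "(real \<Rightarrow> real) \<Rightarrow> (real \<Rightarrow> real) \<Rightarrow> (real \<Rightarrow> real) \<Rightarrow> L2R2 \<Rightarrow> L2R2 \<Rightarrow> real" where
  "wip p q s x y = (LINT z|lborel. p z * (component x 1 z * component y 1 z)
     + q z * (component x 1 z * component y 2 z + component x 2 z * component y 1 z)
     + s z * (component x 2 z * component y 2 z))"

locale bounded_weight =
  fixes p q s :: "real \<Rightarrow> real" and B :: real
  assumes weight_measurable [measurable]: "p \<in> borel_measurable borel" "q \<in> borel_measurable borel"
      "s \<in> borel_measurable borel"
    and weight_bounded: "\<bar>p z\<bar> \<le> B" "\<bar>q z\<bar> \<le> B" "\<bar>s z\<bar> \<le> B"
begin

lemma bounded_mult_integrable:
  assumes "h \<in> borel_measurable borel" "\<And>z. \<bar>h z\<bar> \<le> B"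
  shows "integrable lborel (\<lambda>z. h z * (component x i z * component y j z))"
  using sqi_mult_integrable[OF sqi_bounded_mult[OF component_sqi assms] component_sqi, of x i y j]
  by (simp add: mult.assoc)

lemma wip_integrable:
  "integrable lborel (\<lambda>z. p z * (component x 1 z * component y 1 z)
     + q z * (component x 1 z * component y 2 z + component x 2 z * component y 1 z)
     + s z * (component x 2 z * component y 2 z))"
  unfolding distrib_left
  by (intro Bochner_Integration.integrable_add bounded_mult_integrable weight_measurable weight_bounded)

lemma wip_commute: "wip p q s x y = wip p q s y x"
  unfolding wip_def by (intro Bochner_Integration.integral_cong) (auto simp: algebra_simps)

lemma wip_add_left: "wip p q s (x + y) w = wip p q s x w + wip p q s y w"
proof -
  have "wip p q s (x + y) w = (LINT z|lborel. (p z * (component x 1 z * component w 1 z)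
     + q z * (component x 1 z * component w 2 z + component x 2 z * component w 1 z)
     + s z * (component x 2 z * component w 2 z)) + (p z * (component y 1 z * component w 1 z)
     + q z * (component y 1 z * component w 2 z + component y 2 z * component w 1 z)
     + s z * (component y 2 z * component w 2 z)))"
    unfolding wip_def
  proof (rule integral_cong_AE)
    show "AE z in lborel. p z * (component (x + y) 1 z * component w 1 z)
     + q z * (component (x + y) 1 z * component w 2 z + component (x + y) 2 z * component w 1 z)
     + s z * (component (x + y) 2 z * component w 2 z) = (p z * (component x 1 z * component w 1 z)
     + q z * (component x 1 z * component w 2 z + component x 2 z * component w 1 z)
     + s z * (component x 2 z * component w 2 z)) + (p z * (component y 1 z * component w 1 z)
     + q z * (component y 1 z * component w 2 z + component y 2 z * component w 1 z)
     + s z * (component y 2 z * component w 2 z))"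
      using component_add[of x y 1] component_add[of x y 2]
      by eventually_elim (simp add: algebra_simps)
  qed measurable
  also have "\<dots> = wip p q s x w + wip p q s y w"
    unfolding wip_def by (intro Bochner_Integration.integral_add wip_integrable)
  finally show ?thesis .
qed

lemma wip_scale_left: "wip p q s (c *\<^sub>R x) w = c * wip p q s x w"
proof -
  have "wip p q s (c *\<^sub>R x) w = (LINT z|lborel. c * (p z * (component x 1 z * component w 1 z)
     + q z * (component x 1 z * component w 2 z + component x 2 z * component w 1 z)
     + s z * (component x 2 z * component w 2 z)))"
    unfolding wip_def
  proof (rule integral_cong_AE)
    show "AE z in lborel. p z * (component (c *\<^sub>R x) 1 z * component w 1 z)
     + q z * (component (c *\<^sub>R x) 1 z * component w 2 z + component (c *\<^sub>R x) 2 z * component w 1 z)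
     + s z * (component (c *\<^sub>R x) 2 z * component w 2 z) = c * (p z * (component x 1 z * component w 1 z)
     + q z * (component x 1 z * component w 2 z + component x 2 z * component w 1 z)
     + s z * (component x 2 z * component w 2 z))"
      using component_scale[of c x 1] component_scale[of c x 2]
      by eventually_elim (simp add: algebra_simps)
  qed measurable
  also have "\<dots> = c * wip p q s x w"
    unfolding wip_def by simp
  finally show ?thesis .
qed

end

definition sqn :: "L2R2 \<Rightarrow> real" where
  "sqn x = (LINT z|lborel. (component x 1 z)\<^sup>2 + (component x 2 z)\<^sup>2)"

lemma component_sq_integrable: "integrable lborel (\<lambda>z. (component x i z)\<^sup>2)"
  using component_sqi[of x i] by (simp add: sqi_def)

lemma sqn_nonneg: "0 \<le> sqn x"
  unfolding sqn_def by (rule integral_nonneg_AE) simp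

lemma sqn_zeroD:
  assumes "sqn x = 0"
  shows "x = 0"
proof -
  have "AE z in lborel. (component x 1 z)\<^sup>2 + (component x 2 z)\<^sup>2 = 0"
    using assms integral_nonneg_eq_0_iff_AE[of lborel "\<lambda>z. (component x 1 z)\<^sup>2 + (component x 2 z)\<^sup>2"]
      component_sq_integrable by (simp add: sqn_def)
  then have "AE z in lborel. component x 1 z = 0 \<and> component x 2 z = 0"
    by eventually_elim (simp add: add_nonneg_eq_0_iff)
  then have "AE z in lborel. component x 1 z = component 0 1 z \<and> component x 2 z = component 0 2 z"
    using component_zero[of 1] component_zero[of 2] by eventually_elim simp
  then show ?thesis
    by (intro L2R2_eqI_component) auto
qed

lemma sqn_split:
  "sqn (x - y) = (LINT z|lborel. (component x 1 z - component y 1 z)\<^sup>2)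
     + (LINT z|lborel. (component x 2 z - component y 2 z)\<^sup>2)"
proof -
  have "sqn (x - y) = (LINT z|lborel. (component x 1 z - component y 1 z)\<^sup>2
      + (component x 2 z - component y 2 z)\<^sup>2)"
    unfolding sqn_def
  proof (rule integral_cong_AE)
    show "AE z in lborel. (component (x - y) 1 z)\<^sup>2 + (component (x - y) 2 z)\<^sup>2 =
        (component x 1 z - component y 1 z)\<^sup>2 + (component x 2 z - component y 2 z)\<^sup>2"
      using component_diff[of x y 1] component_diff[of x y 2] by eventually_elim simp
  qed measurable
  also have "\<dots> = (LINT z|lborel. (component x 1 z - component y 1 z)\<^sup>2)
     + (LINT z|lborel. (component x 2 z - component y 2 z)\<^sup>2)"
    using sqi_diff[OF component_sqi component_sqi]
    by (intro Bochner_Integration.integral_add) (auto simp: sqi_def)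
  finally show ?thesis .
qed

lemma L2_space_complete:
  assumes s: "\<And>n. s n \<in> L2_space a b"
    and cau: "\<And>e. 0 < e \<Longrightarrow> \<exists>K. \<forall>m\<ge>K. \<forall>n\<ge>K. sqn (s m - s n) < e"
  shows "\<exists>l\<in>L2_space a b. (\<lambda>n::nat. sqn (s n - l)) \<longlonglongrightarrow> 0"
proof -
  have comp_le: "(LINT z|lborel. (component x i z - component y i z)\<^sup>2) \<le> sqn (x - y)" for x y i
  proof -
    have "0 \<le> (LINT z|lborel. (component x j z - component y j z)\<^sup>2)" for j
      by (rule integral_nonneg_AE) simp
    then show ?thesis
      using exhaust_2[of i] sqn_split[of x y] by (metis le_add_same_cancel1 le_add_same_cancel2)
  qed
  have "\<exists>g. sqi g \<and> (\<lambda>n. LINT z|lborel. (component (s n) i z - g z)\<^sup>2) \<longlonglongrightarrow> 0" for i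
  proof (rule sqi_complete[OF component_sqi])
    fix e :: real assume "0 < e"
    then obtain K where "\<forall>m\<ge>K. \<forall>n\<ge>K. sqn (s m - s n) < e"
      using cau by blast
    then show "\<exists>K. \<forall>m\<ge>K. \<forall>n\<ge>K. (LINT z|lborel. (component (s m) i z - component (s n) i z)\<^sup>2) < e"
      using comp_le le_less_trans by blast
  qed
  then have "\<exists>g. \<forall>i. sqi (g i) \<and> (\<lambda>n. LINT z|lborel. (component (s n) i z - g i z)\<^sup>2) \<longlonglongrightarrow> 0"
    by (intro choice) blast
  then obtain g where g: "\<And>i. sqi (g i)"
    "\<And>i. (\<lambda>n. LINT z|lborel. (component (s n) i z - g i z)\<^sup>2) \<longlonglongrightarrow> 0"
    by blast
  \<comment> \<open>Cutting the limit off to [a,b] can only reduce its distance to the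
    \<open>s n\<close>, which vanish outside.\<close>
  define h where "h i z = indicator {a..b} z * g i z" for i z
  have h: "sqi (h i)" for i
    unfolding h_def by (intro sqi_indicator g) auto
  have lim: "(\<lambda>n. LINT z|lborel. (component (s n) i z - h i z)\<^sup>2) \<longlonglongrightarrow> 0" for i
  proof (rule tendsto_sandwich[OF _ _ tendsto_const g(2)[of i]])
    have "(LINT z|lborel. (component (s n) i z - h i z)\<^sup>2) \<le> (LINT z|lborel. (component (s n) i z - g i z)\<^sup>2)" for n
    proof (rule integral_mono_AE)
      show "integrable lborel (\<lambda>z. (component (s n) i z - h i z)\<^sup>2)"
        "integrable lborel (\<lambda>z. (component (s n) i z - g i z)\<^sup>2)"
        using sqi_diff[OF component_sqi h] sqi_diff[OF component_sqi g(1)] by (auto simp: sqi_def)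
      show "AE z in lborel. (component (s n) i z - h i z)\<^sup>2 \<le> (component (s n) i z - g i z)\<^sup>2"
        using s[of n] unfolding L2_space_iff
      proof eventually_elim
        case (elim z)
        then show ?case
          using exhaust_2[of i] by (cases "z \<in> {a..b}") (auto simp: h_def)
      qed
    qed
    then show "\<forall>\<^sub>F n in sequentially. (LINT z|lborel. (component (s n) i z - h i z)\<^sup>2)
        \<le> (LINT z|lborel. (component (s n) i z - g i z)\<^sup>2)"
      by simp
  qed (auto intro: always_eventually)
  define l where "l = abs_L2R2 (\<lambda>z. vector [h 1 z, h 2 z])"
  have l1: "AE z in lborel. component l 1 z = h 1 z" and l2: "AE z in lborel. component l 2 z = h 2 z"
    using component_abs[OF sq_integrable_vector[OF h h], of 1 2 1]
      component_abs[OF sq_integrable_vector[OF h h], of 1 2 2] by (simp_all add: l_def)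
  have "l \<in> L2_space a b"
    unfolding L2_space_iff using l1 l2 by eventually_elim (simp add: h_def)
  moreover have "sqn (s n - l) = (LINT z|lborel. (component (s n) 1 z - h 1 z)\<^sup>2)
      + (LINT z|lborel. (component (s n) 2 z - h 2 z)\<^sup>2)" for n
  proof -
    have [measurable]: "h i \<in> borel_measurable borel" for i
      using h by (rule sqi_measurable)
    have "(LINT z|lborel. (component (s n) 1 z - component l 1 z)\<^sup>2) = (LINT z|lborel. (component (s n) 1 z - h 1 z)\<^sup>2)"
    proof (rule integral_cong_AE)
      show "AE z in lborel. (component (s n) 1 z - component l 1 z)\<^sup>2 = (component (s n) 1 z - h 1 z)\<^sup>2"
        using l1 by eventually_elim simp
    qed measurable
    moreover have "(LINT z|lborel. (component (s n) 2 z - component l 2 z)\<^sup>2) = (LINT z|lborel. (component (s n) 2 z - h 2 z)\<^sup>2)"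
    proof (rule integral_cong_AE)
      show "AE z in lborel. (component (s n) 2 z - component l 2 z)\<^sup>2 = (component (s n) 2 z - h 2 z)\<^sup>2"
        using l2 by eventually_elim simp
    qed measurable
    ultimately show ?thesis
      by (simp add: sqn_split)
  qed
  moreover have "(\<lambda>n. (LINT z|lborel. (component (s n) 1 z - h 1 z)\<^sup>2)
      + (LINT z|lborel. (component (s n) 2 z - h 2 z)\<^sup>2)) \<longlonglongrightarrow> 0 + 0"
    by (intro tendsto_add lim)
  ultimately show ?thesis
    by (intro bexI[of _ l]) simp_all
qed

subsection \<open>Absolutely continuous functions\<close>

lemma set_integrable_Ioo_iff_Icc:
  "set_integrable lborel {c<..<d} (f :: real \<Rightarrow> real) \<longleftrightarrow> set_integrable lborel {c..d} f"
  by (rule set_integrable_discrete_difference[of "{c, d}"]) auto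

lemma set_integral_Ioo_eq_Icc:
  "(LINT z:{c<..<d}|lborel. f z) = (LINT z:{c..d}|lborel. (f :: real \<Rightarrow> real) z)"
  by (rule set_integral_discrete_difference[of "{c, d}"]) auto

text \<open>Absolute continuity as being an indefinite integral: the density \<open>f\<close> is
  part of the data and is not recovered by pointwise differentiation.\<close>

definition ac_on :: "real \<Rightarrow> real \<Rightarrow> (real \<Rightarrow> real) \<Rightarrow> (real \<Rightarrow> real) \<Rightarrow> bool" where
  "ac_on c d F f \<longleftrightarrow> set_integrable lborel {c..d} f \<and>
     (\<forall>z\<in>{c..d}. F z = F c + (LINT s:{c..z}|lborel. f s))"

lemma ac_onD:
  assumes "ac_on c d F f"
  shows "set_integrable lborel {c..d} f" "\<And>z. z \<in> {c..d} \<Longrightarrow> F z = F c + (LINT s:{c..z}|lborel. f s)"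
  using assms unfolding ac_on_def by blast+

lemma set_integrable_subinterval:
  "set_integrable lborel {c..d} f \<Longrightarrow> c \<le> p \<Longrightarrow> q \<le> d \<Longrightarrow> set_integrable lborel {p..q} (f :: real \<Rightarrow> real)"
  by (rule set_integrable_subset) auto

lemma ac_on_indefinite:
  assumes "set_integrable lborel {c..d} f" "c \<le> d"
  shows "ac_on c d (\<lambda>z. C + (LINT s:{c..z}|lborel. f s)) f"
proof -
  have "(LINT s:{c..c}|lborel. f s) = 0"
    using set_integral_Ioo_eq_Icc[of c c f] by (simp add: set_lebesgue_integral_def)
  then show ?thesis
    using assms by (simp add: ac_on_def)
qed

lemma ac_on_continuous:
  assumes F: "ac_on c d F f"
  shows "continuous_on {c..d} F"
proof -
  have "continuous_on {c..d} (\<lambda>z. F c + integral {c..z} f)"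
    using set_borel_integral_eq_integral(1)[OF ac_onD(1)[OF F]]
    by (intro continuous_intros indefinite_integral_continuous_1)
  moreover have "F c + integral {c..z} f = F z" if "z \<in> {c..d}" for z
    using ac_onD(2)[OF F that] set_borel_integral_eq_integral(2)[of "{c..z}" f]
      set_integrable_subinterval[OF ac_onD(1)[OF F], of c z] that by simp
  ultimately show ?thesis
    by (rule continuous_on_eq) simp
qed

lemma ac_on_subinterval:
  assumes F: "ac_on c d F f" and sub: "c \<le> p" "p \<le> q" "q \<le> d"
  shows "ac_on p q F f"
  unfolding ac_on_def
proof (intro conjI ballI)
  show int: "set_integrable lborel {p..q} f"
    using set_integrable_subinterval[OF ac_onD(1)[OF F]] sub by simp
  fix z assume z: "z \<in> {p..q}"
  have "(LINT s:{c..z}|lborel. f s) = (LINT s:{c..p} \<union> {p<..z}|lborel. f s)"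
    using z sub by (intro arg_cong[where f = "\<lambda>S. LINT s:S|lborel. f s"]) auto
  also have "\<dots> = (LINT s:{c..p}|lborel. f s) + (LINT s:{p<..z}|lborel. f s)"
    using z sub by (intro set_integral_Un set_integrable_subset[OF ac_onD(1)[OF F]]) auto
  also have "(LINT s:{p<..z}|lborel. f s) = (LINT s:{p..z}|lborel. f s)"
    by (rule set_integral_discrete_difference[of "{p}"]) auto
  finally show "F z = F p + (LINT s:{p..z}|lborel. f s)"
    using ac_onD(2)[OF F, of z] ac_onD(2)[OF F, of p] z sub by simp
qed

lemma ac_on_C1:
  assumes "\<And>z. z \<in> {c..d} \<Longrightarrow> (F has_real_derivative f z) (at z within {c..d})"
    and "continuous_on {c..d} f"
  shows "ac_on c d F f"
  unfolding ac_on_def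
proof (intro conjI ballI)
  show "set_integrable lborel {c..d} f"
    using assms(2) by (rule borel_integrable_atLeastAtMost')
  fix z assume z: "z \<in> {c..d}"
  have "(LINT s|lborel. indicator {c..z} s *\<^sub>R f s) = F z - F c"
  proof (rule integral_FTC_atLeastAtMost)
    show "(F has_vector_derivative f x) (at x within {c..z})" if "c \<le> x" "x \<le> z" for x
      using assms(1)[of x] that z
      by (auto simp flip: has_real_derivative_iff_has_vector_derivative intro: DERIV_subset)
    show "continuous_on {c..z} f"
      using assms(2) by (rule continuous_on_subset) (use z in auto)
  qed (use z in auto)
  then show "F z = F c + (LINT s:{c..z}|lborel. f s)"
    by (simp add: set_lebesgue_integral_def)
qed

lemma ac_on_add:
  assumes F: "ac_on c d F f" and G: "ac_on c d G g"
  shows "ac_on c d (\<lambda>z. F z + G z) (\<lambda>z. f z + g z)"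
  unfolding ac_on_def
proof (intro conjI ballI)
  show "set_integrable lborel {c..d} (\<lambda>z. f z + g z)"
    using ac_onD(1)[OF F] ac_onD(1)[OF G] by (rule set_integral_add)
  fix z assume z: "z \<in> {c..d}"
  have "(LINT s:{c..z}|lborel. f s + g s) = (LINT s:{c..z}|lborel. f s) + (LINT s:{c..z}|lborel. g s)"
    using z by (intro set_integral_add set_integrable_subinterval[OF ac_onD(1)[OF F]]
        set_integrable_subinterval[OF ac_onD(1)[OF G]]) auto
  then show "F z + G z = F c + G c + (LINT s:{c..z}|lborel. f s + g s)"
    using ac_onD(2)[OF F z] ac_onD(2)[OF G z] by simp
qed

lemma ac_on_cmult:
  assumes F: "ac_on c d F f"
  shows "ac_on c d (\<lambda>z. k * F z) (\<lambda>z. k * f z)"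
  unfolding ac_on_def
proof (intro conjI ballI)
  show "set_integrable lborel {c..d} (\<lambda>z. k * f z)"
    using ac_onD(1)[OF F] by simp
  fix z assume z: "z \<in> {c..d}"
  show "k * F z = k * F c + (LINT s:{c..z}|lborel. k * f s)"
    using ac_onD(2)[OF F z] by (simp add: distrib_left)
qed

lemma set_integrable_continuous_mult:
  assumes f: "set_integrable lborel {c..d} f" and G: "continuous_on {c..d} (G :: real \<Rightarrow> real)"
  shows "set_integrable lborel {c..d} (\<lambda>z. f z * G z)"
proof -
  obtain B where "\<forall>y\<in>G ` {c..d}. norm y \<le> B"
    using compact_imp_bounded[OF compact_continuous_image[OF G compact_Icc]]
    unfolding bounded_iff by blast
  then have B: "\<bar>G z\<bar> \<le> B" if "z \<in> {c..d}" for z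
    using that by simp
  have m: "(\<lambda>z. indicator {c..d} z *\<^sub>R f z) \<in> borel_measurable lborel"
    using f unfolding set_integrable_def by (rule borel_measurable_integrable)
  have mG: "(\<lambda>z. indicator {c..d} z *\<^sub>R G z) \<in> borel_measurable borel"
    using G by (intro borel_measurable_continuous_on_indicator) auto
  show ?thesis
    unfolding set_integrable_def
  proof (rule Bochner_Integration.integrable_bound)
    show "integrable lborel (\<lambda>z. B * (indicator {c..d} z *\<^sub>R f z))"
      using f unfolding set_integrable_def by (rule integrable_mult_right)
    have "(\<lambda>z. (indicator {c..d} z *\<^sub>R f z) * (indicator {c..d} z *\<^sub>R G z)) \<in> borel_measurable lborel"
      using m mG by simp
    also have "(\<lambda>z. (indicator {c..d} z *\<^sub>R f z) * (indicator {c..d} z *\<^sub>R G z)) =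
        (\<lambda>z. indicator {c..d} z *\<^sub>R (f z * G z))"
      by (auto split: split_indicator)
    finally show "(\<lambda>z. indicator {c..d} z *\<^sub>R (f z * G z)) \<in> borel_measurable lborel" .
    have "norm (indicator {c..d} z *\<^sub>R (f z * G z)) \<le> norm (B * (indicator {c..d} z *\<^sub>R f z))" for z
    proof (cases "z \<in> {c..d}")
      case True
      then have "\<bar>f z\<bar> * \<bar>G z\<bar> \<le> \<bar>f z\<bar> * \<bar>B\<bar>"
        using B[OF True] by (intro mult_left_mono) auto
      then show ?thesis
        using True by (simp add: abs_mult mult.commute)
    qed simp
    then show "AE z in lborel. norm (indicator {c..d} z *\<^sub>R (f z * G z))
        \<le> norm (B * (indicator {c..d} z *\<^sub>R f z))"
      by simp
  qed
qed

text \<open>Integration by parts without differentiability: both integrals are evaluated by Fubini's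
  theorem on the triangle \<open>s \<le> t\<close>.\<close>
lemma ac_on_by_parts:
  assumes F: "ac_on c d F f" and G: "ac_on c d G g" and cd: "c \<le> d"
  shows "(LINT z:{c..d}|lborel. f z * G z) + (LINT z:{c..d}|lborel. g z * F z) = F d * G d - F c * G c"
proof -
  define u where "u = (\<lambda>z. indicator {c..d} z *\<^sub>R f z)"
  define v where "v = (\<lambda>z. indicator {c..d} z *\<^sub>R g z)"
  have int: "integrable lborel u" "integrable lborel v"
    using ac_onD(1)[OF F] ac_onD(1)[OF G] by (simp_all add: u_def v_def set_integrable_def)
  note [measurable] = borel_measurable_integrable[OF int(1), simplified]
    borel_measurable_integrable[OF int(2), simplified]
  define k where "k s t = (if s \<le> t then u s * v t else 0)" for s t
  have [measurable]: "case_prod k \<in> borel_measurable (lborel \<Otimes>\<^sub>M lborel)"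
    unfolding k_def by measurable
  have kint: "integrable (lborel \<Otimes>\<^sub>M lborel) (case_prod k)"
  proof (rule Bochner_Integration.integrable_bound)
    show "integrable (lborel \<Otimes>\<^sub>M lborel) (\<lambda>p. u (fst p) * v (snd p))"
    proof (rule lborel_pair.Fubini_integrable)
      have "(\<integral>y. norm (u (fst (x, y)) * v (snd (x, y))) \<partial>lborel) = \<bar>u x\<bar> * (\<integral>y. \<bar>v y\<bar> \<partial>lborel)" for x
        by (simp add: abs_mult)
      then show "integrable lborel (\<lambda>x. \<integral>y. norm (u (fst (x, y)) * v (snd (x, y))) \<partial>lborel)"
        using int by simp
      show "AE x in lborel. integrable lborel (\<lambda>y. u (fst (x, y)) * v (snd (x, y)))"
        using int by simp
    qed measurable
    show "AE p in lborel \<Otimes>\<^sub>M lborel. norm (case_prod k p) \<le> norm (u (fst p) * v (snd p))"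
      by (auto simp: k_def)
  qed measurable
  define K where "K = (\<integral>t. (\<integral>s. k s t \<partial>lborel) \<partial>lborel)"
  have Fu: "F t = F c + (\<integral>s. u s * indicator {..t} s \<partial>lborel)" if "t \<in> {c..d}" for t
  proof -
    have "(LINT s:{c..t}|lborel. f s) = (\<integral>s. u s * indicator {..t} s \<partial>lborel)"
      unfolding set_lebesgue_integral_def u_def
      using that by (intro Bochner_Integration.integral_cong) (auto split: split_indicator)
    then show ?thesis
      using ac_onD(2)[OF F that] by simp
  qed
  have "(LINT t:{c..d}|lborel. g t * F t) = (\<integral>t. F c * v t + (\<integral>s. k s t \<partial>lborel) \<partial>lborel)"
    unfolding set_lebesgue_integral_def
  proof (intro Bochner_Integration.integral_cong refl)
    fix t
    show "indicator {c..d} t *\<^sub>R (g t * F t) = F c * v t + (\<integral>s. k s t \<partial>lborel)"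
    proof (cases "t \<in> {c..d}")
      case True
      have "(\<integral>s. k s t \<partial>lborel) = (\<integral>s. v t * (u s * indicator {..t} s) \<partial>lborel)"
        unfolding k_def by (intro Bochner_Integration.integral_cong) (auto split: split_indicator)
      also have "\<dots> = v t * (\<integral>s. u s * indicator {..t} s \<partial>lborel)"
        by simp
      finally show ?thesis
        using Fu[OF True] True by (simp add: v_def algebra_simps)
    next
      case False
      then have "k s t = 0" for s
        by (simp add: k_def v_def)
      then show ?thesis
        using False by (simp add: v_def)
    qed
  qed
  also have "\<dots> = F c * (\<integral>t. v t \<partial>lborel) + K"
    unfolding K_def using int lborel_pair.integrable_snd[OF kint]
    by (subst Bochner_Integration.integral_add) auto
  finally have 1: "(LINT t:{c..d}|lborel. g t * F t) = F c * (\<integral>t. v t \<partial>lborel) + K" .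
  \<comment> \<open>\<open>G\<close> is expanded backwards from \<open>d\<close>, so that the
    remaining region is again the triangle \<open>s \<le> t\<close> and the same kernel
    \<open>k\<close> appears.\<close>
  have Gv: "G s = G d - (\<integral>t. v t * indicator {s..} t \<partial>lborel)" if "s \<in> {c..d}" for s
  proof -
    have "(LINT t:{s..d}|lborel. g t) = (\<integral>t. v t * indicator {s..} t \<partial>lborel)"
      unfolding set_lebesgue_integral_def v_def
      using that by (intro Bochner_Integration.integral_cong) (auto split: split_indicator)
    then show ?thesis
      using ac_onD(2)[OF ac_on_subinterval[OF G, of s d], of d] that by simp
  qed
  have "(LINT s:{c..d}|lborel. f s * G s) = (\<integral>s. G d * u s - (\<integral>t. k s t \<partial>lborel) \<partial>lborel)"
    unfolding set_lebesgue_integral_def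
  proof (intro Bochner_Integration.integral_cong refl)
    fix s
    show "indicator {c..d} s *\<^sub>R (f s * G s) = G d * u s - (\<integral>t. k s t \<partial>lborel)"
    proof (cases "s \<in> {c..d}")
      case True
      have "(\<integral>t. k s t \<partial>lborel) = (\<integral>t. u s * (v t * indicator {s..} t) \<partial>lborel)"
        unfolding k_def by (intro Bochner_Integration.integral_cong) (auto split: split_indicator)
      also have "\<dots> = u s * (\<integral>t. v t * indicator {s..} t \<partial>lborel)"
        by simp
      finally show ?thesis
        using True by (simp add: u_def Gv[OF True] algebra_simps)
    next
      case False
      then have "k s t = 0" for t
        by (simp add: k_def u_def)
      then show ?thesis
        using False by (simp add: u_def)
    qed
  qed
  also have "\<dots> = G d * (\<integral>s. u s \<partial>lborel) - (\<integral>s. (\<integral>t. k s t \<partial>lborel) \<partial>lborel)"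
    using int lborel_pair.integrable_fst[OF kint] by (subst Bochner_Integration.integral_diff) auto
  also have "(\<integral>s. (\<integral>t. k s t \<partial>lborel) \<partial>lborel) = K"
    unfolding K_def using lborel_pair.Fubini_integral[OF kint] by simp
  finally have 2: "(LINT s:{c..d}|lborel. f s * G s) = G d * (\<integral>s. u s \<partial>lborel) - K" .
  have "F d = F c + (\<integral>s. u s \<partial>lborel)" "G d = G c + (\<integral>s. v s \<partial>lborel)"
    using ac_onD(2)[OF F, of d] ac_onD(2)[OF G, of d] cd
    by (simp_all add: set_lebesgue_integral_def u_def v_def)
  then show ?thesis
    unfolding 1 2 by (simp add: algebra_simps)
qed

lemma ac_on_mult:
  assumes F: "ac_on c d F f" and G: "ac_on c d G g"
  shows "ac_on c d (\<lambda>z. F z * G z) (\<lambda>z. f z * G z + g z * F z)"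
  unfolding ac_on_def
proof (intro conjI ballI)
  have int: "set_integrable lborel {c..d} (\<lambda>z. f z * G z)" "set_integrable lborel {c..d} (\<lambda>z. g z * F z)"
    using set_integrable_continuous_mult[OF ac_onD(1)[OF F] ac_on_continuous[OF G]]
      set_integrable_continuous_mult[OF ac_onD(1)[OF G] ac_on_continuous[OF F]] .
  then show "set_integrable lborel {c..d} (\<lambda>z. f z * G z + g z * F z)"
    by (rule set_integral_add)
  fix z assume z: "z \<in> {c..d}"
  have "(LINT s:{c..z}|lborel. f s * G s + g s * F s) =
      (LINT s:{c..z}|lborel. f s * G s) + (LINT s:{c..z}|lborel. g s * F s)"
    using z by (intro set_integral_add set_integrable_subinterval[OF int(1)]
        set_integrable_subinterval[OF int(2)]) auto
  also have "\<dots> = F z * G z - F c * G c"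
    using z by (intro ac_on_by_parts ac_on_subinterval[OF F] ac_on_subinterval[OF G]) auto
  finally show "F z * G z = F c * G c + (LINT s:{c..z}|lborel. f s * G s + g s * F s)"
    by simp
qed

subsection \<open>Weak derivatives\<close>

text \<open>The sets over which the zero-extended \<open>f\<close> has integral 0 contain all
  half-lines {..z} and are closed under complements and disjoint unions, hence include every Borel
  set by Dynkin's theorem.\<close>

lemma AE_zero_if_set_integrals_zero:
  assumes f: "set_integrable lborel {c..d} (f :: real \<Rightarrow> real)"
    and z: "\<And>z. z \<in> {c..d} \<Longrightarrow> (LINT s:{c..z}|lborel. f s) = 0"
  shows "AE s in lborel. s \<in> {c..d} \<longrightarrow> f s = 0"
proof -
  define u where "u = (\<lambda>s. indicator {c..d} s *\<^sub>R f s)"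
  have int: "integrable lborel u"
    using f by (simp add: u_def set_integrable_def)
  have sint: "set_integrable lborel A u" if "A \<in> sets borel" for A
    using int that unfolding set_integrable_def by (intro integrable_mult_indicator) auto
  have atMost: "(LINT s:{..z}|lborel. u s) = 0" for z
  proof -
    have "(LINT s:{..z}|lborel. u s) = (LINT s:{c..min z d}|lborel. f s)"
      unfolding set_lebesgue_integral_def u_def
      by (intro Bochner_Integration.integral_cong) (auto split: split_indicator)
    also have "\<dots> = 0"
      using assms(2)[of "min z d"] by (cases "c \<le> min z d") (auto simp: set_lebesgue_integral_def)
    finally show ?thesis .
  qed
  have "(\<integral>s. u s \<partial>lborel) = (LINT s:{..d}|lborel. u s)"
    unfolding set_lebesgue_integral_def u_def
    by (intro Bochner_Integration.integral_cong) (auto split: split_indicator)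
  then have total: "(\<integral>s. u s \<partial>lborel) = 0"
    using atMost by simp
  have "(LINT s:A|lborel. u s) = 0" if "A \<in> sets lborel" for A
  proof -
    have "Int_stable (range (\<lambda>a::real. {..a}))"
      by (auto simp: Int_stable_def)
    moreover have "range (\<lambda>a::real. {..a}) \<subseteq> Pow UNIV"
      by simp
    moreover have "A \<in> sigma_sets UNIV (range (\<lambda>a::real. {..a}))"
      using that by (simp add: borel_eq_atMost)
    ultimately show ?thesis
    proof (induction rule: sigma_sets_induct_disjoint)
      case (basic A)
      then show ?case
        using atMost by auto
    next
      case empty
      then show ?case
        by (simp add: set_lebesgue_integral_def)
    next
      case (compl A)
      then have A: "A \<in> sets borel"
        by (simp add: borel_eq_atMost)
      have "(\<integral>s. u s \<partial>lborel) = (LINT s:(UNIV - A) \<union> A|lborel. u s)"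
        by (simp add: set_lebesgue_integral_def)
      also have "\<dots> = (LINT s:UNIV - A|lborel. u s) + (LINT s:A|lborel. u s)"
        using A by (intro set_integral_Un sint) auto
      finally show ?case
        using compl total by simp
    next
      case (union A)
      then have A: "A i \<in> sets borel" for i
        by (auto simp: borel_eq_atMost)
      have "(LINT s:(\<Union>i. A i)|lborel. u s) = (\<Sum>i. LINT s:A i|lborel. u s)"
        using A union(1) by (intro lebesgue_integral_countable_add sint) (auto simp: disjoint_family_on_def)
      then show ?case
        using union by simp
    qed
  qed
  then have "AE s in lborel. u s = 0"
    using int by (intro density_unique_real) auto
  then show ?thesis
    by eventually_elim (auto simp: u_def)
qed

text \<open>An antiderivative that vanishes at \<open>c\<close> is constant on either side of the
  support, and the zero mean carries the value 0 over to \<open>d\<close>. So continuous functions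
  of mean zero with such support are derivatives of test functions.\<close>

lemma bump_test_function:
  assumes \<psi>: "continuous_on UNIV \<psi>" and pq: "c < p" "p \<le> q" "q < d"
    and supp: "\<And>z. z \<notin> {p..q} \<Longrightarrow> \<psi> z = 0" and mean: "(LINT z:{c..d}|lborel. \<psi> z) = 0"
  shows "\<exists>\<phi>. test_function c d \<phi> \<psi>"
proof -
  have "\<exists>F. \<forall>x::real. -\<infinity> < ereal x \<longrightarrow> ereal x < \<infinity> \<longrightarrow> (F has_vector_derivative \<psi> x) (at x)"
    using \<psi> by (intro einterval_antiderivative) (auto simp: continuous_on_eq_continuous_at)
  then obtain F where F: "\<And>x. (F has_vector_derivative \<psi> x) (at x)"
    by auto
  define \<phi> where "\<phi> z = F z - F c" for z
  have D: "(\<phi> has_real_derivative \<psi> z) (at z)" for z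
    unfolding \<phi>_def has_real_derivative_iff_has_vector_derivative
    using F[of z] by (auto intro!: derivative_eq_intros)
  have ac: "ac_on c d \<phi> \<psi>"
    using D \<psi> by (intro ac_on_C1) (auto intro: DERIV_subset continuous_on_subset)
  have ends: "\<phi> c = 0" "\<phi> d = 0"
    using ac_onD(2)[OF ac, of d] mean pq by (auto simp: \<phi>_def)
  have const: "\<phi> z = \<phi> y" if "\<And>w. w \<in> S \<Longrightarrow> \<psi> w = 0" "z \<in> S" "y \<in> S" "connected S" "convex S" for z y S
    using has_field_derivative_zero_constant[of S \<phi>] that D
    by (metis DERIV_subset UNIV_I top_greatest)
  have "\<phi> z = 0" if "z \<notin> {p..q}" for z
  proof (cases "z < p")
    case True
    have "\<phi> z = \<phi> c"
      by (rule const[of "{..<p}"]) (use True pq supp in auto)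
    then show ?thesis
      using ends by simp
  next
    case False
    have "\<phi> z = \<phi> d"
      by (rule const[of "{q<..}"]) (use False that pq supp in auto)
    then show ?thesis
      using ends by simp
  qed
  then have "compact {p..q} \<and> {p..q} \<subseteq> {c<..<d} \<and> (\<forall>z. z \<notin> {p..q} \<longrightarrow> \<phi> z = 0)"
    using pq by auto
  then show ?thesis
    using D \<psi> unfolding test_function_def by blast
qed

text \<open>Approximates the indicator of [p,q] with flanks of width 1 / n. Continuity is all that
  the derivative of a test function has to satisfy.\<close>

definition trapezoid :: "real \<Rightarrow> real \<Rightarrow> nat \<Rightarrow> real \<Rightarrow> real" where
  "trapezoid p q n z = max 0 (1 - real n * max 0 (max (p - z) (z - q)))"

lemma trapezoid_continuous: "continuous_on S (trapezoid p q n)"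
  unfolding trapezoid_def by (intro continuous_intros)

lemma trapezoid_bounds: "0 \<le> trapezoid p q n z" "trapezoid p q n z \<le> 1"
  by (auto simp: trapezoid_def)

lemma trapezoid_support:
  assumes n: "0 < n" and z: "z \<notin> {p - 1 / real n..q + 1 / real n}"
  shows "trapezoid p q n z = 0"
proof -
  have "1 / real n \<le> max 0 (max (p - z) (z - q))"
  proof -
    have "z < p - 1 / real n \<or> q + 1 / real n < z"
      using z by (simp only: atLeastAtMost_iff) linarith
    then have "1 / real n \<le> p - z \<or> 1 / real n \<le> z - q"
      by linarith
    then show ?thesis
      by (simp only: le_max_iff_disj) blast
  qed
  then have "1 \<le> real n * max 0 (max (p - z) (z - q))"
    using n by (simp add: pos_divide_le_eq mult.commute)
  then show ?thesis
    by (simp add: trapezoid_def)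
qed

lemma trapezoid_tendsto: "(\<lambda>n. trapezoid p q n z) \<longlonglongrightarrow> indicator {p..q} z"
proof (cases "z \<in> {p..q}")
  case True
  then show ?thesis
    by (simp add: trapezoid_def)
next
  case False
  then have m: "0 < max 0 (max (p - z) (z - q))"
    by auto
  obtain N where N: "1 / max 0 (max (p - z) (z - q)) \<le> real N"
    using real_arch_simple by blast
  have "trapezoid p q n z = 0" if "N \<le> n" for n
  proof -
    have "1 / max 0 (max (p - z) (z - q)) \<le> real n"
      using N that by (meson of_nat_mono order_trans)
    then have "1 \<le> real n * max 0 (max (p - z) (z - q))"
      using m by (simp only: pos_divide_le_eq)
    then show ?thesis
      by (simp add: trapezoid_def)
  qed
  then have "\<forall>\<^sub>F n in sequentially. trapezoid p q n z = 0"
    by (auto simp: eventually_sequentially)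
  then show ?thesis
    using False by (simp add: tendsto_eventually)
qed

lemma trapezoid_integral_tendsto:
  assumes u: "set_integrable lborel {c..d} u" and pq: "c \<le> p" "q \<le> d"
  shows "(\<lambda>n. LINT z:{c..d}|lborel. u z * trapezoid p q n z) \<longlonglongrightarrow> (LINT z:{p..q}|lborel. u z)"
proof -
  have m: "(\<lambda>z. indicator {c..d} z *\<^sub>R u z) \<in> borel_measurable lborel"
    using u unfolding set_integrable_def by (rule borel_measurable_integrable)
  have t: "trapezoid p q n \<in> borel_measurable borel" for n
    by (intro borel_measurable_continuous_onI trapezoid_continuous)
  have "(\<lambda>n. \<integral>z. (indicator {c..d} z *\<^sub>R u z) * trapezoid p q n z \<partial>lborel) \<longlonglongrightarrow>
      (\<integral>z. (indicator {c..d} z *\<^sub>R u z) * indicator {p..q} z \<partial>lborel)"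
  proof (rule integral_dominated_convergence)
    show "integrable lborel (\<lambda>z. \<bar>indicator {c..d} z *\<^sub>R u z\<bar>)"
      using u unfolding set_integrable_def by (rule integrable_abs)
    show "AE z in lborel. (\<lambda>n. (indicator {c..d} z *\<^sub>R u z) * trapezoid p q n z) \<longlonglongrightarrow>
        (indicator {c..d} z *\<^sub>R u z) * indicator {p..q} z"
      by (intro AE_I2 tendsto_intros trapezoid_tendsto)
    show "AE z in lborel. norm ((indicator {c..d} z *\<^sub>R u z) * trapezoid p q n z) \<le> \<bar>indicator {c..d} z *\<^sub>R u z\<bar>" for n
    proof (intro AE_I2)
      fix z
      have "\<bar>indicator {c..d} z *\<^sub>R u z\<bar> * \<bar>trapezoid p q n z\<bar> \<le> \<bar>indicator {c..d} z *\<^sub>R u z\<bar> * 1"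
        using trapezoid_bounds[of p q n z] by (intro mult_left_mono) auto
      then show "norm ((indicator {c..d} z *\<^sub>R u z) * trapezoid p q n z) \<le> \<bar>indicator {c..d} z *\<^sub>R u z\<bar>"
        by (simp add: abs_mult)
    qed
  qed (use m t in measurable)
  moreover have "(\<integral>z. (indicator {c..d} z *\<^sub>R u z) * trapezoid p q n z \<partial>lborel) = (LINT z:{c..d}|lborel. u z * trapezoid p q n z)" for n
    unfolding set_lebesgue_integral_def by (simp add: mult.assoc)
  moreover have "(\<integral>z. (indicator {c..d} z *\<^sub>R u z) * indicator {p..q} z \<partial>lborel) = (LINT z:{p..q}|lborel. u z)"
    unfolding set_lebesgue_integral_def
    using pq by (intro Bochner_Integration.integral_cong) (auto split: split_indicator)
  ultimately show ?thesis
    by simp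
qed

text \<open>Two trapezoids combined to mean zero give an admissible derivative. In the limit the
  averages of \<open>u\<close> over any two intervals inside (c,d) agree, so with \<open>k\<close>
  as their common value all integrals of u - k vanish.\<close>

lemma du_Bois_Reymond:
  assumes u: "set_integrable lborel {c..d} u" and cd: "c < d"
    and weak: "\<And>\<phi> \<phi>'. test_function c d \<phi> \<phi>' \<Longrightarrow> (LINT z:{c..d}|lborel. u z * \<phi>' z) = 0"
  shows "\<exists>k. AE z in lborel. z \<in> {c..d} \<longrightarrow> u z = k"
proof -
  have one: "set_integrable lborel {c..d} (\<lambda>z. 1::real)"
    by (intro borel_integrable_atLeastAtMost') auto
  have ratio: "(q' - p') * (LINT z:{p..q}|lborel. u z) = (q - p) * (LINT z:{p'..q'}|lborel. u z)"
    if pq: "c < p" "p \<le> q" "q < d" and pq': "c < p'" "p' \<le> q'" "q' < d" for p q p' q'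
  proof -
    let ?I = "\<lambda>p q n. LINT z:{c..d}|lborel. trapezoid p q n z"
    let ?U = "\<lambda>p q n. LINT z:{c..d}|lborel. u z * trapezoid p q n z"
    define p0 and q0 where "p0 = min p p'" and "q0 = max q q'"
    define e where "e = min (p0 - c) (d - q0)"
    have e: "0 < e"
      using pq pq' by (auto simp: e_def p0_def q0_def)
    obtain N where N: "0 < N" "1 / real N < e"
      using real_arch_invD[OF e] by (auto simp: inverse_eq_divide)
    have eq: "?I p' q' n * ?U p q n = ?I p q n * ?U p' q' n" if n: "N \<le> n" for n
    proof -
      have n0: "0 < n" "1 / real n < e"
        using n N by (auto intro: le_less_trans[OF divide_left_mono[of "real N" "real n" 1]])
      \<comment> \<open>Each trapezoid is weighted by the integral of the other, which makes the
        mean vanish.\<close>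
      let ?\<psi> = "\<lambda>z. ?I p' q' n * trapezoid p q n z - ?I p q n * trapezoid p' q' n z"
      have tint: "set_integrable lborel {c..d} (trapezoid x y n)" for x y
        by (intro borel_integrable_atLeastAtMost' trapezoid_continuous)
      have uint: "set_integrable lborel {c..d} (\<lambda>z. u z * trapezoid x y n z)" for x y
        by (intro set_integrable_continuous_mult u trapezoid_continuous)
      have "\<exists>\<phi>. test_function c d \<phi> ?\<psi>"
      proof (rule bump_test_function[of _ c "p0 - 1 / real n" "q0 + 1 / real n"])
        show "continuous_on UNIV ?\<psi>"
          by (intro continuous_intros trapezoid_continuous)
        show "c < p0 - 1 / real n" "q0 + 1 / real n < d"
          using n0 by (auto simp: e_def)
        have "p0 \<le> q0"
          using pq by (auto simp: p0_def q0_def)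
        then show "p0 - 1 / real n \<le> q0 + 1 / real n"
          using n0(1) by (smt (verit) divide_nonneg_nonneg of_nat_0_le_iff)
        show "?\<psi> z = 0" if "z \<notin> {p0 - 1 / real n..q0 + 1 / real n}" for z
        proof -
          have "p0 \<le> p" "p0 \<le> p'" "q \<le> q0" "q' \<le> q0"
            by (auto simp: p0_def q0_def)
          then have "z \<notin> {p - 1 / real n..q + 1 / real n}" "z \<notin> {p' - 1 / real n..q' + 1 / real n}"
            using that by (simp only: atLeastAtMost_iff, linarith)+
          then have "trapezoid p q n z = 0" "trapezoid p' q' n z = 0"
            using trapezoid_support[OF n0(1)] by blast+
          then show ?thesis
            by simp
        qed
        show "(LINT z:{c..d}|lborel. ?\<psi> z) = 0"
          using tint by (subst set_integral_diff) (auto simp: mult.commute)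
      qed
      then have "(LINT z:{c..d}|lborel. u z * ?\<psi> z) = 0"
        using weak by blast
      also have "(\<lambda>z. u z * ?\<psi> z) = (\<lambda>z. ?I p' q' n * (u z * trapezoid p q n z) - ?I p q n * (u z * trapezoid p' q' n z))"
        by (auto simp: algebra_simps)
      finally have "?I p' q' n * ?U p q n - ?I p q n * ?U p' q' n = 0"
        using uint by (subst (asm) set_integral_diff) auto
      then show ?thesis
        by simp
    qed
    have lim: "?I x y \<longlonglongrightarrow> y - x" if "c \<le> x" "x \<le> y" "y \<le> d" for x y
      using trapezoid_integral_tendsto[OF one, of x y] that by (simp add: set_lebesgue_integral_def)
    have 1: "(\<lambda>n. ?I p' q' n * ?U p q n) \<longlonglongrightarrow> (q' - p') * (LINT z:{p..q}|lborel. u z)"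
      using pq pq' by (intro tendsto_mult lim trapezoid_integral_tendsto u) auto
    have 2: "(\<lambda>n. ?I p q n * ?U p' q' n) \<longlonglongrightarrow> (q - p) * (LINT z:{p'..q'}|lborel. u z)"
      using pq pq' by (intro tendsto_mult lim trapezoid_integral_tendsto u) auto
    have "\<forall>\<^sub>F n in sequentially. ?I p' q' n * ?U p q n = ?I p q n * ?U p' q' n"
      unfolding eventually_sequentially using eq by blast
    from LIMSEQ_unique[OF Lim_transform_eventually[OF 1 this] 2] show ?thesis .
  qed
  define p' and q' where "p' = c + (d - c) / 3" and "q' = c + 2 * (d - c) / 3"
  have pq': "c < p'" "p' < q'" "q' < d"
    using cd by (auto simp: p'_def q'_def field_simps)
  define k where "k = (LINT z:{p'..q'}|lborel. u z) / (q' - p')"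
  have k: "(LINT z:{p..q}|lborel. u z) = (q - p) * k" if "c < p" "p \<le> q" "q < d" for p q
    using ratio[OF that, of p' q'] pq' by (simp add: k_def field_simps)
  have uk: "set_integrable lborel {c..d} (\<lambda>z. u z - k)"
    using set_integral_diff(1)[OF u, of "\<lambda>_. k"] by (simp add: borel_integrable_atLeastAtMost')
  define G where "G z = 0 + (LINT s:{c..z}|lborel. u s - k)" for z
  have G: "ac_on c d G (\<lambda>z. u z - k)"
    unfolding G_def using ac_on_indefinite[OF uk, of 0] cd by simp
  have diff: "G q = G p" if "c < p" "p \<le> q" "q < d" for p q
  proof -
    have "G q = G p + (LINT s:{p..q}|lborel. u s - k)"
      using ac_onD(2)[OF ac_on_subinterval[OF G, of p q], of q] that by simp
    also have "(LINT s:{p..q}|lborel. u s - k) = (LINT s:{p..q}|lborel. u s) - (LINT s:{p..q}|lborel. k)"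
      using that by (intro set_integral_diff set_integrable_subinterval[OF u] borel_integrable_atLeastAtMost') auto
    also have "\<dots> = 0"
      using k[OF that] that by (simp add: set_lebesgue_integral_def)
    finally show ?thesis
      by simp
  qed
  have G_Ioo: "G z = G p'" if "z \<in> {c<..<d}" for z
    using diff[of z p'] diff[of p' z] that pq' by (cases "z \<le> p'") auto
  \<comment> \<open>\<open>diff\<close> covers only interior points; continuity of \<open>G\<close>
    brings in both endpoints, in particular \<open>c\<close>, where \<open>G\<close> is 0.\<close>
  have G_Icc: "G z = G p'" if "z \<in> {c..d}" for z
  proof (rule continuous_constant_on_closure[OF _ G_Ioo])
    show "continuous_on (closure {c<..<d}) G" "z \<in> closure {c<..<d}"
      using ac_on_continuous[OF G] that cd by (simp_all only: closure_greaterThanLessThan)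
  qed
  have "G c = 0"
    using set_integral_Ioo_eq_Icc[of c c "\<lambda>s. u s - k"] by (simp add: G_def set_lebesgue_integral_def)
  then have "(LINT s:{c..z}|lborel. u s - k) = 0" if "z \<in> {c..d}" for z
    using G_Icc[OF that] G_Icc[of c] cd by (simp add: G_def)
  from AE_zero_if_set_integrals_zero[OF uk this]
  have "AE z in lborel. z \<in> {c..d} \<longrightarrow> u z - k = 0"
    by blast
  then have "AE z in lborel. z \<in> {c..d} \<longrightarrow> u z = k"
    by eventually_elim simp
  then show ?thesis
    by blast
qed

lemma sq_integrable_on_imp_set_integrable:
  assumes "sq_integrable_on c d f"
  shows "set_integrable lborel {c..d} f"
proof -
  have m: "(\<lambda>z. indicator {c<..<d} z *\<^sub>R f z) \<in> borel_measurable lborel"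
    using assms by (simp add: sq_integrable_on_def set_borel_measurable_def)
  have "set_integrable lborel {c<..<d} (\<lambda>z. 1::real)"
    by (simp add: set_integrable_Ioo_iff_Icc borel_integrable_atLeastAtMost')
  then have "set_integrable lborel {c<..<d} (\<lambda>z. 1 + (f z)\<^sup>2)"
    using assms by (intro set_integral_add) (auto simp: sq_integrable_on_def)
  then have "set_integrable lborel {c<..<d} f"
    unfolding set_integrable_def
  proof (rule Bochner_Integration.integrable_bound[OF _ m])
    have "\<bar>x\<bar> \<le> 1 + x\<^sup>2" for x :: real
      using zero_le_power2[of "\<bar>x\<bar> - 1"] by (simp add: power2_diff)
    then show "AE z in lborel. norm (indicator {c<..<d} z *\<^sub>R f z)
        \<le> norm (indicator {c<..<d} z *\<^sub>R (1 + (f z)\<^sup>2))"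
      by (auto split: split_indicator)
  qed
  then show ?thesis
    by (simp add: set_integrable_Ioo_iff_Icc)
qed

lemma test_function_ac_on:
  assumes "test_function c d \<phi> \<phi>'"
  shows "ac_on c d \<phi> \<phi>'" "\<phi> c = 0" "\<phi> d = 0"
proof -
  show "ac_on c d \<phi> \<phi>'"
    using assms by (intro ac_on_C1) (auto simp: test_function_def intro: DERIV_subset continuous_on_subset)
  show "\<phi> c = 0" "\<phi> d = 0"
    using assms by (auto simp: test_function_def subset_iff)
qed

lemma ac_on_weak:
  assumes F: "ac_on c d F g" and \<phi>: "test_function c d \<phi> \<phi>'" and cd: "c \<le> d"
  shows "(LINT z:{c..d}|lborel. F z * \<phi>' z) = - (LINT z:{c..d}|lborel. g z * \<phi> z)"
proof -
  have "(LINT z:{c..d}|lborel. \<phi>' z * F z) = (LINT z:{c..d}|lborel. F z * \<phi>' z)"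
    by (simp add: mult.commute)
  then show ?thesis
    using ac_on_by_parts[OF F test_function_ac_on(1)[OF \<phi>] cd] test_function_ac_on(2,3)[OF \<phi>]
    by simp
qed

lemma ac_on_has_weak_deriv:
  assumes F: "ac_on c d F g" and f: "sq_integrable_on c d f" "sq_integrable_on c d g"
    and eq: "AE z in lborel. z \<in> {c<..<d} \<longrightarrow> F z = f z" and cd: "c \<le> d"
  shows "has_weak_deriv c d f g"
  unfolding has_weak_deriv_def
proof (intro conjI allI impI f)
  fix \<phi> \<phi>' assume \<phi>: "test_function c d \<phi> \<phi>'"
  have \<phi>c: "continuous_on {c..d} \<phi>'"
    using \<phi> by (auto simp: test_function_def intro: continuous_on_subset)
  have int: "set_integrable lborel {c<..<d} (\<lambda>z. f z * \<phi>' z)" "set_integrable lborel {c<..<d} (\<lambda>z. F z * \<phi>' z)"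
    unfolding set_integrable_Ioo_iff_Icc
    using set_integrable_continuous_mult[OF sq_integrable_on_imp_set_integrable[OF f(1)] \<phi>c]
      borel_integrable_atLeastAtMost'[OF continuous_on_mult[OF ac_on_continuous[OF F] \<phi>c]] by auto
  have "(LINT z:{c<..<d}|lborel. f z * \<phi>' z) = (LINT z:{c<..<d}|lborel. F z * \<phi>' z)"
    unfolding set_lebesgue_integral_def
  proof (rule integral_cong_AE)
    show "AE z in lborel. indicator {c<..<d} z *\<^sub>R (f z * \<phi>' z) = indicator {c<..<d} z *\<^sub>R (F z * \<phi>' z)"
      using eq by eventually_elim (auto split: split_indicator)
  qed (use int in \<open>auto simp: set_integrable_def dest: borel_measurable_integrable\<close>)
  then show "(LINT z:{c<..<d}|lborel. f z * \<phi>' z) = - (LINT z:{c<..<d}|lborel. g z * \<phi> z)"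
    using ac_on_weak[OF F \<phi> cd] by (simp add: set_integral_Ioo_eq_Icc)
qed

text \<open>\<open>f\<close> minus an indefinite integral of \<open>g\<close> has weak derivative 0,
  hence is constant by \<open>du_Bois_Reymond\<close>; the constant is put into the continuous
  representative.\<close>

lemma has_weak_deriv_imp_ac_on:
  assumes w: "has_weak_deriv c d f g" and cd: "c < d"
  shows "\<exists>F. ac_on c d F g \<and> (AE z in lborel. z \<in> {c<..<d} \<longrightarrow> F z = f z)"
proof -
  have f: "set_integrable lborel {c..d} f" and g: "set_integrable lborel {c..d} g"
    using w sq_integrable_on_imp_set_integrable by (auto simp: has_weak_deriv_def)
  define G where "G C z = C + (LINT s:{c..z}|lborel. g s)" for C z
  have G: "ac_on c d (G C) g" for C
    unfolding G_def using ac_on_indefinite[OF g] cd by simp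
  have Gint: "set_integrable lborel {c..d} (G 0)"
    by (intro borel_integrable_atLeastAtMost' ac_on_continuous[OF G])
  have "\<exists>k. AE z in lborel. z \<in> {c..d} \<longrightarrow> f z - G 0 z = k"
  proof (rule du_Bois_Reymond[OF _ cd])
    show "set_integrable lborel {c..d} (\<lambda>z. f z - G 0 z)"
      using f Gint by (rule set_integral_diff)
    fix \<phi> \<phi>' assume \<phi>: "test_function c d \<phi> \<phi>'"
    then have \<phi>c: "continuous_on {c..d} \<phi>'"
      by (auto simp: test_function_def intro: continuous_on_subset)
    have "(LINT z:{c..d}|lborel. (f z - G 0 z) * \<phi>' z) =
        (LINT z:{c..d}|lborel. f z * \<phi>' z) - (LINT z:{c..d}|lborel. G 0 z * \<phi>' z)"
      unfolding left_diff_distrib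
      by (intro set_integral_diff set_integrable_continuous_mult f Gint \<phi>c)
    also have "(LINT z:{c..d}|lborel. f z * \<phi>' z) = - (LINT z:{c..d}|lborel. g z * \<phi> z)"
      using w \<phi> by (simp add: has_weak_deriv_def set_integral_Ioo_eq_Icc)
    also have "(LINT z:{c..d}|lborel. G 0 z * \<phi>' z) = - (LINT z:{c..d}|lborel. g z * \<phi> z)"
      using ac_on_weak[OF G \<phi>] cd by simp
    finally show "(LINT z:{c..d}|lborel. (f z - G 0 z) * \<phi>' z) = 0"
      by simp
  qed
  then obtain k where "AE z in lborel. z \<in> {c..d} \<longrightarrow> f z - G 0 z = k"
    by blast
  then have "AE z in lborel. z \<in> {c<..<d} \<longrightarrow> G k z = f z"
    by eventually_elim (auto simp: G_def)
  then show ?thesis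
    using G by blast
qed

text \<open>A nonzero difference at an interior point would persist on a ball, which has positive
  measure; the endpoints follow by continuity.\<close>

lemma continuous_AE_eq:
  fixes F G :: "real \<Rightarrow> real"
  assumes "continuous_on {c..d} F" "continuous_on {c..d} G" "c < d"
    and ae: "AE z in lborel. z \<in> {c<..<d} \<longrightarrow> F z = G z" and z: "z \<in> {c..d}"
  shows "F z = G z"
proof -
  have in_Ioo: "F z - G z = 0" if z: "z \<in> {c<..<d}" for z
  proof (rule ccontr)
    assume ne: "F z - G z \<noteq> 0"
    have "continuous_on {c<..<d} (\<lambda>z. F z - G z)"
      using assms(1,2) by (intro continuous_on_diff) (auto intro: continuous_on_subset)
    then have "open ({c<..<d} \<inter> (\<lambda>z. F z - G z) -` (- {0}))"
      by (rule continuous_open_preimage) auto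
    moreover have "z \<in> {c<..<d} \<inter> (\<lambda>z. F z - G z) -` (- {0})"
      using ne z by simp
    ultimately obtain e where e: "0 < e" "ball z e \<subseteq> {c<..<d} \<inter> (\<lambda>z. F z - G z) -` (- {0})"
      unfolding open_contains_ball by blast
    have "AE y in lborel. y \<notin> ball z e"
      using ae by eventually_elim (use e in auto)
    then have "emeasure lborel (ball z e) = 0"
      by (subst (asm) AE_iff_null_sets[symmetric]) auto
    moreover have "ball z e = {z - e<..<z + e}"
      by (auto simp: dist_real_def abs_less_iff)
    ultimately show False
      using e by simp
  qed
  have "F z - G z = 0"
    using continuous_constant_on_closure[of "{c<..<d}" "\<lambda>z. F z - G z" 0] in_Ioo assms
    by (simp add: closure_greaterThanLessThan continuous_on_diff)
  then show ?thesis
    by simp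
qed

text \<open>Two continuous representatives coincide on the closed interval, so the description in
  \<open>pt_value\<close> determines a value and any representative computes it.\<close>

lemma pt_value_eq:
  assumes F: "continuous_on {c..d} F" "AE z in lborel. z \<in> {c<..<d} \<longrightarrow> F z = f z"
    and cd: "c < d" and p: "p \<in> {c..d}"
  shows "pt_value c d f p = F p"
  unfolding pt_value_def
proof (rule the_equality)
  show "\<exists>G. continuous_on {c..d} G \<and> (AE z in lborel. z \<in> {c<..<d} \<longrightarrow> G z = f z) \<and> G p = F p"
    using F by blast
  fix y assume "\<exists>G. continuous_on {c..d} G \<and> (AE z in lborel. z \<in> {c<..<d} \<longrightarrow> G z = f z) \<and> G p = y"
  then obtain G where G: "continuous_on {c..d} G" "AE z in lborel. z \<in> {c<..<d} \<longrightarrow> G z = f z" "G p = y"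
    by blast
  have "AE z in lborel. z \<in> {c<..<d} \<longrightarrow> G z = F z"
    using F(2) G(2) by eventually_elim auto
  then show "y = F p"
    using continuous_AE_eq[OF G(1) F(1) cd _ p] G(3) by simp
qed

text \<open>\<open>weak_deriv\<close> is an arbitrary choice, and this makes \<open>J0\<close>
  independent of it: both candidates are densities of the same continuous function, so their
  integrals over all initial intervals agree.\<close>

lemma has_weak_deriv_unique:
  assumes g: "has_weak_deriv c d f g" and h: "has_weak_deriv c d f h" and cd: "c < d"
  shows "AE z in lborel. z \<in> {c<..<d} \<longrightarrow> g z = h z"
proof -
  obtain G H where G: "ac_on c d G g" "AE z in lborel. z \<in> {c<..<d} \<longrightarrow> G z = f z"
    and H: "ac_on c d H h" "AE z in lborel. z \<in> {c<..<d} \<longrightarrow> H z = f z"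
    using has_weak_deriv_imp_ac_on[OF g cd] has_weak_deriv_imp_ac_on[OF h cd] by blast
  have "AE z in lborel. z \<in> {c<..<d} \<longrightarrow> G z = H z"
    using G(2) H(2) by eventually_elim auto
  then have eq: "G z = H z" if "z \<in> {c..d}" for z
    using continuous_AE_eq[OF ac_on_continuous[OF G(1)] ac_on_continuous[OF H(1)] cd _ that] by blast
  have D: "ac_on c d (\<lambda>z. G z + (-1) * H z) (\<lambda>z. g z + (-1) * h z)"
    by (intro ac_on_add ac_on_cmult G H)
  have "(LINT s:{c..z}|lborel. g s + (-1) * h s) = 0" if "z \<in> {c..d}" for z
    using ac_onD(2)[OF D that] eq[OF that] eq[of c] cd by simp
  then have "AE z in lborel. z \<in> {c..d} \<longrightarrow> g z + (-1) * h z = 0"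
    by (rule AE_zero_if_set_integrals_zero[OF ac_onD(1)[OF D]])
  then show ?thesis
    by eventually_elim auto
qed

lemma weak_deriv_works: "f \<in> H1 c d \<Longrightarrow> has_weak_deriv c d f (weak_deriv c d f)"
  unfolding weak_deriv_def H1_def by (simp add: someI_ex)

subsection \<open>The boundary form\<close>

lemma vector_4_nth [simp]:
  "(vector [w, x, y, z] :: 'a::zero ^ 4) $ 1 = w"
  "(vector [w, x, y, z] :: 'a::zero ^ 4) $ 2 = x"
  "(vector [w, x, y, z] :: 'a::zero ^ 4) $ 3 = y"
  "(vector [w, x, y, z] :: 'a::zero ^ 4) $ 4 = z"
  unfolding vector_def by simp_all

lemma Sigma_mat_mult: "Sigma_mat *v x = vector [x $ 3, x $ 4, x $ 1, x $ 2]"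
  by (simp add: vec_eq_iff forall_4 matrix_vector_mult_def sum_4 Sigma_mat_def)

lemma Sigma_form: "x \<bullet> (Sigma_mat *v x) = 2 * (x $ 1 * x $ 3 + x $ 2 * x $ 4)"
  by (simp add: Sigma_mat_mult inner_vec_def sum_4)

lemma Sigma_mat_involution: "Sigma_mat *v (Sigma_mat *v x) = x"
  by (simp add: Sigma_mat_mult vec_eq_iff forall_4)

lemma Sigma_mat_sym: "x \<bullet> (Sigma_mat *v y) = (Sigma_mat *v x) \<bullet> y"
  by (simp add: Sigma_mat_mult inner_vec_def sum_4)

lemma exists_kernel_vector:
  fixes f :: "'a::euclidean_space \<Rightarrow> 'b::euclidean_space"
  assumes "linear f" "DIM('b) < DIM('a)"
  shows "\<exists>x. x \<noteq> 0 \<and> f x = 0"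
proof (rule ccontr)
  assume "\<not> ?thesis"
  then have "inj f"
    using linear_injective_0[OF assms(1)] by blast
  then have "dim (range f) = DIM('a)"
    using dim_image_eq[OF assms(1), of UNIV] by simp
  then show False
    using dim_subset_UNIV[of "range f"] assms(2) by simp
qed

text \<open>The \<open>\<Sigma>\<close>-form is positive on the two-dimensional space \<open>\<Sigma> W\<^sup>T \<real>\<^sup>2\<close>, whose \<open>\<Sigma>\<close>-orthogonal
  complement is the kernel of \<open>W\<close>, and its signature is \<open>(2, 2)\<close>. So it is negative on the kernel.\<close>
lemma Sigma_form_kernel_neg:
  fixes W :: "real^4^2"
  assumes W: "pos_def (W ** Sigma_mat ** transpose W)" and x: "W *v x = 0" "x \<noteq> 0"
  shows "x \<bullet> (Sigma_mat *v x) < 0"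
proof (rule ccontr)
  assume "\<not> x \<bullet> (Sigma_mat *v x) < 0"
  then have nonneg: "0 \<le> x \<bullet> (Sigma_mat *v x)"
    by simp
  define y where "y v = Sigma_mat *v (transpose W *v v)" for v :: "real^2"
  have yy: "y v \<bullet> (Sigma_mat *v y v) = v \<bullet> ((W ** Sigma_mat ** transpose W) *v v)" for v
    by (simp add: y_def Sigma_mat_involution inner_commute[of _ "v v* W"] dot_lmul_matrix
        del: vector_transpose_matrix flip: matrix_vector_mul_assoc)
  have yx: "y v \<bullet> (Sigma_mat *v x) = 0" for v
    by (simp add: y_def Sigma_mat_sym Sigma_mat_involution dot_lmul_matrix x)
  define g where "g p = y (fst p) + snd p *\<^sub>R x" for p :: "(real^2) \<times> real"
  have g: "linear g"
    unfolding g_def y_def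
    by (rule linearI) (auto simp: matrix_vector_right_distrib matrix_vector_mult_scaleR algebra_simps
        vector_matrix_left_distrib scaleR_vector_matrix_assoc)
  \<comment> \<open>Under the contrary assumption the form is nonnegative on the image of
    \<open>g\<close>. The two sums vanish on a plane where the form at w equals -2 (w_1^2 + w_2^2);
    three parameters against two equations leave a nonzero \<open>p\<close> that is mapped
    there.\<close>
  have "linear (\<lambda>p. (vector [g p $ 1 + g p $ 3, g p $ 2 + g p $ 4] :: real^2))"
    using linear_add[OF g] linear_scale[OF g]
    by (intro linearI) (auto simp: vec_eq_iff forall_2 algebra_simps)
  then obtain p where p: "p \<noteq> 0" "(vector [g p $ 1 + g p $ 3, g p $ 2 + g p $ 4] :: real^2) = 0"
    using exists_kernel_vector by fastforce
  then have 13: "g p $ 3 = - g p $ 1" "g p $ 4 = - g p $ 2"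
    by (auto simp: vec_eq_iff forall_2)
  have "g p \<bullet> (Sigma_mat *v g p) = y (fst p) \<bullet> (Sigma_mat *v y (fst p)) + (snd p)\<^sup>2 * (x \<bullet> (Sigma_mat *v x))"
    using yx[of "fst p"] Sigma_mat_sym[of x "y (fst p)"]
    by (simp add: g_def matrix_vector_right_distrib matrix_vector_mult_scaleR inner_add_left
        inner_add_right power2_eq_square inner_commute)
  moreover have "g p \<bullet> (Sigma_mat *v g p) = - 2 * ((g p $ 1)\<^sup>2 + (g p $ 2)\<^sup>2)"
    unfolding Sigma_form 13 by (simp add: power2_eq_square)
  ultimately have eq: "y (fst p) \<bullet> (Sigma_mat *v y (fst p)) + (snd p)\<^sup>2 * (x \<bullet> (Sigma_mat *v x))
      + 2 * (g p $ 1)\<^sup>2 + 2 * (g p $ 2)\<^sup>2 = 0"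
    by simp
  have p2: "0 \<le> (snd p)\<^sup>2 * (x \<bullet> (Sigma_mat *v x))"
    using nonneg by simp
  have v0: "fst p = 0"
  proof (rule ccontr)
    assume "fst p \<noteq> 0"
    then have "0 < y (fst p) \<bullet> (Sigma_mat *v y (fst p))"
      using W by (simp add: yy pos_def_def)
    then show False
      using eq p2 zero_le_power2[of "g p $ 1"] zero_le_power2[of "g p $ 2"] by linarith
  qed
  then have y0: "y (fst p) = 0"
    by (simp add: y_def)
  then have "(g p $ 1)\<^sup>2 = 0" "(g p $ 2)\<^sup>2 = 0"
    using eq p2 zero_le_power2[of "g p $ 1"] zero_le_power2[of "g p $ 2"]
    unfolding y0 inner_zero_left by linarith+
  then have "g p = 0"
    using 13 by (simp add: vec_eq_iff forall_4)
  then have "snd p = 0"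
    using y0 x(2) by (simp add: g_def)
  then show False
    using v0 p(1) by (simp add: prod_eq_iff)
qed

text \<open>The form is homogeneous and negative on the unit sphere of the kernel; that sphere is
  compact, so the maximum there is negative as well.\<close>

lemma Sigma_form_kernel_coercive:
  fixes W :: "real^4^2"
  assumes W: "pos_def (W ** Sigma_mat ** transpose W)"
  shows "\<exists>\<kappa>>0. \<forall>x. W *v x = 0 \<longrightarrow> x \<bullet> (Sigma_mat *v x) \<le> - \<kappa> * (norm x)\<^sup>2"
proof -
  define S where "S = {x. W *v x = 0 \<and> norm x = 1}"
  have "S = (\<lambda>x. W *v x) -` {0} \<inter> sphere 0 1"
    by (auto simp: S_def dist_norm)
  moreover have "closed ((\<lambda>x. W *v x) -` {0})"
    by (intro continuous_closed_vimage matrix_vector_mult_linear_continuous_at) auto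
  ultimately have S: "compact S"
    by (simp add: closed_Int_compact)
  have cont: "continuous_on S (\<lambda>x. x \<bullet> (Sigma_mat *v x))"
    unfolding Sigma_form by (intro continuous_intros)
  have scale: "x \<bullet> (Sigma_mat *v x) \<le> - \<kappa> * (norm x)\<^sup>2"
    if \<kappa>: "\<And>y. y \<in> S \<Longrightarrow> y \<bullet> (Sigma_mat *v y) \<le> - \<kappa>" and x: "W *v x = 0" for x \<kappa>
  proof (cases "x = 0")
    case False
    have "(1 / norm x) *\<^sub>R x \<in> S"
      using False x by (simp add: S_def matrix_vector_mult_scaleR)
    from \<kappa>[OF this] have "(1 / norm x)\<^sup>2 * (x \<bullet> (Sigma_mat *v x)) \<le> - \<kappa>"
      by (simp add: matrix_vector_mult_scaleR power2_eq_square)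
    then show ?thesis
      using False by (simp add: power_one_over field_simps)
  qed simp
  show ?thesis
  proof (cases "S = {}")
    case True
    then show ?thesis
      using scale[of 1] by (intro exI[of _ 1]) auto
  next
    case False
    obtain x0 where x0: "x0 \<in> S" "\<And>y. y \<in> S \<Longrightarrow> y \<bullet> (Sigma_mat *v y) \<le> x0 \<bullet> (Sigma_mat *v x0)"
      using continuous_attains_sup[OF S False cont] by blast
    have "x0 \<bullet> (Sigma_mat *v x0) < 0"
      using x0(1) by (intro Sigma_form_kernel_neg[OF W]) (auto simp: S_def)
    then show ?thesis
      using scale[of "- (x0 \<bullet> (Sigma_mat *v x0))"] x0(2)
      by (intro exI[of _ "- (x0 \<bullet> (Sigma_mat *v x0))"]) auto
  qed
qed

text \<open>\<open>u\<close> and \<open>v\<close> are the effort values at \<open>a\<close> and at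
  \<open>b\<close>; this isolates the finite-dimensional part of the boundary condition.\<close>

definition bd_form :: "real^4^2 \<Rightarrow> real^2 \<Rightarrow> real^2 \<Rightarrow> real^2" where
  "bd_form W u v = W *v stack ((1 / sqrt 2) *\<^sub>R (P1 *v v - P1 *v u)) ((1 / sqrt 2) *\<^sub>R (v + u))"

lemma P1_mult: "P1 *v v = vector [- v $ 2, - v $ 1]"
  by (simp add: vec_eq_iff forall_2 matrix_vector_mult_def sum_2 P1_def)

lemma stack_add: "stack (f + f') (e + e') = stack f e + stack f' e'"
  by (simp add: stack_def vec_eq_iff forall_4)

lemma stack_scale: "stack (c *\<^sub>R f) (c *\<^sub>R e) = c *\<^sub>R stack f e"
  by (simp add: stack_def vec_eq_iff forall_4)

lemma bd_form_add: "bd_form W (u + u') (v + v') = bd_form W u v + bd_form W u' v'"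
proof -
  have "stack ((1 / sqrt 2) *\<^sub>R (P1 *v (v + v') - P1 *v (u + u'))) ((1 / sqrt 2) *\<^sub>R ((v + v') + (u + u')))
     = stack ((1 / sqrt 2) *\<^sub>R (P1 *v v - P1 *v u)) ((1 / sqrt 2) *\<^sub>R (v + u))
       + stack ((1 / sqrt 2) *\<^sub>R (P1 *v v' - P1 *v u')) ((1 / sqrt 2) *\<^sub>R (v' + u'))"
    by (simp add: matrix_vector_right_distrib algebra_simps flip: stack_add)
  then show ?thesis
    by (simp add: bd_form_def matrix_vector_right_distrib)
qed

lemma bd_form_scale: "bd_form W (c *\<^sub>R u) (c *\<^sub>R v) = c *\<^sub>R bd_form W u v"
proof -
  have "stack ((1 / sqrt 2) *\<^sub>R (P1 *v (c *\<^sub>R v) - P1 *v (c *\<^sub>R u))) ((1 / sqrt 2) *\<^sub>R (c *\<^sub>R v + c *\<^sub>R u))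
     = c *\<^sub>R stack ((1 / sqrt 2) *\<^sub>R (P1 *v v - P1 *v u)) ((1 / sqrt 2) *\<^sub>R (v + u))"
    by (simp add: matrix_vector_mult_scaleR algebra_simps flip: stack_scale)
  then show ?thesis
    by (simp add: bd_form_def matrix_vector_mult_scaleR)
qed

text \<open>The map from end values to port variables is an isometry, and half of the \<Sigma>-form,
  which is f . e, becomes the power u_1 u_2 - v_1 v_2 entering through the two ends. Halving the
  form halves the constant.\<close>

lemma boundary_dissipation:
  assumes W: "pos_def (W ** Sigma_mat ** transpose W)"
  shows "\<exists>\<kappa>>0. \<forall>u v. bd_form W u v = 0 \<longrightarrow>
    u $ 1 * u $ 2 - v $ 1 * v $ 2 \<le> - \<kappa> * ((u $ 1)\<^sup>2 + (u $ 2)\<^sup>2 + (v $ 1)\<^sup>2 + (v $ 2)\<^sup>2)"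
proof -
  obtain \<kappa> where \<kappa>: "0 < \<kappa>" "\<And>x. W *v x = 0 \<Longrightarrow> x \<bullet> (Sigma_mat *v x) \<le> - \<kappa> * (norm x)\<^sup>2"
    using Sigma_form_kernel_coercive[OF W] by blast
  have "u $ 1 * u $ 2 - v $ 1 * v $ 2 \<le> - (\<kappa> / 2) * ((u $ 1)\<^sup>2 + (u $ 2)\<^sup>2 + (v $ 1)\<^sup>2 + (v $ 2)\<^sup>2)"
    if uv: "bd_form W u v = 0" for u v
  proof -
    let ?x = "stack ((1 / sqrt 2) *\<^sub>R (P1 *v v - P1 *v u)) ((1 / sqrt 2) *\<^sub>R (v + u))"
    let ?c = "1 / sqrt 2 :: real"
    have c: "?c * ?c = 1 / 2"
      by simp
    have x: "?x $ 1 = ?c * (u $ 2 - v $ 2)" "?x $ 2 = ?c * (u $ 1 - v $ 1)"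
      "?x $ 3 = ?c * (v $ 1 + u $ 1)" "?x $ 4 = ?c * (v $ 2 + u $ 2)"
      by (simp_all add: stack_def P1_mult)
    have "?x \<bullet> (Sigma_mat *v ?x) = 2 * (?c * ?c) * ((u $ 2 - v $ 2) * (v $ 1 + u $ 1) + (u $ 1 - v $ 1) * (v $ 2 + u $ 2))"
      unfolding Sigma_form x by algebra
    also have "\<dots> = 2 * (u $ 1 * u $ 2 - v $ 1 * v $ 2)"
      unfolding c by algebra
    finally have 1: "?x \<bullet> (Sigma_mat *v ?x) = 2 * (u $ 1 * u $ 2 - v $ 1 * v $ 2)" .
    have "(norm ?x)\<^sup>2 = (?x $ 1)\<^sup>2 + (?x $ 2)\<^sup>2 + (?x $ 3)\<^sup>2 + (?x $ 4)\<^sup>2"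
      by (simp only: power2_norm_eq_inner inner_vec_def sum_4) (simp add: power2_eq_square)
    also have "\<dots> = (?c * ?c) * ((u $ 2 - v $ 2)\<^sup>2 + (u $ 1 - v $ 1)\<^sup>2 + (v $ 1 + u $ 1)\<^sup>2 + (v $ 2 + u $ 2)\<^sup>2)"
      unfolding x by algebra
    also have "\<dots> = (u $ 1)\<^sup>2 + (u $ 2)\<^sup>2 + (v $ 1)\<^sup>2 + (v $ 2)\<^sup>2"
      unfolding c by algebra
    finally have 2: "(norm ?x)\<^sup>2 = (u $ 1)\<^sup>2 + (u $ 2)\<^sup>2 + (v $ 1)\<^sup>2 + (v $ 2)\<^sup>2" .
    show ?thesis
      using \<kappa>(2)[of ?x] uv unfolding bd_form_def 1 2 by simp
  qed
  then show ?thesis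
    using \<kappa>(1) by (intro exI[of _ "\<kappa> / 2"]) auto
qed

subsection \<open>The multiplier estimate on an interval\<close>

text \<open>The right-hand sides are the entries of -S Q' S, the derivative of the inverse S =
  Q^(-1).\<close>

lemma inverse_entry_derivatives:
  fixes q1 q2 q3 :: "real \<Rightarrow> real"
  assumes d: "(q1 has_real_derivative q1') F" "(q2 has_real_derivative q2') F" "(q3 has_real_derivative q3') F"
    and F: "F = at z within S" and det: "q1 z * q3 z - (q2 z)\<^sup>2 \<noteq> 0"
  defines "D \<equiv> \<lambda>z. q1 z * q3 z - (q2 z)\<^sup>2"
  defines "s11 \<equiv> \<lambda>z. q3 z / D z" and "s12 \<equiv> \<lambda>z. - q2 z / D z" and "s22 \<equiv> \<lambda>z. q1 z / D z"
  shows "(s11 has_real_derivative - ((s11 z)\<^sup>2 * q1' + 2 * s11 z * s12 z * q2' + (s12 z)\<^sup>2 * q3')) F"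
    "(s12 has_real_derivative - (s11 z * s12 z * q1' + (s11 z * s22 z + (s12 z)\<^sup>2) * q2' + s12 z * s22 z * q3')) F"
    "(s22 has_real_derivative - ((s12 z)\<^sup>2 * q1' + 2 * s12 z * s22 z * q2' + (s22 z)\<^sup>2 * q3')) F"
proof -
  have det': "D z \<noteq> 0"
    using det by (simp add: D_def)
  have D: "(D has_real_derivative (q1' * q3 z + q1 z * q3' - 2 * q2 z * q2')) F"
    unfolding D_def F by (auto intro!: derivative_eq_intros d[unfolded F])
  have quot: "((\<lambda>z. h z / D z) has_real_derivative (h' * D z - h z * (q1' * q3 z + q1 z * q3' - 2 * q2 z * q2')) / (D z * D z)) F"
    if "(h has_real_derivative h') F" for h h'
    using DERIV_divide[OF that[unfolded F] D[unfolded F] det'] unfolding F .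
  have e: "p / D z = p * D z / (D z * D z)" for p
    using det' by simp
  show "(s11 has_real_derivative - ((s11 z)\<^sup>2 * q1' + 2 * s11 z * s12 z * q2' + (s12 z)\<^sup>2 * q3')) F"
    unfolding s11_def s12_def
    by (rule DERIV_cong[OF quot[OF d(3)]])
      (use det' in \<open>simp add: field_simps power2_eq_square; simp add: D_def; algebra\<close>)
  show "(s12 has_real_derivative - (s11 z * s12 z * q1' + (s11 z * s22 z + (s12 z)\<^sup>2) * q2' + s12 z * s22 z * q3')) F"
    unfolding s11_def s12_def s22_def
    by (rule DERIV_cong[OF quot[OF DERIV_minus[OF d(2)[unfolded F], folded F]]])
      (use det' in \<open>simp add: field_simps power2_eq_square; simp add: D_def; algebra\<close>)
  show "(s22 has_real_derivative - ((s12 z)\<^sup>2 * q1' + 2 * s12 z * s22 z * q2' + (s22 z)\<^sup>2 * q3')) F"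
    unfolding s12_def s22_def
    by (rule DERIV_cong[OF quot[OF d(1)]])
      (use det' in \<open>simp add: field_simps power2_eq_square; simp add: D_def; algebra\<close>)
qed

text \<open>Symmetric \<open>2 \<times> 2\<close> matrices \<open>Q = ((q1, q2), (q2, q3))\<close>, with inverse
  \<open>S = ((s1, s2), (s2, s3))\<close>.\<close>
locale coefficients =
  fixes c d m L :: real and q1 q2 q3 q1' q2' q3' :: "real \<Rightarrow> real"
  assumes cd: "c < d" and m: "0 < m"
    and dq: "\<And>z. z \<in> {c..d} \<Longrightarrow> (q1 has_real_derivative q1' z) (at z within {c..d})"
      "\<And>z. z \<in> {c..d} \<Longrightarrow> (q2 has_real_derivative q2' z) (at z within {c..d})"
      "\<And>z. z \<in> {c..d} \<Longrightarrow> (q3 has_real_derivative q3' z) (at z within {c..d})"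
    and dq_cont: "continuous_on {c..d} q1'" "continuous_on {c..d} q2'" "continuous_on {c..d} q3'"
    and coercive: "\<And>z x y. z \<in> {c..d} \<Longrightarrow> m * (x\<^sup>2 + y\<^sup>2) \<le> q1 z * x\<^sup>2 + 2 * q2 z * x * y + q3 z * y\<^sup>2"
    and dq_bound: "\<And>z. z \<in> {c..d} \<Longrightarrow> \<bar>q1' z\<bar> \<le> L" "\<And>z. z \<in> {c..d} \<Longrightarrow> \<bar>q2' z\<bar> \<le> L"
      "\<And>z. z \<in> {c..d} \<Longrightarrow> \<bar>q3' z\<bar> \<le> L"
begin

definition dt :: "real \<Rightarrow> real" where "dt z = q1 z * q3 z - (q2 z)\<^sup>2"
definition s1 :: "real \<Rightarrow> real" where "s1 z = q3 z / dt z"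
definition s2 :: "real \<Rightarrow> real" where "s2 z = - q2 z / dt z"
definition s3 :: "real \<Rightarrow> real" where "s3 z = q1 z / dt z"

lemma q_continuous: "continuous_on {c..d} q1" "continuous_on {c..d} q2" "continuous_on {c..d} q3"
  using DERIV_continuous_on[OF dq(1)] DERIV_continuous_on[OF dq(2)] DERIV_continuous_on[OF dq(3)]
  by blast+

lemma dt_pos:
  assumes z: "z \<in> {c..d}"
  shows "0 < dt z"
proof -
  have q1: "m \<le> q1 z"
    using coercive[OF z, of 1 0] by simp
  \<comment> \<open>Coercivity tested on the vector (-q2, q1), where the form equals q1 times the
    determinant.\<close>
  have "0 < m * ((- q2 z)\<^sup>2 + (q1 z)\<^sup>2)"
    using m q1 by (intro mult_pos_pos) (auto simp: add_nonneg_pos)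
  also have "\<dots> \<le> q1 z * (- q2 z)\<^sup>2 + 2 * q2 z * (- q2 z) * q1 z + q3 z * (q1 z)\<^sup>2"
    using coercive[OF z] .
  also have "\<dots> = q1 z * dt z"
    by (simp add: dt_def algebra_simps power2_eq_square)
  finally show ?thesis
    using m q1 by (simp add: zero_less_mult_iff)
qed

lemma s_continuous: "continuous_on {c..d} s1" "continuous_on {c..d} s2" "continuous_on {c..d} s3"
proof -
  have dt: "continuous_on {c..d} dt"
    unfolding dt_def[abs_def] by (intro continuous_intros q_continuous)
  show "continuous_on {c..d} s1" "continuous_on {c..d} s2" "continuous_on {c..d} s3"
    unfolding s1_def[abs_def] s2_def[abs_def] s3_def[abs_def]
    using dt_pos by (intro continuous_intros q_continuous dt; force)+
qed

lemma Q_S: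
  assumes z: "z \<in> {c..d}" and x: "x1 = s1 z * e1 + s2 z * e2" "x2 = s2 z * e1 + s3 z * e2"
  shows "e1 = q1 z * x1 + q2 z * x2" "e2 = q2 z * x1 + q3 z * x2"
proof -
  have e: "dt z * x1 = q3 z * e1 - q2 z * e2" "dt z * x2 = q1 z * e2 - q2 z * e1"
    using dt_pos[OF z] by (simp_all add: x s1_def s2_def s3_def field_simps)
  have "dt z * e1 = dt z * (q1 z * x1 + q2 z * x2)" 
    using e unfolding dt_def by algebra
  moreover have "dt z * e2 = dt z * (q2 z * x1 + q3 z * x2)"
    using e unfolding dt_def by algebra
  ultimately show "e1 = q1 z * x1 + q2 z * x2" "e2 = q2 z * x1 + q3 z * x2"
    using dt_pos[OF z] by auto
qed

lemma S_Q:
  assumes z: "z \<in> {c..d}" and e: "e1 = q1 z * x1 + q2 z * x2" "e2 = q2 z * x1 + q3 z * x2"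
  shows "x1 = s1 z * e1 + s2 z * e2" "x2 = s2 z * e1 + s3 z * e2"
proof -
  have "dt z * x1 = q3 z * e1 - q2 z * e2" "dt z * x2 = q1 z * e2 - q2 z * e1"
    unfolding dt_def e by algebra+
  then show "x1 = s1 z * e1 + s2 z * e2" "x2 = s2 z * e1 + s3 z * e2"
    using dt_pos[OF z] by (simp_all add: s1_def s2_def s3_def field_simps)
qed

definition s1' :: "real \<Rightarrow> real" where
  "s1' z = - ((s1 z)\<^sup>2 * q1' z + 2 * s1 z * s2 z * q2' z + (s2 z)\<^sup>2 * q3' z)"
definition s2' :: "real \<Rightarrow> real" where
  "s2' z = - (s1 z * s2 z * q1' z + (s1 z * s3 z + (s2 z)\<^sup>2) * q2' z + s2 z * s3 z * q3' z)"
definition s3' :: "real \<Rightarrow> real" where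
  "s3' z = - ((s2 z)\<^sup>2 * q1' z + 2 * s2 z * s3 z * q2' z + (s3 z)\<^sup>2 * q3' z)"

lemma s_ac_on: "ac_on c d s1 s1'" "ac_on c d s2 s2'" "ac_on c d s3 s3'"
proof -
  have D: "(s1 has_real_derivative s1' z) (at z within {c..d})"
    "(s2 has_real_derivative s2' z) (at z within {c..d})"
    "(s3 has_real_derivative s3' z) (at z within {c..d})" if z: "z \<in> {c..d}" for z
    using inverse_entry_derivatives[OF dq[OF z] refl] dt_pos[OF z]
    unfolding s1'_def s2'_def s3'_def s1_def[abs_def] s2_def[abs_def] s3_def[abs_def] dt_def[abs_def]
    by auto
  have "continuous_on {c..d} s1'" "continuous_on {c..d} s2'" "continuous_on {c..d} s3'"
    unfolding s1'_def[abs_def] s2'_def[abs_def] s3'_def[abs_def]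
    by (intro continuous_intros s_continuous dq_cont)+
  then show "ac_on c d s1 s1'" "ac_on c d s2 s2'" "ac_on c d s3 s3'"
    using D by (auto intro!: ac_on_C1)
qed

text \<open>With e = Q x, the density h = e^T S e = x^T Q x satisfies h' = 2 e'^T x - x^T Q' x. So
  twice the multiplier integrand is (w h)' minus |w| (k h - \<sigma> x^T Q' x), and the subtracted
  part is at least |x|^2 because |w| \<ge> 1 and k m \<ge> 2 L + 1. The summand with factor 1/2 is
  an exact derivative, that of -(1/2) e_1 e_2.\<close>

lemma multiplier_estimate:
  assumes E: "ac_on c d E1 g1" "ac_on c d E2 g2"
    and sgn: "\<sigma> = 1 \<or> \<sigma> = -1" "\<forall>z\<in>{c..d}. 0 \<le> \<sigma> * z"
    and k: "2 * L + 1 \<le> k * m" "0 \<le> k" and \<epsilon>: "0 \<le> \<epsilon>"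
  defines "w \<equiv> \<lambda>z. \<sigma> * exp (\<sigma> * k * z)"
    and "x1 \<equiv> \<lambda>z. s1 z * E1 z + s2 z * E2 z" and "x2 \<equiv> \<lambda>z. s2 z * E1 z + s3 z * E2 z"
  shows "(LINT z:{c..d}|lborel. - (1/2) * (g2 z * E1 z + g1 z * E2 z) + \<epsilon> * w z * (g1 z * x1 z + g2 z * x2 z)) \<le>
     - (1/2) * (E1 d * E2 d - E1 c * E2 c)
     + \<epsilon> / 2 * (w d * (E1 d * x1 d + E2 d * x2 d) - w c * (E1 c * x1 c + E2 c * x2 c)
        - (LINT z:{c..d}|lborel. (x1 z)\<^sup>2 + (x2 z)\<^sup>2))"
    and "set_integrable lborel {c..d} (\<lambda>z. - (1/2) * (g2 z * E1 z + g1 z * E2 z) + \<epsilon> * w z * (g1 z * x1 z + g2 z * x2 z))"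
    and "set_integrable lborel {c..d} (\<lambda>z. (x1 z)\<^sup>2 + (x2 z)\<^sup>2)"
proof -
  define h where "h z = s1 z * (E1 z * E1 z) + (2 * (s2 z * (E1 z * E2 z)) + s3 z * (E2 z * E2 z))" for z
  define h' where "h' z = (s1' z * (E1 z * E1 z) + (g1 z * E1 z + g1 z * E1 z) * s1 z) +
     (2 * (s2' z * (E1 z * E2 z) + (g1 z * E2 z + g2 z * E1 z) * s2 z) +
      (s3' z * (E2 z * E2 z) + (g2 z * E2 z + g2 z * E2 z) * s3 z))" for z
  define w' where "w' z = k * exp (\<sigma> * k * z)" for z
  have h: "ac_on c d h h'"
    unfolding h_def h'_def by (intro ac_on_add ac_on_cmult ac_on_mult s_ac_on E)
  have w: "ac_on c d w w'"
  proof (rule ac_on_C1)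
    show "(w has_real_derivative w' z) (at z within {c..d})" for z
      unfolding w_def w'_def using sgn(1) by (auto intro!: derivative_eq_intros)
    show "continuous_on {c..d} w'"
      unfolding w'_def by (intro continuous_intros)
  qed
  have wh: "ac_on c d (\<lambda>z. w z * h z) (\<lambda>z. w' z * h z + h' z * w z)"
    by (rule ac_on_mult[OF w h])
  have EE: "ac_on c d (\<lambda>z. E1 z * E2 z) (\<lambda>z. g1 z * E2 z + g2 z * E1 z)"
    by (rule ac_on_mult[OF E])
  note Ec = ac_on_continuous[OF E(1)] ac_on_continuous[OF E(2)]
  have xc: "continuous_on {c..d} x1" "continuous_on {c..d} x2"
    unfolding x1_def x2_def by (intro continuous_intros s_continuous Ec)+
  have h_eq: "h z = E1 z * x1 z + E2 z * x2 z" for z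
    unfolding h_def x1_def x2_def by algebra
  have int_h: "(LINT z:{c..d}|lborel. w' z * h z + h' z * w z) = w d * h d - w c * h c"
    using ac_onD(2)[OF wh, of d] cd by simp
  have int_E: "(LINT z:{c..d}|lborel. g1 z * E2 z + g2 z * E1 z) = E1 d * E2 d - E1 c * E2 c"
    using ac_onD(2)[OF EE, of d] cd by simp
  define ge where "ge z = g1 z * E2 z + g2 z * E1 z" for z
  show xint: "set_integrable lborel {c..d} (\<lambda>z. (x1 z)\<^sup>2 + (x2 z)\<^sup>2)"
    by (intro borel_integrable_atLeastAtMost' continuous_intros xc)
  define gx where "gx z = g1 z * (w z * x1 z) + g2 z * (w z * x2 z)" for z
  have wx: "set_integrable lborel {c..d} gx"
    unfolding gx_def[abs_def]
    by (intro set_integral_add set_integrable_continuous_mult ac_onD(1)[OF E(1)] ac_onD(1)[OF E(2)]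
        continuous_on_mult ac_on_continuous[OF w] xc)
  have point: "2 * gx z \<le> (w' z * h z + h' z * w z) - ((x1 z)\<^sup>2 + (x2 z)\<^sup>2)"
    if z: "z \<in> {c..d}" for z
  proof -
    note QS = Q_S[OF z, of "x1 z" "E1 z" "E2 z" "x2 z", OF x1_def[THEN meta_eq_to_obj_eq, THEN fun_cong] x2_def[THEN meta_eq_to_obj_eq, THEN fun_cong]]
    let ?R = "(x1 z)\<^sup>2 * q1' z + 2 * x1 z * x2 z * q2' z + (x2 z)\<^sup>2 * q3' z"
    \<comment> \<open>This is where S' = -S Q' S enters: e^T S' e = -x^T Q' x.\<close>
    have h'_eq: "h' z = 2 * (g1 z * x1 z + g2 z * x2 z) - ?R"
      unfolding h'_def s1'_def s2'_def s3'_def x1_def x2_def by algebra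
    have 1: "(w' z * h z + h' z * w z) - 2 * gx z =
        exp (\<sigma> * k * z) * (k * h z - \<sigma> * ?R)"
      unfolding h'_eq gx_def w_def w'_def by algebra
    have hm: "m * ((x1 z)\<^sup>2 + (x2 z)\<^sup>2) \<le> h z"
    proof -
      have "h z = q1 z * (x1 z)\<^sup>2 + 2 * q2 z * x1 z * x2 z + q3 z * (x2 z)\<^sup>2"
        unfolding h_eq by (subst QS(1), subst QS(2)) (simp add: algebra_simps power2_eq_square)
      then show ?thesis
        using coercive[OF z, of "x1 z" "x2 z"] by simp
    qed
    \<comment> \<open>The two diagonal entries together cost L |x|^2 and the doubled mixed term as
      much again, whence 2 L.\<close>
    have R: "\<bar>?R\<bar> \<le> 2 * L * ((x1 z)\<^sup>2 + (x2 z)\<^sup>2)"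
    proof -
      have L: "0 \<le> L"
        using dq_bound(1)[OF z] by linarith
      have "2 * \<bar>x1 z\<bar> * \<bar>x2 z\<bar> \<le> (x1 z)\<^sup>2 + (x2 z)\<^sup>2"
        using sum_squares_bound[of "\<bar>x1 z\<bar>" "\<bar>x2 z\<bar>"] by simp
      then have "2 * \<bar>x1 z\<bar> * \<bar>x2 z\<bar> * \<bar>q2' z\<bar> \<le> ((x1 z)\<^sup>2 + (x2 z)\<^sup>2) * L"
        using dq_bound(2)[OF z] by (intro mult_mono) auto
      moreover have "(x1 z)\<^sup>2 * \<bar>q1' z\<bar> \<le> (x1 z)\<^sup>2 * L" "(x2 z)\<^sup>2 * \<bar>q3' z\<bar> \<le> (x2 z)\<^sup>2 * L"
        using dq_bound[OF z] by (auto intro!: mult_left_mono)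
      moreover have "\<bar>?R\<bar> \<le> (x1 z)\<^sup>2 * \<bar>q1' z\<bar> + 2 * \<bar>x1 z\<bar> * \<bar>x2 z\<bar> * \<bar>q2' z\<bar> + (x2 z)\<^sup>2 * \<bar>q3' z\<bar>"
      proof -
        have "\<bar>u + v + t\<bar> \<le> \<bar>u\<bar> + \<bar>v\<bar> + \<bar>t\<bar>" for u v t :: real
          by linarith
        from this[of "(x1 z)\<^sup>2 * q1' z" "2 * x1 z * x2 z * q2' z" "(x2 z)\<^sup>2 * q3' z"] show ?thesis
          by (simp add: abs_mult)
      qed
      ultimately show ?thesis
        by (simp add: algebra_simps)
    qed
    have "\<sigma> * ?R \<le> \<bar>?R\<bar>"
      using sgn(1) by auto
    moreover have "k * (m * ((x1 z)\<^sup>2 + (x2 z)\<^sup>2)) \<le> k * h z"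
      using hm k(2) by (intro mult_left_mono)
    moreover have "(2 * L + 1) * ((x1 z)\<^sup>2 + (x2 z)\<^sup>2) \<le> k * m * ((x1 z)\<^sup>2 + (x2 z)\<^sup>2)"
      using k(1) by (intro mult_right_mono) auto
    ultimately have 2: "(x1 z)\<^sup>2 + (x2 z)\<^sup>2 \<le> k * h z - \<sigma> * ?R"
      using R by (simp add: algebra_simps)
    \<comment> \<open>The sign hypothesis makes the exponent nonnegative on the interval, so the
      exponential factor is at least 1.\<close>
    have "0 \<le> \<sigma> * k * z"
      using mult_nonneg_nonneg[OF k(2) bspec[OF sgn(2) z]] by (simp add: ac_simps)
    then have "1 * ((x1 z)\<^sup>2 + (x2 z)\<^sup>2) \<le> exp (\<sigma> * k * z) * (k * h z - \<sigma> * ?R)"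
      using 2 by (intro mult_mono) auto
    then show ?thesis
      using 1 by simp
  qed
  have "(LINT z:{c..d}|lborel. 2 * gx z) \<le>
      (LINT z:{c..d}|lborel. (w' z * h z + h' z * w z) - ((x1 z)\<^sup>2 + (x2 z)\<^sup>2))"
    using wx xint ac_onD(1)[OF wh] point by (intro set_integral_mono set_integral_diff) auto
  also have "\<dots> = w d * h d - w c * h c - (LINT z:{c..d}|lborel. (x1 z)\<^sup>2 + (x2 z)\<^sup>2)"
    using xint ac_onD(1)[OF wh] by (subst set_integral_diff) (simp_all add: int_h)
  finally have main: "2 * (LINT z:{c..d}|lborel. gx z) \<le>
      w d * h d - w c * h c - (LINT z:{c..d}|lborel. (x1 z)\<^sup>2 + (x2 z)\<^sup>2)"
    by simp
  have "set_integrable lborel {c..d} ge"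
    unfolding ge_def[abs_def] by (rule ac_onD(1)[OF EE])
  then have i1: "set_integrable lborel {c..d} (\<lambda>z. (- (1/2)) * ge z)"
    by (intro set_integrable_mult_right)
  have i2: "set_integrable lborel {c..d} (\<lambda>z. \<epsilon> * gx z)"
    using wx by (intro set_integrable_mult_right)
  have "(\<lambda>z. - (1/2) * (g2 z * E1 z + g1 z * E2 z) + \<epsilon> * w z * (g1 z * x1 z + g2 z * x2 z)) =
      (\<lambda>z. (- (1/2)) * ge z + \<epsilon> * gx z)"
    by (auto simp: gx_def ge_def algebra_simps)
  then show "set_integrable lborel {c..d} (\<lambda>z. - (1/2) * (g2 z * E1 z + g1 z * E2 z) + \<epsilon> * w z * (g1 z * x1 z + g2 z * x2 z))"
    using set_integral_add(1)[OF i1 i2] by simp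
  have "(LINT z:{c..d}|lborel. - (1/2) * (g2 z * E1 z + g1 z * E2 z) + \<epsilon> * w z * (g1 z * x1 z + g2 z * x2 z)) =
      (LINT z:{c..d}|lborel. (- (1/2)) * ge z + \<epsilon> * gx z)"
    by (intro set_lebesgue_integral_cong) (auto simp: gx_def ge_def algebra_simps)
  also have "\<dots> = (- (1/2)) * (LINT z:{c..d}|lborel. ge z) + \<epsilon> * (LINT z:{c..d}|lborel. gx z)"
    by (subst set_integral_add(2)[OF i1 i2]) (simp only: set_integral_mult_right)
  also have "\<dots> \<le> (- (1/2)) * (E1 d * E2 d - E1 c * E2 c)
      + \<epsilon> / 2 * (w d * h d - w c * h c - (LINT z:{c..d}|lborel. (x1 z)\<^sup>2 + (x2 z)\<^sup>2))"
    using mult_left_mono[OF main \<epsilon>] unfolding ge_def int_E by simp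
  finally show "(LINT z:{c..d}|lborel. - (1/2) * (g2 z * E1 z + g1 z * E2 z) + \<epsilon> * w z * (g1 z * x1 z + g2 z * x2 z)) \<le>
     - (1/2) * (E1 d * E2 d - E1 c * E2 c)
     + \<epsilon> / 2 * (w d * (E1 d * x1 d + E2 d * x2 d) - w c * (E1 c * x1 c + E2 c * x2 c)
        - (LINT z:{c..d}|lborel. (x1 z)\<^sup>2 + (x2 z)\<^sup>2))"
    unfolding h_eq .
qed

text \<open>The density is e^T S e with 0 \<le> S \<le> 1/m. The upper bound comes from |e - m x|^2
  \<ge> 0 together with m |x|^2 \<le> e . x.\<close>

lemma energy_density_le:
  assumes z: "z \<in> {c..d}" and x: "x1 = s1 z * e1 + s2 z * e2" "x2 = s2 z * e1 + s3 z * e2"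
  shows "0 \<le> e1 * x1 + e2 * x2" "e1 * x1 + e2 * x2 \<le> (e1\<^sup>2 + e2\<^sup>2) / m"
proof -
  have "e1 * x1 + e2 * x2 = q1 z * x1\<^sup>2 + 2 * q2 z * x1 * x2 + q3 z * x2\<^sup>2"
    unfolding Q_S(1)[OF z x] Q_S(2)[OF z x] by (simp add: algebra_simps power2_eq_square)
  then have 1: "m * (x1\<^sup>2 + x2\<^sup>2) \<le> e1 * x1 + e2 * x2"
    using coercive[OF z, of x1 x2] by simp
  moreover have "0 \<le> m * (x1\<^sup>2 + x2\<^sup>2)"
    using m by simp
  ultimately show "0 \<le> e1 * x1 + e2 * x2"
    by simp
  have "0 \<le> (e1 - m * x1)\<^sup>2 + (e2 - m * x2)\<^sup>2"
    by simp
  also have "\<dots> = (e1\<^sup>2 + e2\<^sup>2) + m * (m * (x1\<^sup>2 + x2\<^sup>2)) - 2 * m * (e1 * x1 + e2 * x2)"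
    by (simp add: algebra_simps power2_eq_square)
  also have "m * (m * (x1\<^sup>2 + x2\<^sup>2)) \<le> m * (e1 * x1 + e2 * x2)"
    using 1 m by (intro mult_left_mono) auto
  finally show "e1 * x1 + e2 * x2 \<le> (e1\<^sup>2 + e2\<^sup>2) / m"
    using m by (simp add: field_simps)
qed

end

subsection \<open>The operator in terms of continuous representatives\<close>

lemma sqi_imp_sq_integrable_on:
  assumes "sqi f"
  shows "sq_integrable_on c d f"
proof -
  have "set_integrable lborel {c<..<d} (\<lambda>z. (f z)\<^sup>2)"
    unfolding set_integrable_def using assms by (intro integrable_mult_indicator) (auto simp: sqi_def)
  moreover have "set_borel_measurable lborel {c<..<d} f"
    unfolding set_borel_measurable_def using assms by (auto simp: sqi_def)
  ultimately show ?thesis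
    by (simp add: sq_integrable_on_def)
qed

lemma sq_integrable_on_imp_sqi:
  assumes "sq_integrable_on c d f"
  shows "sqi (\<lambda>z. indicator {c<..<d} z * f z)"
proof -
  have "(\<lambda>z. (indicator {c<..<d} z * f z)\<^sup>2) = (\<lambda>z. indicator {c<..<d} z *\<^sub>R (f z)\<^sup>2)"
    by (auto split: split_indicator)
  then show ?thesis
    using assms by (simp add: sqi_def sq_integrable_on_def set_borel_measurable_def set_integrable_def)
qed

lemma sqi_set_integrable: "sqi f \<Longrightarrow> set_integrable lborel {c..d} f"
  by (intro sq_integrable_on_imp_set_integrable sqi_imp_sq_integrable_on)

lemma sqi_continuous:
  assumes "continuous_on {c..d} (f :: real \<Rightarrow> real)" "S \<in> sets borel" "S \<subseteq> {c..d}"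
  shows "sqi (\<lambda>z. indicator S z * f z)"
proof -
  have "set_integrable lborel {c<..<d} (\<lambda>z. (f z)\<^sup>2)"
    unfolding set_integrable_Ioo_iff_Icc
    using assms by (intro borel_integrable_atLeastAtMost' continuous_intros)
  moreover have "(\<lambda>z. indicator {c<..<d} z *\<^sub>R f z) \<in> borel_measurable borel"
    using assms(1) by (intro borel_measurable_continuous_on_indicator) (auto intro: continuous_on_subset)
  then have "set_borel_measurable lborel {c<..<d} f"
    by (simp add: set_borel_measurable_def)
  ultimately have "sqi (\<lambda>z. indicator {c<..<d} z * f z)"
    by (intro sq_integrable_on_imp_sqi) (simp add: sq_integrable_on_def)
  then have sq: "sqi (\<lambda>z. indicator S z * (indicator {c<..<d} z * f z))"
    using assms(2) by (rule sqi_indicator)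
  have "(\<lambda>z. indicator {c..d} z *\<^sub>R f z) \<in> borel_measurable borel"
    using assms(1) by (intro borel_measurable_continuous_on_indicator) auto
  then have "(\<lambda>z. indicator S z * (indicator {c..d} z *\<^sub>R f z)) \<in> borel_measurable borel"
    using assms(2) by simp
  moreover have "(\<lambda>z. indicator S z * (indicator {c..d} z *\<^sub>R f z)) = (\<lambda>z. indicator S z * f z)"
    using assms(3) by (auto simp: fun_eq_iff split: split_indicator)
  ultimately have m: "(\<lambda>z. indicator S z * f z) \<in> borel_measurable borel"
    by simp
  have "AE z in lborel. z \<noteq> c \<and> z \<noteq> d"
    by (intro AE_conjI AE_lborel_singleton)
  then have "AE z in lborel. indicator S z * (indicator {c<..<d} z * f z) = indicator S z * f z"
    by eventually_elim (use assms(3) in \<open>auto split: split_indicator\<close>)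
  then show ?thesis
    by (rule sqi_cong_AE[OF sq m])
qed

lemma ac_on_cong_AE:
  assumes F: "ac_on c d F f" and g: "set_integrable lborel {c..d} g"
    and eq: "AE z in lborel. z \<in> {c<..<d} \<longrightarrow> f z = g z"
  shows "ac_on c d F g"
  unfolding ac_on_def
proof (intro conjI ballI g)
  fix z assume z: "z \<in> {c..d}"
  have int: "set_integrable lborel {c..z} f" "set_integrable lborel {c..z} g"
    using set_integrable_subinterval[OF ac_onD(1)[OF F]] set_integrable_subinterval[OF g] z by auto
  have "(LINT s:{c..z}|lborel. f s) = (LINT s:{c..z}|lborel. g s)"
    unfolding set_lebesgue_integral_def
  proof (rule integral_cong_AE)
    have "AE s in lborel. s \<noteq> c \<and> s \<noteq> d"
      by (intro AE_conjI AE_lborel_singleton)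
    with eq show "AE s in lborel. indicator {c..z} s *\<^sub>R f s = indicator {c..z} s *\<^sub>R g s"
      by eventually_elim (use z in \<open>auto split: split_indicator\<close>)
  qed (use int in \<open>auto simp: set_integrable_def dest: borel_measurable_integrable\<close>)
  then show "F z = F c + (LINT s:{c..z}|lborel. g s)"
    using ac_onD(2)[OF F z] by simp
qed

lemma dom_J0_weak:
  assumes "e \<in> dom_J0 a b"
  shows "has_weak_deriv a 0 (component e 1) (weak_deriv a 0 (component e 1))"
    "has_weak_deriv 0 b (component e 1) (weak_deriv 0 b (component e 1))"
    "has_weak_deriv a b (component e 2) (weak_deriv a b (component e 2))"
  using assms by (auto simp: dom_J0_def intro: weak_deriv_works)

lemma sq_integrable_J0:
  assumes ab: "a < 0" "0 < b" and e: "e \<in> dom_J0 a b"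
  shows "sq_integrable (\<lambda>z. if z \<in> {a<..<0} \<union> {0<..<b}
     then vector [d0 a b (component e 2) z, - d0_adj a b (component e 1) z] else 0)" (is "sq_integrable ?F")
  unfolding sq_integrable_iff
proof
  note w = dom_J0_weak[OF e, unfolded has_weak_deriv_def]
  have "(\<lambda>z. ?F z $ 1) = (\<lambda>z. - (indicator ({a<..<0} \<union> {0<..<b}) z * (indicator {a<..<b} z * weak_deriv a b (component e 2) z)))"
    using ab by (auto simp: fun_eq_iff d0_def split: split_indicator)
  moreover have "sqi (\<lambda>z. - (indicator ({a<..<0} \<union> {0<..<b}) z * (indicator {a<..<b} z * weak_deriv a b (component e 2) z)))"
    using w by (intro sqi_minus sqi_indicator sq_integrable_on_imp_sqi) auto
  ultimately show "sqi (\<lambda>z. ?F z $ 1)"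
    by simp
  have "(\<lambda>z. ?F z $ 2) = (\<lambda>z. - (indicator {a<..<0} z * weak_deriv a 0 (component e 1) z
      + indicator {0<..<b} z * weak_deriv 0 b (component e 1) z))"
    using ab by (auto simp: fun_eq_iff d0_adj_def split: split_indicator)
  moreover have "sqi (\<lambda>z. - (indicator {a<..<0} z * weak_deriv a 0 (component e 1) z
      + indicator {0<..<b} z * weak_deriv 0 b (component e 1) z))"
    using w by (intro sqi_minus sqi_add sq_integrable_on_imp_sqi) auto
  ultimately show "sqi (\<lambda>z. ?F z $ 2)"
    by simp
qed

lemma component_J0:
  assumes ab: "a < 0" "0 < b" and e: "e \<in> dom_J0 a b"
  shows "AE z in lborel. component (J0 a b e) 1 z =
      (if z \<in> {a<..<0} \<union> {0<..<b} then - weak_deriv a b (component e 2) z else 0)"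
    and "AE z in lborel. component (J0 a b e) 2 z =
      (if z \<in> {a<..<0} then - weak_deriv a 0 (component e 1) z
       else if z \<in> {0<..<b} then - weak_deriv 0 b (component e 1) z else 0)"
proof -
  show "AE z in lborel. component (J0 a b e) 1 z =
      (if z \<in> {a<..<0} \<union> {0<..<b} then - weak_deriv a b (component e 2) z else 0)"
    using component_abs[OF sq_integrable_J0[OF assms], of 1] unfolding J0_def[symmetric]
    by eventually_elim (simp add: d0_def)
  show "AE z in lborel. component (J0 a b e) 2 z =
      (if z \<in> {a<..<0} then - weak_deriv a 0 (component e 1) z
       else if z \<in> {0<..<b} then - weak_deriv 0 b (component e 1) z else 0)"
    using component_abs[OF sq_integrable_J0[OF assms], of 2] unfolding J0_def[symmetric]
    by eventually_elim (auto simp: d0_adj_def)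
qed

lemma J0_in_L2_space:
  assumes "a < 0" "0 < b" "e \<in> dom_J0 a b"
  shows "J0 a b e \<in> L2_space a b"
  unfolding L2_space_iff using component_J0[OF assms] by eventually_elim (use assms in auto)

lemma entry_deriv:
  assumes "(Q has_vector_derivative (Q' :: real^2^2)) F"
  shows "((\<lambda>z. Q z $ i $ j) has_real_derivative Q' $ i $ j) F"
  unfolding has_real_derivative_iff_has_vector_derivative
  using bounded_linear.has_vector_derivative[OF bounded_linear_compose[OF bounded_linear_vec_nth bounded_linear_vec_nth] assms] .

text \<open>Scalar inequalities at every point replace the almost everywhere matrix bounds;
  \<open>form_bounds\<close> supplies them by continuity of the coefficients. One \<open>L\<close>
  bounds the derivative entries of both coefficients.\<close>

locale port_hamiltonian =
  fixes a b m M L r :: real and Qm Qp Qm' Qp' :: "real \<Rightarrow> real^2^2" and W :: "real^4^2"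
  assumes ab: "a < 0" "0 < b" and m: "0 < m" and r: "0 \<le> r"
    and sym: "\<And>z. z \<in> {a..b} \<Longrightarrow> Qm z $ 2 $ 1 = Qm z $ 1 $ 2" "\<And>z. z \<in> {a..b} \<Longrightarrow> Qp z $ 2 $ 1 = Qp z $ 1 $ 2"
    and lower: "\<And>z x y. z \<in> {a..b} \<Longrightarrow> m * (x\<^sup>2 + y\<^sup>2) \<le> Qm z $ 1 $ 1 * x\<^sup>2 + 2 * Qm z $ 1 $ 2 * x * y + Qm z $ 2 $ 2 * y\<^sup>2"
      "\<And>z x y. z \<in> {a..b} \<Longrightarrow> m * (x\<^sup>2 + y\<^sup>2) \<le> Qp z $ 1 $ 1 * x\<^sup>2 + 2 * Qp z $ 1 $ 2 * x * y + Qp z $ 2 $ 2 * y\<^sup>2"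
    and upper: "\<And>z x y. z \<in> {a..b} \<Longrightarrow> Qm z $ 1 $ 1 * x\<^sup>2 + 2 * Qm z $ 1 $ 2 * x * y + Qm z $ 2 $ 2 * y\<^sup>2 \<le> M * (x\<^sup>2 + y\<^sup>2)"
      "\<And>z x y. z \<in> {a..b} \<Longrightarrow> Qp z $ 1 $ 1 * x\<^sup>2 + 2 * Qp z $ 1 $ 2 * x * y + Qp z $ 2 $ 2 * y\<^sup>2 \<le> M * (x\<^sup>2 + y\<^sup>2)"
    and deriv: "\<And>z. z \<in> {a..b} \<Longrightarrow> (Qm has_vector_derivative Qm' z) (at z within {a..b})"
      "\<And>z. z \<in> {a..b} \<Longrightarrow> (Qp has_vector_derivative Qp' z) (at z within {a..b})"
    and deriv_cont: "continuous_on {a..b} Qm'" "continuous_on {a..b} Qp'"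
    and deriv_bound: "\<And>z i j. z \<in> {a..b} \<Longrightarrow> \<bar>Qm' z $ i $ j\<bar> \<le> L" "\<And>z i j. z \<in> {a..b} \<Longrightarrow> \<bar>Qp' z $ i $ j\<bar> \<le> L"
    and W: "pos_def (W ** Sigma_mat ** transpose W)"
begin

sublocale minus: coefficients a 0 m L "\<lambda>z. Qm z $ 1 $ 1" "\<lambda>z. Qm z $ 1 $ 2" "\<lambda>z. Qm z $ 2 $ 2"
  "\<lambda>z. Qm' z $ 1 $ 1" "\<lambda>z. Qm' z $ 1 $ 2" "\<lambda>z. Qm' z $ 2 $ 2"
proof -
  have d: "((\<lambda>z. Qm z $ i $ j) has_real_derivative Qm' z $ i $ j) (at z within {a..0})"
    if "z \<in> {a..0}" for z i j
    by (rule DERIV_subset[OF entry_deriv[OF deriv(1)]]) (use ab that in auto)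
  have "continuous_on {a..0} Qm'"
    using deriv_cont(1) by (rule continuous_on_subset) (use ab in auto)
  then have c: "continuous_on {a..0} (\<lambda>z. Qm' z $ i $ j)" for i j
    by (intro continuous_on_component)
  show "coefficients a 0 m L (\<lambda>z. Qm z $ 1 $ 1) (\<lambda>z. Qm z $ 1 $ 2) (\<lambda>z. Qm z $ 2 $ 2)
    (\<lambda>z. Qm' z $ 1 $ 1) (\<lambda>z. Qm' z $ 1 $ 2) (\<lambda>z. Qm' z $ 2 $ 2)"
    by unfold_locales (use ab m lower(1) deriv_bound(1) d c in auto)
qed

sublocale plus: coefficients 0 b m L "\<lambda>z. Qp z $ 1 $ 1" "\<lambda>z. Qp z $ 1 $ 2" "\<lambda>z. Qp z $ 2 $ 2"
  "\<lambda>z. Qp' z $ 1 $ 1" "\<lambda>z. Qp' z $ 1 $ 2" "\<lambda>z. Qp' z $ 2 $ 2"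
proof -
  have d: "((\<lambda>z. Qp z $ i $ j) has_real_derivative Qp' z $ i $ j) (at z within {0..b})"
    if "z \<in> {0..b}" for z i j
    by (rule DERIV_subset[OF entry_deriv[OF deriv(2)]]) (use ab that in auto)
  have "continuous_on {0..b} Qp'"
    using deriv_cont(2) by (rule continuous_on_subset) (use ab in auto)
  then have c: "continuous_on {0..b} (\<lambda>z. Qp' z $ i $ j)" for i j
    by (intro continuous_on_component)
  show "coefficients 0 b m L (\<lambda>z. Qp z $ 1 $ 1) (\<lambda>z. Qp z $ 1 $ 2) (\<lambda>z. Qp z $ 2 $ 2)
    (\<lambda>z. Qp' z $ 1 $ 1) (\<lambda>z. Qp' z $ 1 $ 2) (\<lambda>z. Qp' z $ 2 $ 2)"
    by unfold_locales (use ab m lower(2) deriv_bound(2) d c in auto)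
qed

definition q :: "2 \<Rightarrow> 2 \<Rightarrow> real \<Rightarrow> real" where
  "q i j z = Q0 a b Qm Qp z $ i $ j"

lemma q_eq: "q i j z = indicator {a..<0} z * Qm z $ i $ j + indicator {0<..b} z * Qp z $ i $ j"
  by (simp add: q_def Q0_def)

lemma Q_entry_continuous:
  "continuous_on {a..b} (\<lambda>z. Qm z $ i $ j)" "continuous_on {a..b} (\<lambda>z. Qp z $ i $ j)"
  using DERIV_continuous_on[OF entry_deriv[OF deriv(1)]] DERIV_continuous_on[OF entry_deriv[OF deriv(2)]]
  by blast+

lemma q_measurable [measurable]: "q i j \<in> borel_measurable borel"
proof -
  have "(\<lambda>z. indicator {a..<0} z * Qm z $ i $ j + indicator {0<..b} z * Qp z $ i $ j) \<in> borel_measurable borel"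
    by (intro borel_measurable_add sqi_measurable[OF sqi_continuous[OF Q_entry_continuous(1)]]
        sqi_measurable[OF sqi_continuous[OF Q_entry_continuous(2)]]) (use ab in auto)
  then show ?thesis
    by (simp add: q_eq[abs_def])
qed

lemma q_bounded: "\<exists>B. \<forall>i j z. \<bar>q i j z\<bar> \<le> B"
proof -
  have "\<exists>B. \<forall>z. \<bar>q i j z\<bar> \<le> B" for i j
  proof -
    obtain B1 where B1: "\<forall>y\<in>(\<lambda>z. Qm z $ i $ j) ` {a..b}. norm y \<le> B1"
      using compact_imp_bounded[OF compact_continuous_image[OF Q_entry_continuous(1) compact_Icc]]
      unfolding bounded_iff by blast
    obtain B2 where B2: "\<forall>y\<in>(\<lambda>z. Qp z $ i $ j) ` {a..b}. norm y \<le> B2"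
      using compact_imp_bounded[OF compact_continuous_image[OF Q_entry_continuous(2) compact_Icc]]
      unfolding bounded_iff by blast
    have "\<bar>q i j z\<bar> \<le> \<bar>B1\<bar> + \<bar>B2\<bar>" for z
    proof (cases "z \<in> {a..b}")
      case True
      then have "\<bar>Qm z $ i $ j\<bar> \<le> B1" "\<bar>Qp z $ i $ j\<bar> \<le> B2"
        using B1 B2 by auto
      then show ?thesis
        by (auto simp: q_eq split: split_indicator)
    next
      case False
      then show ?thesis
        using ab by (auto simp: q_eq split: split_indicator)
    qed
    then show ?thesis
      by blast
  qed
  then obtain B where B: "\<And>i j z. \<bar>q i j z\<bar> \<le> B i j"
    by metis
  have "\<bar>q i j z\<bar> \<le> (\<Sum>i\<in>UNIV. \<Sum>j\<in>UNIV. \<bar>B i j\<bar>)" for i j z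
  proof -
    have "\<bar>q i j z\<bar> \<le> \<bar>B i j\<bar>"
      using B[of i j z] by simp
    also have "\<dots> \<le> (\<Sum>j\<in>UNIV. \<bar>B i j\<bar>)"
      by (rule member_le_sum) auto
    also have "\<dots> \<le> (\<Sum>i\<in>UNIV. \<Sum>j\<in>UNIV. \<bar>B i j\<bar>)"
      by (rule member_le_sum[where f = "\<lambda>i. \<Sum>j\<in>UNIV. \<bar>B i j\<bar>"]) (auto intro: sum_nonneg)
    finally show ?thesis .
  qed
  then show ?thesis
    by blast
qed

abbreviation Q where "Q \<equiv> Q0 a b Qm Qp"
abbreviation X where "X \<equiv> L2_space a b"

lemma component_mult_op:
  "AE z in lborel. component (mult_op Q x) i z = q i 1 z * component x 1 z + q i 2 z * component x 2 z"
proof -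
  obtain B where B: "\<And>i j z. \<bar>q i j z\<bar> \<le> B"
    using q_bounded by blast
  have eq: "(Q z *v rep_L2R2 x z) $ i = q i 1 z * component x 1 z + q i 2 z * component x 2 z" for i z
    by (simp add: matrix_vector_mult_def sum_2 q_def component_def)
  have "sqi (\<lambda>z. q i 1 z * component x 1 z + q i 2 z * component x 2 z)" for i
    by (rule sqi_add) (rule sqi_bounded_mult[OF component_sqi q_measurable B])+
  then have "sq_integrable (\<lambda>z. Q z *v rep_L2R2 x z)"
    unfolding sq_integrable_iff eq by blast
  from component_abs[OF this, of i] show ?thesis
    unfolding mult_op_def eq .
qed

text \<open>\<open>y = A x\<close>, where \<open>Em\<close>, \<open>Ep\<close> and \<open>E2\<close> are the continuous representatives of the effort
  \<open>e = \<Q>\<^sub>0 x\<close>: of \<open>e\<^sub>1\<close> on \<open>[a,0]\<close>, of \<open>e\<^sub>1\<close> on \<open>[0,b]\<close>, and of \<open>e\<^sub>2\<close> on \<open>[a,b]\<close>.\<close>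
definition graph :: "L2R2 \<Rightarrow> L2R2 \<Rightarrow> (real \<Rightarrow> real) \<Rightarrow> (real \<Rightarrow> real) \<Rightarrow> (real \<Rightarrow> real) \<Rightarrow> bool" where
  "graph x y Em Ep E2 \<longleftrightarrow> x \<in> X \<and> y \<in> X \<and>
     ac_on a 0 Em (\<lambda>z. - component y 2 z) \<and> ac_on 0 b Ep (\<lambda>z. - component y 2 z) \<and>
     ac_on a b E2 (\<lambda>z. - component y 1 z) \<and>
     (AE z in lborel. z \<in> {a<..<0} \<longrightarrow> Em z = q 1 1 z * component x 1 z + q 1 2 z * component x 2 z) \<and>
     (AE z in lborel. z \<in> {0<..<b} \<longrightarrow> Ep z = q 1 1 z * component x 1 z + q 1 2 z * component x 2 z) \<and>
     (AE z in lborel. z \<in> {a<..<b} \<longrightarrow> E2 z = q 2 1 z * component x 1 z + q 2 2 z * component x 2 z) \<and>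
     E2 0 = r * (Em 0 - Ep 0) \<and>
     bd_form W (vector [Em a, E2 a]) (vector [Ep b, E2 b]) = 0"

lemma boundary_values:
  assumes Em: "continuous_on {a..0} Em" "AE z in lborel. z \<in> {a<..<0} \<longrightarrow> Em z = component e 1 z"
    and Ep: "continuous_on {0..b} Ep" "AE z in lborel. z \<in> {0<..<b} \<longrightarrow> Ep z = component e 1 z"
    and E2: "continuous_on {a..b} E2" "AE z in lborel. z \<in> {a<..<b} \<longrightarrow> E2 z = component e 2 z"
  shows "f_I a b e = E2 0" "e_I a b e = Em 0 - Ep 0"
    "W *v stack (f_bd a b e) (e_bd a b e) = bd_form W (vector [Em a, E2 a]) (vector [Ep b, E2 b])"
  using pt_value_eq[OF Em ab(1), of 0] pt_value_eq[OF Em ab(1), of a]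
    pt_value_eq[OF Ep ab(2), of 0] pt_value_eq[OF Ep ab(2), of b]
    pt_value_eq[OF E2, of 0] pt_value_eq[OF E2, of a] pt_value_eq[OF E2, of b] ab
  by (simp_all add: f_I_def e_I_def f_bd_def e_bd_def bd_form_def val_a_def val_b_def)

lemma dom_A_imp_graph:
  assumes x: "x \<in> dom_A a b Qm Qp r W"
  shows "\<exists>Em Ep E2. graph x (op_A a b Qm Qp x) Em Ep E2"
proof -
  define e where "e = mult_op Q x"
  define y where "y = op_A a b Qm Qp x"
  have e: "e \<in> dom_J0 a b" "x \<in> X" "f_I a b e = r * e_I a b e" "W *v stack (f_bd a b e) (e_bd a b e) = 0"
    using x by (simp_all add: dom_A_def e_def Let_def)
  have y: "y = J0 a b e"
    by (simp add: y_def op_A_def e_def)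
  note w = dom_J0_weak[OF e(1)]
  have ab2: "a < b"
    using ab by simp
  obtain Em where Em: "ac_on a 0 Em (weak_deriv a 0 (component e 1))"
    "AE z in lborel. z \<in> {a<..<0} \<longrightarrow> Em z = component e 1 z"
    using has_weak_deriv_imp_ac_on[OF w(1) ab(1)] by blast
  obtain Ep where Ep: "ac_on 0 b Ep (weak_deriv 0 b (component e 1))"
    "AE z in lborel. z \<in> {0<..<b} \<longrightarrow> Ep z = component e 1 z"
    using has_weak_deriv_imp_ac_on[OF w(2) ab(2)] by blast
  obtain E2 where E2: "ac_on a b E2 (weak_deriv a b (component e 2))"
    "AE z in lborel. z \<in> {a<..<b} \<longrightarrow> E2 z = component e 2 z"
    using has_weak_deriv_imp_ac_on[OF w(3) ab2] by blast
  have int: "set_integrable lborel {c..d} (\<lambda>z. - component y i z)" for c d i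
    by (intro sqi_set_integrable sqi_minus component_sqi)
  note y12 = component_J0[OF ab e(1), folded y]
  have ac: "ac_on a 0 Em (\<lambda>z. - component y 2 z)" "ac_on 0 b Ep (\<lambda>z. - component y 2 z)"
    "ac_on a b E2 (\<lambda>z. - component y 1 z)"
  proof -
    have "AE z in lborel. z \<in> {a<..<0} \<longrightarrow> weak_deriv a 0 (component e 1) z = - component y 2 z"
      using y12(2) by eventually_elim auto
    then show "ac_on a 0 Em (\<lambda>z. - component y 2 z)"
      by (rule ac_on_cong_AE[OF Em(1) int])
    have "AE z in lborel. z \<in> {0<..<b} \<longrightarrow> weak_deriv 0 b (component e 1) z = - component y 2 z"
      using y12(2) by eventually_elim auto
    then show "ac_on 0 b Ep (\<lambda>z. - component y 2 z)"
      by (rule ac_on_cong_AE[OF Ep(1) int])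
    \<comment> \<open>\<open>J0\<close> is set to 0 at the point 0, so that point is discarded here;
      \<open>E2\<close> passes through it continuously.\<close>
    have "AE z in lborel. z \<in> {a<..<b} \<longrightarrow> weak_deriv a b (component e 2) z = - component y 1 z"
      using y12(1) AE_lborel_singleton[of 0] by eventually_elim auto
    then show "ac_on a b E2 (\<lambda>z. - component y 1 z)"
      by (rule ac_on_cong_AE[OF E2(1) int])
  qed
  note bv = boundary_values[OF ac_on_continuous[OF Em(1)] Em(2) ac_on_continuous[OF Ep(1)] Ep(2)
      ac_on_continuous[OF E2(1)] E2(2)]
  have "AE z in lborel. z \<in> {a<..<0} \<longrightarrow> Em z = q 1 1 z * component x 1 z + q 1 2 z * component x 2 z"
    using Em(2) component_mult_op[of x 1, folded e_def] by eventually_elim auto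
  moreover have "AE z in lborel. z \<in> {0<..<b} \<longrightarrow> Ep z = q 1 1 z * component x 1 z + q 1 2 z * component x 2 z"
    using Ep(2) component_mult_op[of x 1, folded e_def] by eventually_elim auto
  moreover have "AE z in lborel. z \<in> {a<..<b} \<longrightarrow> E2 z = q 2 1 z * component x 1 z + q 2 2 z * component x 2 z"
    using E2(2) component_mult_op[of x 2, folded e_def] by eventually_elim auto
  moreover have "y \<in> X"
    unfolding y by (rule J0_in_L2_space[OF ab e(1)])
  ultimately have "graph x y Em Ep E2"
    unfolding graph_def using ac e bv by simp
  then show ?thesis
    unfolding y_def by blast
qed

text \<open>Together with the converse \<open>dom_A_imp_graph\<close>, this removes the choices
  behind \<open>weak_deriv\<close> and \<open>pt_value\<close>: membership in the domain and the
  value of the operator are certified by continuous representatives.\<close>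

lemma graph_imp_dom_A:
  assumes g: "graph x y Em Ep E2"
  shows "x \<in> dom_A a b Qm Qp r W \<and> op_A a b Qm Qp x = y"
proof -
  define e where "e = mult_op Q x"
  have ac: "ac_on a 0 Em (\<lambda>z. - component y 2 z)" "ac_on 0 b Ep (\<lambda>z. - component y 2 z)"
    "ac_on a b E2 (\<lambda>z. - component y 1 z)" and xy: "x \<in> X" "y \<in> X"
    and bc: "E2 0 = r * (Em 0 - Ep 0)" "bd_form W (vector [Em a, E2 a]) (vector [Ep b, E2 b]) = 0"
    and E: "AE z in lborel. z \<in> {a<..<0} \<longrightarrow> Em z = q 1 1 z * component x 1 z + q 1 2 z * component x 2 z"
    "AE z in lborel. z \<in> {0<..<b} \<longrightarrow> Ep z = q 1 1 z * component x 1 z + q 1 2 z * component x 2 z"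
    "AE z in lborel. z \<in> {a<..<b} \<longrightarrow> E2 z = q 2 1 z * component x 1 z + q 2 2 z * component x 2 z"
    using g unfolding graph_def by blast+
  have Em: "AE z in lborel. z \<in> {a<..<0} \<longrightarrow> Em z = component e 1 z"
    using E(1) component_mult_op[of x 1, folded e_def] by eventually_elim auto
  have Ep: "AE z in lborel. z \<in> {0<..<b} \<longrightarrow> Ep z = component e 1 z"
    using E(2) component_mult_op[of x 1, folded e_def] by eventually_elim auto
  have E2: "AE z in lborel. z \<in> {a<..<b} \<longrightarrow> E2 z = component e 2 z"
    using E(3) component_mult_op[of x 2, folded e_def] by eventually_elim auto
  have sq: "sq_integrable_on c d (component e i)" "sq_integrable_on c d (\<lambda>z. - component y i z)" for c d i
    by (intro sqi_imp_sq_integrable_on sqi_minus component_sqi)+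
  have ab2: "a < b"
    using ab by simp
  have w: "has_weak_deriv a 0 (component e 1) (\<lambda>z. - component y 2 z)"
    "has_weak_deriv 0 b (component e 1) (\<lambda>z. - component y 2 z)"
    "has_weak_deriv a b (component e 2) (\<lambda>z. - component y 1 z)"
    using ac_on_has_weak_deriv[OF ac(1) sq Em] ac_on_has_weak_deriv[OF ac(2) sq Ep]
      ac_on_has_weak_deriv[OF ac(3) sq E2] ab by auto
  have "e \<in> X"
    unfolding L2_space_iff
    using xy(1)[unfolded L2_space_iff] component_mult_op[of x 1, folded e_def] component_mult_op[of x 2, folded e_def]
    by eventually_elim auto
  then have e: "e \<in> dom_J0 a b"
    unfolding dom_J0_def H1_def using w by blast
  note bv = boundary_values[OF ac_on_continuous[OF ac(1)] Em ac_on_continuous[OF ac(2)] Ep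
      ac_on_continuous[OF ac(3)] E2]
  have dom: "x \<in> dom_A a b Qm Qp r W"
    using e xy(1) bc bv by (simp add: dom_A_def Let_def flip: e_def)
  have uniq: "AE z in lborel. z \<in> {a<..<0} \<longrightarrow> weak_deriv a 0 (component e 1) z = - component y 2 z"
    "AE z in lborel. z \<in> {0<..<b} \<longrightarrow> weak_deriv 0 b (component e 1) z = - component y 2 z"
    "AE z in lborel. z \<in> {a<..<b} \<longrightarrow> weak_deriv a b (component e 2) z = - component y 1 z"
    using has_weak_deriv_unique[OF dom_J0_weak(1)[OF e] w(1) ab(1)]
      has_weak_deriv_unique[OF dom_J0_weak(2)[OF e] w(2) ab(2)]
      has_weak_deriv_unique[OF dom_J0_weak(3)[OF e] w(3) ab2] by auto
  have sing: "AE z in lborel. z \<noteq> a \<and> z \<noteq> 0 \<and> z \<noteq> b"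
    by (intro AE_conjI AE_lborel_singleton)
  have "J0 a b e = y"
  proof (rule L2R2_eqI_component)
    show "AE z in lborel. component (J0 a b e) 1 z = component y 1 z"
      using component_J0(1)[OF ab e] uniq(3) sing xy(2)[unfolded L2_space_iff]
      by eventually_elim (use ab in auto)
    show "AE z in lborel. component (J0 a b e) 2 z = component y 2 z"
      using component_J0(2)[OF ab e] uniq(1,2) sing xy(2)[unfolded L2_space_iff]
      by eventually_elim (use ab in auto)
  qed
  then show ?thesis
    using dom by (simp add: op_A_def e_def)
qed

end

section \<open>Weighted forms as Hilbert norms on the state space\<close>

lemma wip_bounds:
  assumes bw: "bounded_weight p q s B" and x: "x \<in> L2_space a b"
    and lo: "AE z in lborel. z \<in> {a..b} \<longrightarrow> (\<forall>u v. lo * (u\<^sup>2 + v\<^sup>2) \<le> p z * u\<^sup>2 + 2 * q z * u * v + s z * v\<^sup>2)"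
    and hi: "AE z in lborel. z \<in> {a..b} \<longrightarrow> (\<forall>u v. p z * u\<^sup>2 + 2 * q z * u * v + s z * v\<^sup>2 \<le> hi * (u\<^sup>2 + v\<^sup>2))"
  shows "lo * sqn x \<le> wip p q s x x" "wip p q s x x \<le> hi * sqn x"
proof -
  let ?i = "\<lambda>z. p z * (component x 1 z * component x 1 z)
     + q z * (component x 1 z * component x 2 z + component x 2 z * component x 1 z)
     + s z * (component x 2 z * component x 2 z)"
  let ?n = "\<lambda>z. (component x 1 z)\<^sup>2 + (component x 2 z)\<^sup>2"
  have int: "integrable lborel ?i" "integrable lborel ?n"
    by (rule bounded_weight.wip_integrable[OF bw])
      (intro Bochner_Integration.integrable_add component_sq_integrable)
  have ae: "AE z in lborel. lo * ?n z \<le> ?i z \<and> ?i z \<le> hi * ?n z"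
    using lo hi x[unfolded L2_space_iff]
  proof eventually_elim
    case (elim z)
    show ?case
    proof (cases "z \<in> {a..b}")
      case True
      have eq: "?i z = p z * (component x 1 z)\<^sup>2 + 2 * q z * component x 1 z * component x 2 z + s z * (component x 2 z)\<^sup>2"
        by (simp add: power2_eq_square algebra_simps)
      show ?thesis
        unfolding eq using elim True by blast
    next
      case False
      then show ?thesis
        using elim by simp
    qed
  qed
  have "(LINT z|lborel. lo * ?n z) \<le> (LINT z|lborel. ?i z)"
    by (rule integral_mono_AE[OF integrable_mult_right[OF int(2)] int(1)]) (use ae in eventually_elim, blast)
  moreover have "(LINT z|lborel. ?i z) \<le> (LINT z|lborel. hi * ?n z)"
    by (rule integral_mono_AE[OF int(1) integrable_mult_right[OF int(2)]]) (use ae in eventually_elim, blast)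
  ultimately show "lo * sqn x \<le> wip p q s x x" "wip p q s x x \<le> hi * sqn x"
    by (simp_all only: wip_def sqn_def integral_mult_right_zero)
qed

text \<open>Equivalence with the plain L^2 norm transfers definiteness and completeness to the
  weighted form.\<close>

lemma hilbert_subspace_wip:
  assumes bw: "bounded_weight p q s B" and lo: "0 < lo"
    and nonneg: "\<And>x. 0 \<le> wip p q s x x"
    and bounds: "\<And>x. x \<in> L2_space a b \<Longrightarrow> lo * sqn x \<le> wip p q s x x"
      "\<And>x. x \<in> L2_space a b \<Longrightarrow> wip p q s x x \<le> hi * sqn x"
  shows "hilbert_subspace (wip p q s) (L2_space a b)"
proof
  note X = subspace_L2_space[of a b]
  show "wip p q s x y = wip p q s y x" "wip p q s (x + y) z = wip p q s x z + wip p q s y z"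
    "wip p q s (c *\<^sub>R x) y = c * wip p q s x y" "0 \<le> wip p q s x x" for x y z c
    using bounded_weight.wip_commute[OF bw] bounded_weight.wip_add_left[OF bw]
      bounded_weight.wip_scale_left[OF bw] nonneg by blast+
  show "subspace (L2_space a b)"
    by (rule X)
  show "x = 0" if "x \<in> L2_space a b" "wip p q s x x = 0" for x
  proof -
    have "lo * sqn x \<le> 0"
      using bounds(1)[OF that(1)] that(2) by simp
    then have "sqn x = 0"
      using lo sqn_nonneg[of x] by (simp add: mult_le_0_iff)
    then show ?thesis
      by (rule sqn_zeroD)
  qed
  fix f :: "nat \<Rightarrow> L2R2"
  assume f: "\<And>n. f n \<in> L2_space a b"
    and cau: "\<And>e. 0 < e \<Longrightarrow> \<exists>K. \<forall>m\<ge>K. \<forall>n\<ge>K. wip p q s (f m - f n) (f m - f n) < e"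
  have "\<exists>l\<in>L2_space a b. (\<lambda>n. sqn (f n - l)) \<longlonglongrightarrow> 0"
  proof (rule L2_space_complete[OF f])
    fix e :: real assume "0 < e"
    then obtain K where K: "\<forall>m\<ge>K. \<forall>n\<ge>K. wip p q s (f m - f n) (f m - f n) < lo * e"
      using cau[of "lo * e"] lo by auto
    have "sqn (f m - f n) < e" if "K \<le> m" "K \<le> n" for m n
    proof -
      have "lo * sqn (f m - f n) < lo * e"
        using bounds(1)[OF subspace_diff[OF X f f, of m n]] K that by fastforce
      then show ?thesis
        using lo by simp
    qed
    then show "\<exists>K. \<forall>m\<ge>K. \<forall>n\<ge>K. sqn (f m - f n) < e"
      by blast
  qed
  then obtain l where l: "l \<in> L2_space a b" "(\<lambda>n. sqn (f n - l)) \<longlonglongrightarrow> 0"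
    by blast
  have "(\<lambda>n. hi * sqn (f n - l)) \<longlonglongrightarrow> 0"
    using l(2) by (rule tendsto_mult_right_zero)
  then have "(\<lambda>n. wip p q s (f n - l) (f n - l)) \<longlonglongrightarrow> 0"
    by (rule tendsto_sandwich[OF _ _ tendsto_const, rotated 2])
      (auto simp: nonneg intro!: always_eventually bounds(2) subspace_diff[OF X f l(1)])
  then show "\<exists>l\<in>L2_space a b. (\<lambda>n. wip p q s (f n - l) (f n - l)) \<longlonglongrightarrow> 0"
    using l(1) by blast
qed

lemma vector_2_add: "vector [x + x', y + y'] = vector [x, y] + (vector [x', y'] :: real^2)"
  by (simp add: vec_eq_iff forall_2)

lemma vector_2_scale: "vector [c * x, c * y] = c *\<^sub>R (vector [x, y] :: real^2)"
  by (simp add: vec_eq_iff forall_2)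

section \<open>Linearity of the operator\<close>

context port_hamiltonian
begin

lemma component_set_integrable: "set_integrable lborel {c..d} (\<lambda>z. - component y i z)"
  by (intro sqi_set_integrable sqi_minus component_sqi)

lemma graph_add:
  assumes g: "graph x y Em Ep E2" and h: "graph x' y' Em' Ep' E2'"
  shows "graph (x + x') (y + y') (\<lambda>z. Em z + Em' z) (\<lambda>z. Ep z + Ep' z) (\<lambda>z. E2 z + E2' z)"
proof -
  have ac: "ac_on c d (\<lambda>z. F z + F' z) (\<lambda>z. - component (y + y') i z)"
    if "ac_on c d F (\<lambda>z. - component y i z)" "ac_on c d F' (\<lambda>z. - component y' i z)" for c d F F' i
  proof (rule ac_on_cong_AE[OF ac_on_add[OF that] component_set_integrable])
    show "AE z in lborel. z \<in> {c<..<d} \<longrightarrow> - component y i z + - component y' i z = - component (y + y') i z"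
      using component_add[of y y' i] by eventually_elim simp
  qed
  have ae: "AE z in lborel. z \<in> I \<longrightarrow> F z + F' z = q i 1 z * component (x + x') 1 z + q i 2 z * component (x + x') 2 z"
    if "AE z in lborel. z \<in> I \<longrightarrow> F z = q i 1 z * component x 1 z + q i 2 z * component x 2 z"
      "AE z in lborel. z \<in> I \<longrightarrow> F' z = q i 1 z * component x' 1 z + q i 2 z * component x' 2 z" for I F F' i
    using that component_add[of x x' 1] component_add[of x x' 2] by eventually_elim (simp add: algebra_simps)
  note gg = g[unfolded graph_def] and hh = h[unfolded graph_def]
  have "x + x' \<in> X" "y + y' \<in> X"
    using gg hh subspace_add[OF subspace_L2_space] by blast+
  moreover have "E2 0 + E2' 0 = r * (Em 0 + Em' 0 - (Ep 0 + Ep' 0))"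
  proof -
    have "E2 0 = r * (Em 0 - Ep 0)" "E2' 0 = r * (Em' 0 - Ep' 0)"
      using gg hh by blast+
    then show ?thesis
      by (simp add: algebra_simps)
  qed
  moreover have "bd_form W (vector [Em a + Em' a, E2 a + E2' a]) (vector [Ep b + Ep' b, E2 b + E2' b]) = 0"
    using gg hh by (simp add: vector_2_add bd_form_add)
  ultimately show ?thesis
    unfolding graph_def using gg hh by (intro conjI ac ae) blast+
qed

lemma graph_scale:
  assumes g: "graph x y Em Ep E2"
  shows "graph (k *\<^sub>R x) (k *\<^sub>R y) (\<lambda>z. k * Em z) (\<lambda>z. k * Ep z) (\<lambda>z. k * E2 z)"
proof -
  have ac: "ac_on c d (\<lambda>z. k * F z) (\<lambda>z. - component (k *\<^sub>R y) i z)"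
    if "ac_on c d F (\<lambda>z. - component y i z)" for c d F i
  proof (rule ac_on_cong_AE[OF ac_on_cmult[OF that] component_set_integrable])
    show "AE z in lborel. z \<in> {c<..<d} \<longrightarrow> k * - component y i z = - component (k *\<^sub>R y) i z"
      using component_scale[of k y i] by eventually_elim simp
  qed
  have ae: "AE z in lborel. z \<in> I \<longrightarrow> k * F z = q i 1 z * component (k *\<^sub>R x) 1 z + q i 2 z * component (k *\<^sub>R x) 2 z"
    if "AE z in lborel. z \<in> I \<longrightarrow> F z = q i 1 z * component x 1 z + q i 2 z * component x 2 z" for I F i
    using that component_scale[of k x 1] component_scale[of k x 2] by eventually_elim (simp add: algebra_simps)
  note gg = g[unfolded graph_def]
  have "k *\<^sub>R x \<in> X" "k *\<^sub>R y \<in> X"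
    using gg subspace_scale[OF subspace_L2_space] by blast+
  moreover have "k * E2 0 = r * (k * Em 0 - k * Ep 0)"
  proof -
    have "E2 0 = r * (Em 0 - Ep 0)"
      using gg by blast
    then show ?thesis
      by algebra
  qed
  moreover have "bd_form W (vector [k * Em a, k * E2 a]) (vector [k * Ep b, k * E2 b]) = 0"
    using gg by (simp add: vector_2_scale bd_form_scale)
  ultimately show ?thesis
    unfolding graph_def using gg by (intro conjI ac ae) blast+
qed

abbreviation D where "D \<equiv> dom_A a b Qm Qp r W"
abbreviation A where "A \<equiv> op_A a b Qm Qp"

lemma graphE:
  assumes "x \<in> D"
  obtains Em Ep E2 where "graph x (A x) Em Ep E2"
  using dom_A_imp_graph[OF assms] by blast

lemma graph_zero: "graph 0 0 (\<lambda>_. 0) (\<lambda>_. 0) (\<lambda>_. 0)"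
proof -
  have ac: "ac_on c d (\<lambda>_. 0) (\<lambda>z. - component 0 i z)" for c d i
  proof (rule ac_on_cong_AE[OF _ component_set_integrable])
    show "ac_on c d (\<lambda>_. 0) (\<lambda>_. 0)"
      by (simp add: ac_on_def set_integrable_def)
    show "AE z in lborel. z \<in> {c<..<d} \<longrightarrow> 0 = - component 0 i z"
      using component_zero[of i] by eventually_elim simp
  qed
  have ae: "AE z in lborel. z \<in> I \<longrightarrow> 0 = q i 1 z * component 0 1 z + q i 2 z * component 0 2 z" for I i
    using component_zero[of 1] component_zero[of 2] by eventually_elim simp
  have "bd_form W (vector [0, 0]) (vector [0, 0]) = 0"
    using bd_form_scale[of W 0 0 0] vector_2_scale[of 0 0 0] by simp
  then show ?thesis
    unfolding graph_def
    by (intro conjI ac ae subspace_0[OF subspace_L2_space]) simp_all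
qed

lemma A_linear:
  "subspace D"
  "x \<in> D \<Longrightarrow> y \<in> D \<Longrightarrow> A (x + y) = A x + A y"
  "x \<in> D \<Longrightarrow> A (c *\<^sub>R x) = c *\<^sub>R A x"
  "D \<subseteq> X" "x \<in> D \<Longrightarrow> A x \<in> X"
proof -
  have add: "x + y \<in> D \<and> A (x + y) = A x + A y" if xy: "x \<in> D" "y \<in> D" for x y
  proof -
    obtain Em Ep E2 where g: "graph x (A x) Em Ep E2"
      using graphE[OF xy(1)] .
    obtain Em' Ep' E2' where h: "graph y (A y) Em' Ep' E2'"
      using graphE[OF xy(2)] .
    show ?thesis
      using graph_imp_dom_A[OF graph_add[OF g h]] .
  qed
  have scale: "c *\<^sub>R x \<in> D \<and> A (c *\<^sub>R x) = c *\<^sub>R A x" if x: "x \<in> D" for x c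
  proof -
    obtain Em Ep E2 where g: "graph x (A x) Em Ep E2"
      using graphE[OF x] .
    show ?thesis
      using graph_imp_dom_A[OF graph_scale[OF g]] .
  qed
  have "0 \<in> D"
    using graph_imp_dom_A[OF graph_zero] by blast
  then show "subspace D"
    using add scale by (intro subspaceI) blast+
  show "x \<in> D \<Longrightarrow> y \<in> D \<Longrightarrow> A (x + y) = A x + A y" "x \<in> D \<Longrightarrow> A (c *\<^sub>R x) = c *\<^sub>R A x"
    using add scale by blast+
  have "x \<in> X \<and> A x \<in> X" if "x \<in> D" for x
    using graphE[OF that] unfolding graph_def by blast
  then show "D \<subseteq> X" "x \<in> D \<Longrightarrow> A x \<in> X"
    by blast+
qed

subsection \<open>The Lyapunov functional\<close>

lemma L_nonneg: "0 \<le> L"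
  using deriv_bound(1)[of a 1 1] ab by (meson abs_ge_zero atLeastAtMost_iff less_imp_le order_refl order_trans)

text \<open>The exponent \<open>k\<close> of the multiplier, just large enough for the growth of the
  weight to beat the derivatives of the coefficients.\<close>

definition rate :: real where "rate = (2 * L + 1) / m"

lemma rate: "2 * L + 1 \<le> rate * m" "0 \<le> rate"
  using m L_nonneg by (simp_all add: rate_def)

definition wt :: "real \<Rightarrow> real" where
  "wt z = (if z < 0 then - exp (- rate * z) else exp (rate * z))"

definition wt_max :: real where "wt_max = max (exp (- rate * a)) (exp (rate * b))"

lemma wt_bounded: "z \<in> {a..b} \<Longrightarrow> \<bar>wt z\<bar> \<le> wt_max"
  using rate(2) mult_left_mono[of a z rate] mult_left_mono[of z b rate]
  by (auto simp: wt_def wt_max_def le_max_iff_disj)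

lemma wt_max_pos: "0 < wt_max"
  by (simp add: wt_max_def less_max_iff_disj)

text \<open>\<open>((lp, lq \<epsilon>), (lq \<epsilon>, ls))\<close> is the matrix \<open>\<Q>\<^sub>0 / 2 + \<epsilon> w P\<^sub>1\<close>; \<open>\<epsilon> = 0\<close> gives the energy.\<close>
definition lp :: "real \<Rightarrow> real" where "lp z = q 1 1 z / 2"
definition lq :: "real \<Rightarrow> real \<Rightarrow> real" where
  "lq \<epsilon> z = q 1 2 z / 2 - \<epsilon> * (indicator {a..b} z * wt z)"
definition ls :: "real \<Rightarrow> real" where "ls z = q 2 2 z / 2"

lemma bounded_weight: "\<exists>B. bounded_weight lp (lq \<epsilon>) ls B"
proof -
  obtain B where B: "\<And>i j z. \<bar>q i j z\<bar> \<le> B"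
    using q_bounded by blast
  have 1: "\<bar>q i j z / 2\<bar> \<le> B" for i j z
    using B[of i j z] abs_ge_zero[of "q i j z"] by linarith
  have 2: "\<bar>\<epsilon> * (indicator {a..b} z * wt z)\<bar> \<le> \<bar>\<epsilon>\<bar> * wt_max" for z
    using wt_bounded[of z] wt_max_pos by (auto simp: abs_mult intro!: mult_left_mono split: split_indicator)
  have [measurable]: "wt \<in> borel_measurable borel"
    unfolding wt_def[abs_def] by measurable
  have "bounded_weight lp (lq \<epsilon>) ls (B + \<bar>\<epsilon>\<bar> * wt_max)"
  proof
    show "lp \<in> borel_measurable borel" "lq \<epsilon> \<in> borel_measurable borel" "ls \<in> borel_measurable borel"
      unfolding lp_def[abs_def] lq_def[abs_def] ls_def[abs_def] by measurable
    have "0 \<le> \<bar>\<epsilon>\<bar> * wt_max"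
      using wt_max_pos by simp
    then show "\<bar>lp z\<bar> \<le> B + \<bar>\<epsilon>\<bar> * wt_max" "\<bar>ls z\<bar> \<le> B + \<bar>\<epsilon>\<bar> * wt_max" for z
      using 1[of 1 1 z] 1[of 2 2 z] by (auto simp: lp_def ls_def)
    show "\<bar>lq \<epsilon> z\<bar> \<le> B + \<bar>\<epsilon>\<bar> * wt_max" for z
      using 1[of 1 2 z] 2[of z] unfolding lq_def by linarith
  qed
  then show ?thesis
    by blast
qed

text \<open>The points to discard: at 0 the coefficient \<open>Q0\<close> vanishes and is not
  coercive, and at \<open>a\<close> and \<open>b\<close> open and closed intervals differ.\<close>

lemma AE_nonzero: "AE z in lborel. z \<noteq> a \<and> z \<noteq> (0::real) \<and> z \<noteq> b"
  by (intro AE_conjI AE_lborel_singleton)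

lemma q_minus: "z \<in> {a..<0} \<Longrightarrow> q i j z = Qm z $ i $ j"
  using ab by (simp add: q_eq)

lemma q_plus: "z \<in> {0<..b} \<Longrightarrow> q i j z = Qp z $ i $ j"
  by (simp add: q_eq)

lemma q_sym: "q 2 1 z = q 1 2 z"
  using sym ab by (auto simp: q_eq split: split_indicator)

lemma q_bounds:
  assumes "z \<in> {a..b}" "z \<noteq> 0"
  shows "m * (x\<^sup>2 + y\<^sup>2) \<le> q 1 1 z * x\<^sup>2 + 2 * q 1 2 z * x * y + q 2 2 z * y\<^sup>2"
    "q 1 1 z * x\<^sup>2 + 2 * q 1 2 z * x * y + q 2 2 z * y\<^sup>2 \<le> M * (x\<^sup>2 + y\<^sup>2)"
proof -
  have "m * (x\<^sup>2 + y\<^sup>2) \<le> q 1 1 z * x\<^sup>2 + 2 * q 1 2 z * x * y + q 2 2 z * y\<^sup>2 \<and>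
    q 1 1 z * x\<^sup>2 + 2 * q 1 2 z * x * y + q 2 2 z * y\<^sup>2 \<le> M * (x\<^sup>2 + y\<^sup>2)"
  proof (cases "z < 0")
    case True
    then have z: "z \<in> {a..<0}"
      using assms by simp
    show ?thesis
      unfolding q_minus[OF z] using lower(1)[OF assms(1)] upper(1)[OF assms(1)] by blast
  next
    case False
    then have z: "z \<in> {0<..b}"
      using assms by simp
    show ?thesis
      unfolding q_plus[OF z] using lower(2)[OF assms(1)] upper(2)[OF assms(1)] by blast
  qed
  then show "m * (x\<^sup>2 + y\<^sup>2) \<le> q 1 1 z * x\<^sup>2 + 2 * q 1 2 z * x * y + q 2 2 z * y\<^sup>2"
    "q 1 1 z * x\<^sup>2 + 2 * q 1 2 z * x * y + q 2 2 z * y\<^sup>2 \<le> M * (x\<^sup>2 + y\<^sup>2)"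
    by blast+
qed

text \<open>The energy part Q0 / 2 is at least m / 2, and the cross term perturbs it by at most m /
  4 because 2 |u v| \<le> u^2 + v^2. The case \<epsilon> = 0 is applied to the energy norm
  itself.\<close>

lemma lyapunov_bounds:
  assumes \<epsilon>: "0 \<le> \<epsilon>" "\<epsilon> * wt_max \<le> m / 4" and x: "x \<in> X"
  shows "m / 4 * sqn x \<le> wip lp (lq \<epsilon>) ls x x" "wip lp (lq \<epsilon>) ls x x \<le> (M / 2 + m / 4) * sqn x"
proof -
  obtain B where bw: "bounded_weight lp (lq \<epsilon>) ls B"
    using bounded_weight by blast
  have *: "m / 4 * (u\<^sup>2 + v\<^sup>2) \<le> lp z * u\<^sup>2 + 2 * lq \<epsilon> z * u * v + ls z * v\<^sup>2 \<and>
     lp z * u\<^sup>2 + 2 * lq \<epsilon> z * u * v + ls z * v\<^sup>2 \<le> (M / 2 + m / 4) * (u\<^sup>2 + v\<^sup>2)"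
    if z: "z \<in> {a..b}" "z \<noteq> 0" for z u v
  proof -
    have "\<bar>2 * (\<epsilon> * wt z) * u * v\<bar> = \<epsilon> * \<bar>wt z\<bar> * (2 * \<bar>u\<bar> * \<bar>v\<bar>)"
      using \<epsilon>(1) by (simp add: abs_mult)
    also have "\<dots> \<le> m / 4 * (u\<^sup>2 + v\<^sup>2)"
    proof (rule mult_mono)
      show "\<epsilon> * \<bar>wt z\<bar> \<le> m / 4"
        using mult_left_mono[OF wt_bounded[OF z(1)] \<epsilon>(1)] \<epsilon>(2) by simp
      show "2 * \<bar>u\<bar> * \<bar>v\<bar> \<le> u\<^sup>2 + v\<^sup>2"
        using sum_squares_bound[of "\<bar>u\<bar>" "\<bar>v\<bar>"] by simp
    qed (use m in auto)
    finally have 1: "\<bar>2 * (\<epsilon> * wt z) * u * v\<bar> \<le> m / 4 * (u\<^sup>2 + v\<^sup>2)" .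
    have 2: "lp z * u\<^sup>2 + 2 * lq \<epsilon> z * u * v + ls z * v\<^sup>2 =
        (q 1 1 z * u\<^sup>2 + 2 * q 1 2 z * u * v + q 2 2 z * v\<^sup>2) / 2 - 2 * (\<epsilon> * wt z) * u * v"
      using z by (simp add: lp_def lq_def ls_def field_simps)
    have lin: "m / 4 * n \<le> t / 2 - d \<and> t / 2 - d \<le> (M / 2 + m / 4) * n"
      if "m * n \<le> t" "t \<le> M * n" "\<bar>d\<bar> \<le> m / 4 * n" for n t d :: real
    proof -
      have "m / 4 * n = (m * n) / 4" "(M / 2 + m / 4) * n = (M * n) / 2 + (m * n) / 4"
        by (simp_all add: algebra_simps)
      then show ?thesis
        using that by linarith
    qed
    show ?thesis
      unfolding 2 by (rule lin[OF q_bounds[OF z] 1])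
  qed
  have lo: "AE z in lborel. z \<in> {a..b} \<longrightarrow> (\<forall>u v. m / 4 * (u\<^sup>2 + v\<^sup>2) \<le> lp z * u\<^sup>2 + 2 * lq \<epsilon> z * u * v + ls z * v\<^sup>2)"
    using AE_nonzero by eventually_elim (use * in blast)
  have hi: "AE z in lborel. z \<in> {a..b} \<longrightarrow> (\<forall>u v. lp z * u\<^sup>2 + 2 * lq \<epsilon> z * u * v + ls z * v\<^sup>2 \<le> (M / 2 + m / 4) * (u\<^sup>2 + v\<^sup>2))"
    using AE_nonzero by eventually_elim (use * in blast)
  show "m / 4 * sqn x \<le> wip lp (lq \<epsilon>) ls x x" "wip lp (lq \<epsilon>) ls x x \<le> (M / 2 + m / 4) * sqn x"
    using wip_bounds[OF bw x lo hi] by blast+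
qed

lemma lyapunov_nonneg:
  assumes \<epsilon>: "0 \<le> \<epsilon>" "\<epsilon> * wt_max \<le> m / 4"
  shows "0 \<le> wip lp (lq \<epsilon>) ls x x"
proof -
  text \<open>The weights vanish outside \<open>[a,b]\<close>, so \<open>x\<close> can be replaced by its restriction.\<close>
  define x' where "x' = abs_L2R2 (\<lambda>z. vector [indicator {a..b} z * component x 1 z, indicator {a..b} z * component x 2 z])"
  have sq: "sqi (\<lambda>z. indicator {a..b} z * component x i z)" for i
    by (intro sqi_indicator component_sqi) auto
  have c: "AE z in lborel. component x' 1 z = indicator {a..b} z * component x 1 z"
    "AE z in lborel. component x' 2 z = indicator {a..b} z * component x 2 z"
    using component_abs[OF sq_integrable_vector[OF sq sq], of 1 2 1]
      component_abs[OF sq_integrable_vector[OF sq sq], of 1 2 2] by (simp_all add: x'_def)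
  have x': "x' \<in> X"
    unfolding L2_space_iff using c by eventually_elim simp
  obtain B where "bounded_weight lp (lq \<epsilon>) ls B"
    using bounded_weight by blast
  then interpret bw: bounded_weight lp "lq \<epsilon>" ls B .
  have "wip lp (lq \<epsilon>) ls x x = wip lp (lq \<epsilon>) ls x' x'"
    unfolding wip_def
  proof (rule integral_cong_AE)
    show "AE z in lborel. lp z * (component x 1 z * component x 1 z)
       + lq \<epsilon> z * (component x 1 z * component x 2 z + component x 2 z * component x 1 z)
       + ls z * (component x 2 z * component x 2 z) = lp z * (component x' 1 z * component x' 1 z)
       + lq \<epsilon> z * (component x' 1 z * component x' 2 z + component x' 2 z * component x' 1 z)
       + ls z * (component x' 2 z * component x' 2 z)"
      using c
    proof eventually_elim
      case (elim z)
      then show ?case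
        using ab by (cases "z \<in> {a..b}") (auto simp: lp_def lq_def ls_def q_eq)
    qed
  qed measurable
  moreover have "0 \<le> m / 4 * sqn x'"
    using m sqn_nonneg[of x'] by simp
  ultimately show ?thesis
    using lyapunov_bounds(1)[OF \<epsilon> x'] by simp
qed

text \<open>On each side of the interface, state and effort determine each other through x = S e and
  e = Q0 x.\<close>

lemma graph_state:
  assumes g: "graph x y Em Ep E2"
  shows "AE z in lborel. z \<in> {a..0} \<longrightarrow> component x 1 z = minus.s1 z * Em z + minus.s2 z * E2 z
      \<and> component x 2 z = minus.s2 z * Em z + minus.s3 z * E2 z" (is ?A)
    and "AE z in lborel. z \<in> {0..b} \<longrightarrow> component x 1 z = plus.s1 z * Ep z + plus.s2 z * E2 z
      \<and> component x 2 z = plus.s2 z * Ep z + plus.s3 z * E2 z" (is ?B)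
    and "AE z in lborel. z \<in> {a..0} \<longrightarrow> Em z = q 1 1 z * component x 1 z + q 1 2 z * component x 2 z
      \<and> E2 z = q 1 2 z * component x 1 z + q 2 2 z * component x 2 z" (is ?C)
    and "AE z in lborel. z \<in> {0..b} \<longrightarrow> Ep z = q 1 1 z * component x 1 z + q 1 2 z * component x 2 z
      \<and> E2 z = q 1 2 z * component x 1 z + q 2 2 z * component x 2 z" (is ?D)
proof -
  have E: "AE z in lborel. z \<in> {a<..<0} \<longrightarrow> Em z = q 1 1 z * component x 1 z + q 1 2 z * component x 2 z"
    "AE z in lborel. z \<in> {0<..<b} \<longrightarrow> Ep z = q 1 1 z * component x 1 z + q 1 2 z * component x 2 z"
    "AE z in lborel. z \<in> {a<..<b} \<longrightarrow> E2 z = q 2 1 z * component x 1 z + q 2 2 z * component x 2 z"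
    using g unfolding graph_def by blast+
  show C: ?C
    using E(1,3) AE_nonzero by eventually_elim (use ab in \<open>auto simp: q_sym\<close>)
  show D: ?D
    using E(2,3) AE_nonzero by eventually_elim (use ab in \<open>auto simp: q_sym\<close>)
  show ?A
    using C AE_nonzero
  proof eventually_elim
    case (elim z)
    show ?case
    proof
      assume z: "z \<in> {a..0}"
      then have z': "z \<in> {a..<0}"
        using elim by auto
      have "Em z = Qm z $ 1 $ 1 * component x 1 z + Qm z $ 1 $ 2 * component x 2 z"
        "E2 z = Qm z $ 1 $ 2 * component x 1 z + Qm z $ 2 $ 2 * component x 2 z"
        using elim z unfolding q_minus[OF z'] by blast+
      from minus.S_Q[OF z this] show "component x 1 z = minus.s1 z * Em z + minus.s2 z * E2 z
        \<and> component x 2 z = minus.s2 z * Em z + minus.s3 z * E2 z"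
        by blast
    qed
  qed
  show ?B
    using D AE_nonzero
  proof eventually_elim
    case (elim z)
    show ?case
    proof
      assume z: "z \<in> {0..b}"
      then have z': "z \<in> {0<..b}"
        using elim by auto
      have "Ep z = Qp z $ 1 $ 1 * component x 1 z + Qp z $ 1 $ 2 * component x 2 z"
        "E2 z = Qp z $ 1 $ 2 * component x 1 z + Qp z $ 2 $ 2 * component x 2 z"
        using elim z unfolding q_plus[OF z'] by blast+
      from plus.S_Q[OF z this] show "component x 1 z = plus.s1 z * Ep z + plus.s2 z * E2 z
        \<and> component x 2 z = plus.s2 z * Ep z + plus.s3 z * E2 z"
        by blast
    qed
  qed
qed

lemma integral_split:
  assumes m: "f \<in> borel_measurable borel"
    and g: "set_integrable lborel {a..0} g" and h: "set_integrable lborel {0..b} h"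
    and f: "AE z in lborel. (z \<in> {a..0} \<longrightarrow> f z = g z) \<and> (z \<in> {0..b} \<longrightarrow> f z = h z)
      \<and> (z \<notin> {a..b} \<longrightarrow> f z = (0::real))"
  shows "(LINT z|lborel. f z) = (LINT z:{a..0}|lborel. g z) + (LINT z:{0..b}|lborel. h z)"
proof -
  note int = g[unfolded set_integrable_def] h[unfolded set_integrable_def]
  have "(LINT z|lborel. f z) = (LINT z|lborel. indicator {a..0} z *\<^sub>R g z + indicator {0..b} z *\<^sub>R h z)"
  proof (rule integral_cong_AE)
    show "AE z in lborel. f z = indicator {a..0} z *\<^sub>R g z + indicator {0..b} z *\<^sub>R h z"
      using f AE_nonzero by eventually_elim (use ab in \<open>auto split: split_indicator\<close>)
    show "(\<lambda>z. indicator {a..0} z *\<^sub>R g z + indicator {0..b} z *\<^sub>R h z) \<in> borel_measurable lborel"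
      using borel_measurable_integrable[OF int(1)] borel_measurable_integrable[OF int(2)]
      by (rule borel_measurable_add)
  qed (use m in simp)
  also have "\<dots> = (LINT z:{a..0}|lborel. g z) + (LINT z:{0..b}|lborel. h z)"
    unfolding set_lebesgue_integral_def by (rule Bochner_Integration.integral_add[OF int])
  finally show ?thesis .
qed

text \<open>Add the multiplier estimates of the two halves. The weighted densities left at
  \<open>a\<close> and \<open>b\<close> are of size \<epsilon> * wt_max / m and are absorbed by the
  boundary dissipation under the second bound on \<open>\<epsilon>\<close>; the interface
  contributes only terms of favourable sign.\<close>

lemma graph_dissipative:
  assumes g: "graph x y Em Ep E2"
    and \<kappa>: "\<And>u v. bd_form W u v = 0 \<Longrightarrow>
      u $ 1 * u $ 2 - v $ 1 * v $ 2 \<le> - \<kappa> * ((u $ 1)\<^sup>2 + (u $ 2)\<^sup>2 + (v $ 1)\<^sup>2 + (v $ 2)\<^sup>2)"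
    and \<epsilon>: "0 \<le> \<epsilon>" "\<epsilon> * wt_max \<le> \<kappa> * m"
  shows "wip lp (lq \<epsilon>) ls y x \<le> - (\<epsilon> / 2) * sqn x"
proof -
  have ac: "ac_on a 0 Em (\<lambda>z. - component y 2 z)" "ac_on 0 b Ep (\<lambda>z. - component y 2 z)"
    "ac_on a b E2 (\<lambda>z. - component y 1 z)" and xy: "x \<in> X" "y \<in> X"
    and bc: "E2 0 = r * (Em 0 - Ep 0)" "bd_form W (vector [Em a, E2 a]) (vector [Ep b, E2 b]) = 0"
    using g unfolding graph_def by blast+
  have ac2: "ac_on a 0 E2 (\<lambda>z. - component y 1 z)" "ac_on 0 b E2 (\<lambda>z. - component y 1 z)"
    using ac_on_subinterval[OF ac(3)] ab by auto
  define xm1 where "xm1 z = minus.s1 z * Em z + minus.s2 z * E2 z" for z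
  define xm2 where "xm2 z = minus.s2 z * Em z + minus.s3 z * E2 z" for z
  define xp1 where "xp1 z = plus.s1 z * Ep z + plus.s2 z * E2 z" for z
  define xp2 where "xp2 z = plus.s2 z * Ep z + plus.s3 z * E2 z" for z
  define Fm where "Fm z = - (1/2) * (- component y 1 z * Em z + - component y 2 z * E2 z)
     + \<epsilon> * (- 1 * exp (- 1 * rate * z)) * (- component y 2 z * xm1 z + - component y 1 z * xm2 z)" for z
  define Fp where "Fp z = - (1/2) * (- component y 1 z * Ep z + - component y 2 z * E2 z)
     + \<epsilon> * (1 * exp (1 * rate * z)) * (- component y 2 z * xp1 z + - component y 1 z * xp2 z)" for z
  \<comment> \<open>The literal factors -1 and 1 in \<open>Fm\<close> and \<open>Fp\<close> match
    \<open>multiplier_estimate\<close> with \<sigma> = -1 on the left half and \<sigma> = 1 on the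
    right half.\<close>
  have sm: "(-1::real) = 1 \<or> (-1::real) = -1" "\<forall>z\<in>{a..0}. 0 \<le> -1 * z"
    and sp: "(1::real) = 1 \<or> (1::real) = -1" "\<forall>z\<in>{0..b}. 0 \<le> 1 * z"
    by auto
  note estm = minus.multiplier_estimate[OF ac(1) ac2(1) sm rate \<epsilon>(1), folded xm1_def xm2_def Fm_def]
  note estp = plus.multiplier_estimate[OF ac(2) ac2(2) sp rate \<epsilon>(1), folded xp1_def xp2_def Fp_def]
  note st = graph_state[OF g]
  obtain B where "bounded_weight lp (lq \<epsilon>) ls B"
    using bounded_weight by blast
  then interpret bw: bounded_weight lp "lq \<epsilon>" ls B .
  have "wip lp (lq \<epsilon>) ls y x = (LINT z:{a..0}|lborel. Fm z) + (LINT z:{0..b}|lborel. Fp z)"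
    unfolding wip_def
  proof (rule integral_split)
    show "set_integrable lborel {a..0} Fm" "set_integrable lborel {0..b} Fp"
      using estm(2) estp(2) .
    show "AE z in lborel. (z \<in> {a..0} \<longrightarrow> lp z * (component y 1 z * component x 1 z)
         + lq \<epsilon> z * (component y 1 z * component x 2 z + component y 2 z * component x 1 z)
         + ls z * (component y 2 z * component x 2 z) = Fm z) \<and>
       (z \<in> {0..b} \<longrightarrow> lp z * (component y 1 z * component x 1 z)
         + lq \<epsilon> z * (component y 1 z * component x 2 z + component y 2 z * component x 1 z)
         + ls z * (component y 2 z * component x 2 z) = Fp z) \<and>
       (z \<notin> {a..b} \<longrightarrow> lp z * (component y 1 z * component x 1 z)
         + lq \<epsilon> z * (component y 1 z * component x 2 z + component y 2 z * component x 1 z)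
         + ls z * (component y 2 z * component x 2 z) = 0)"
      using st AE_nonzero xy(1)[unfolded L2_space_iff]
    proof eventually_elim
      case (elim z)
      have nz: "z \<noteq> 0"
        using elim by blast
      have "lp z * (component y 1 z * component x 1 z)
         + lq \<epsilon> z * (component y 1 z * component x 2 z + component y 2 z * component x 1 z)
         + ls z * (component y 2 z * component x 2 z) = Fm z" if z: "z \<in> {a..0}"
      proof -
        have w: "lq \<epsilon> z = q 1 2 z / 2 + \<epsilon> * exp (- rate * z)"
          using z nz ab by (auto simp: lq_def wt_def)
        have x: "xm1 z = component x 1 z" "xm2 z = component x 2 z"
          unfolding xm1_def xm2_def using elim(1) z by simp_all
        have E: "Em z = q 1 1 z * component x 1 z + q 1 2 z * component x 2 z"
          "E2 z = q 1 2 z * component x 1 z + q 2 2 z * component x 2 z"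
          using elim z by blast+
        show ?thesis
          unfolding Fm_def x E w lp_def ls_def by (simp add: field_simps)
      qed
      moreover have "lp z * (component y 1 z * component x 1 z)
         + lq \<epsilon> z * (component y 1 z * component x 2 z + component y 2 z * component x 1 z)
         + ls z * (component y 2 z * component x 2 z) = Fp z" if z: "z \<in> {0..b}"
      proof -
        have w: "lq \<epsilon> z = q 1 2 z / 2 - \<epsilon> * exp (rate * z)"
          using z nz ab by (auto simp: lq_def wt_def)
        have x: "xp1 z = component x 1 z" "xp2 z = component x 2 z"
          unfolding xp1_def xp2_def using elim(2) z by simp_all
        have E: "Ep z = q 1 1 z * component x 1 z + q 1 2 z * component x 2 z"
          "E2 z = q 1 2 z * component x 1 z + q 2 2 z * component x 2 z"
          using elim z by blast+
        show ?thesis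
          unfolding Fp_def x E w lp_def ls_def by (simp add: field_simps)
      qed
      moreover have "component x 1 z = 0 \<and> component x 2 z = 0" if "z \<notin> {a..b}"
        using elim that by blast
      ultimately show ?case
        by simp
    qed
  qed measurable
  also have "\<dots> \<le> - (\<epsilon> / 2) * ((LINT z:{a..0}|lborel. (xm1 z)\<^sup>2 + (xm2 z)\<^sup>2) + (LINT z:{0..b}|lborel. (xp1 z)\<^sup>2 + (xp2 z)\<^sup>2))"
  proof -
    define hm where "hm z = Em z * xm1 z + E2 z * xm2 z" for z
    define hp where "hp z = Ep z * xp1 z + E2 z * xp2 z" for z
    have m0: "0 \<le> hm 0" and ma: "hm a \<le> ((Em a)\<^sup>2 + (E2 a)\<^sup>2) / m"
      using minus.energy_density_le[of 0 "xm1 0" "Em 0" "E2 0" "xm2 0"]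
        minus.energy_density_le[of a "xm1 a" "Em a" "E2 a" "xm2 a"] ab
      by (simp_all add: hm_def xm1_def xm2_def)
    have p0: "0 \<le> hp 0" and pb: "hp b \<le> ((Ep b)\<^sup>2 + (E2 b)\<^sup>2) / m"
      using plus.energy_density_le[of 0 "xp1 0" "Ep 0" "E2 0" "xp2 0"]
        plus.energy_density_le[of b "xp1 b" "Ep b" "E2 b" "xp2 b"] ab
      by (simp_all add: hp_def xp1_def xp2_def)
    have bd: "Em a * E2 a - Ep b * E2 b \<le> - \<kappa> * ((Em a)\<^sup>2 + (E2 a)\<^sup>2 + (Ep b)\<^sup>2 + (E2 b)\<^sup>2)"
      using \<kappa>[OF bc(2)] by simp
    \<comment> \<open>The interface condition turns the power lost at 0 into r times the square of
      the jump of e_1.\<close>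
    have int: "0 \<le> E2 0 * (Em 0 - Ep 0)"
      unfolding bc(1) using r by (simp add: mult.assoc)
    have "exp (- rate * a) * hm a \<le> wt_max * (((Em a)\<^sup>2 + (E2 a)\<^sup>2) / m)"
      using ma m wt_max_pos by (intro order_trans[OF mult_left_mono mult_right_mono]) (auto simp: wt_max_def)
    moreover have "exp (rate * b) * hp b \<le> wt_max * (((Ep b)\<^sup>2 + (E2 b)\<^sup>2) / m)"
      using pb m wt_max_pos by (intro order_trans[OF mult_left_mono mult_right_mono]) (auto simp: wt_max_def)
    ultimately have "exp (- rate * a) * hm a + exp (rate * b) * hp b \<le>
        wt_max * (((Em a)\<^sup>2 + (E2 a)\<^sup>2 + (Ep b)\<^sup>2 + (E2 b)\<^sup>2) / m)"
      by (simp add: add_divide_distrib distrib_left)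
    then have "\<epsilon> * (exp (- rate * a) * hm a + exp (rate * b) * hp b) \<le>
        \<epsilon> * (wt_max * (((Em a)\<^sup>2 + (E2 a)\<^sup>2 + (Ep b)\<^sup>2 + (E2 b)\<^sup>2) / m))"
      using \<epsilon>(1) by (rule mult_left_mono)
    also have "\<dots> = (\<epsilon> * wt_max) * (((Em a)\<^sup>2 + (E2 a)\<^sup>2 + (Ep b)\<^sup>2 + (E2 b)\<^sup>2) / m)"
      by simp
    also have "\<dots> \<le> (\<kappa> * m) * (((Em a)\<^sup>2 + (E2 a)\<^sup>2 + (Ep b)\<^sup>2 + (E2 b)\<^sup>2) / m)"
      using \<epsilon>(2) m by (intro mult_right_mono) auto
    also have "\<dots> = \<kappa> * ((Em a)\<^sup>2 + (E2 a)\<^sup>2 + (Ep b)\<^sup>2 + (E2 b)\<^sup>2)"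
      using m by simp
    finally have w: "\<epsilon> * (exp (- rate * a) * hm a + exp (rate * b) * hp b) \<le>
        \<kappa> * ((Em a)\<^sup>2 + (E2 a)\<^sup>2 + (Ep b)\<^sup>2 + (E2 b)\<^sup>2)" .
    \<comment> \<open>Both interface densities carry the factor -\<epsilon>/2, since the weight is
      -1 at 0 from the left and 1 from the right.\<close>
    have "0 \<le> \<epsilon> * (hm 0 + hp 0)"
      using \<epsilon>(1) m0 p0 by simp
    then show ?thesis
      using estm(1)[folded hm_def] estp(1)[folded hp_def] w bd int
      by (simp add: algebra_simps)
  qed
  also have "(LINT z:{a..0}|lborel. (xm1 z)\<^sup>2 + (xm2 z)\<^sup>2) + (LINT z:{0..b}|lborel. (xp1 z)\<^sup>2 + (xp2 z)\<^sup>2) = sqn x"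
    unfolding sqn_def
  proof (rule integral_split[symmetric])
    show "set_integrable lborel {a..0} (\<lambda>z. (xm1 z)\<^sup>2 + (xm2 z)\<^sup>2)"
      "set_integrable lborel {0..b} (\<lambda>z. (xp1 z)\<^sup>2 + (xp2 z)\<^sup>2)"
      using estm(3) estp(3) .
    show "AE z in lborel. (z \<in> {a..0} \<longrightarrow> (component x 1 z)\<^sup>2 + (component x 2 z)\<^sup>2 = (xm1 z)\<^sup>2 + (xm2 z)\<^sup>2) \<and>
       (z \<in> {0..b} \<longrightarrow> (component x 1 z)\<^sup>2 + (component x 2 z)\<^sup>2 = (xp1 z)\<^sup>2 + (xp2 z)\<^sup>2) \<and>
       (z \<notin> {a..b} \<longrightarrow> (component x 1 z)\<^sup>2 + (component x 2 z)\<^sup>2 = 0)"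
      using st(1,2) xy(1)[unfolded L2_space_iff]
      by eventually_elim (simp add: xm1_def xm2_def xp1_def xp2_def)
  qed measurable
  finally show ?thesis .
qed

end

context port_hamiltonian
begin

subsection \<open>Surjectivity\<close>

lemma A_surj:
  assumes y: "y \<in> X"
  shows "\<exists>x\<in>D. A x = y"
proof -
  \<comment> \<open>The unknowns are c = (\<open>Em a\<close>, \<open>E2 a\<close>,
    \<open>Ep 0\<close>), and \<open>f\<close> returns the residuals of the interface condition and
    of the two boundary conditions for constant efforts.\<close>
  define f where "f = (\<lambda>c :: real \<times> real \<times> real.
    (fst (snd c) - r * (fst c - snd (snd c)),
     bd_form W (vector [fst c, fst (snd c)]) (vector [snd (snd c), fst (snd c)]) $ 1,
     bd_form W (vector [fst c, fst (snd c)]) (vector [snd (snd c), fst (snd c)]) $ 2))"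
  have lin: "linear f"
  proof (rule linearI)
    show "f (c + d) = f c + f d" for c d
      by (simp add: f_def vector_2_add bd_form_add algebra_simps)
    show "f (k *\<^sub>R c) = k *\<^sub>R f c" for k c
      by (simp add: f_def vector_2_scale bd_form_scale algebra_simps)
  qed
  obtain \<kappa> where \<kappa>: "0 < \<kappa>" "\<And>u v. bd_form W u v = 0 \<Longrightarrow>
      u $ 1 * u $ 2 - v $ 1 * v $ 2 \<le> - \<kappa> * ((u $ 1)\<^sup>2 + (u $ 2)\<^sup>2 + (v $ 1)\<^sup>2 + (v $ 2)\<^sup>2)"
    using boundary_dissipation[OF W] by blast
  text \<open>\<open>f c = 0\<close> says that the constants \<open>c\<close> satisfy the homogeneous conditions, so the power
    balance forces \<open>c = 0\<close>.\<close>
  have "c = 0" if c: "f c = 0" for c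
  proof -
    obtain c1 c2 c3 where c_eq: "c = (c1, c2, c3)"
      by (cases c) auto
    have 1: "c2 = r * (c1 - c3)"
      using c by (simp add: f_def c_eq zero_prod_def)
    have "bd_form W (vector [c1, c2]) (vector [c3, c2]) = vector [fst (snd (f c)), snd (snd (f c))]"
      by (simp add: f_def c_eq vec_eq_iff forall_2)
    then have 2: "bd_form W (vector [c1, c2]) (vector [c3, c2]) = 0"
      unfolding c by (simp add: vec_eq_iff forall_2)
    have "c1 * c2 - c3 * c2 \<le> - \<kappa> * (c1\<^sup>2 + c2\<^sup>2 + c3\<^sup>2 + c2\<^sup>2)"
      using \<kappa>(2)[OF 2] by simp
    moreover have "c1 * c2 - c3 * c2 = r * (c1 - c3)\<^sup>2"
      unfolding 1 by algebra
    ultimately have "\<kappa> * (c1\<^sup>2 + c2\<^sup>2 + c3\<^sup>2 + c2\<^sup>2) \<le> 0"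
      using mult_nonneg_nonneg[OF r zero_le_power2[of "c1 - c3"]] by linarith
    then have "c1\<^sup>2 + c2\<^sup>2 + c3\<^sup>2 + c2\<^sup>2 \<le> 0"
      using \<kappa>(1) by (simp add: mult_le_0_iff)
    then have "c1\<^sup>2 = 0 \<and> c2\<^sup>2 = 0 \<and> c3\<^sup>2 = 0"
      using zero_le_power2[of c1] zero_le_power2[of c2] zero_le_power2[of c3] by linarith
    then show ?thesis
      by (simp add: c_eq zero_prod_def)
  qed
  then have "inj f"
    using linear_injective_0[OF lin] by blast
  then have f_surj: "surj f"
    by (rule linear_injective_imp_surjective[OF lin _ refl])
  define I where "I c i z = (LINT s:{c..z}|lborel. - component y i s)" for c i z
  \<comment> \<open>Contribution of \<open>y\<close> to the boundary residual. The values at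
    \<open>a\<close> receive none, because the integrals in \<open>Em\<close> and \<open>E2\<close>
    start there.\<close>
  let ?v = "bd_form W 0 (vector [I 0 2 b, I a 1 b])"
  obtain c where c: "f c = (- (I a 1 0 - r * I a 2 0), - ?v $ 1, - ?v $ 2)"
    using f_surj by (metis surj_def)
  obtain c1 c2 c3 where c_eq: "c = (c1, c2, c3)"
    by (cases c) auto
  define Em where "Em z = c1 + I a 2 z" for z
  define Ep where "Ep z = c3 + I 0 2 z" for z
  define E2 where "E2 z = c2 + I a 1 z" for z
  have ac: "ac_on a 0 Em (\<lambda>z. - component y 2 z)" "ac_on 0 b Ep (\<lambda>z. - component y 2 z)"
    "ac_on a b E2 (\<lambda>z. - component y 1 z)"
    unfolding Em_def Ep_def E2_def I_def
    using ab by (auto intro!: ac_on_indefinite component_set_integrable)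
  have I0: "I c i c = 0" for c i
    using set_integral_Ioo_eq_Icc[of c c "\<lambda>s. - component y i s"]
    unfolding I_def by (simp add: set_lebesgue_integral_def)
  have bc1: "E2 0 = r * (Em 0 - Ep 0)"
    using c by (simp add: f_def c_eq E2_def Em_def Ep_def I0 algebra_simps)
  have bc2: "bd_form W (vector [Em a, E2 a]) (vector [Ep b, E2 b]) = 0"
  proof -
    have "bd_form W (vector [Em a, E2 a]) (vector [Ep b, E2 b]) =
        bd_form W (vector [c1, c2] + 0) (vector [c3, c2] + vector [I 0 2 b, I a 1 b])"
      by (simp add: Em_def Ep_def E2_def I0 vector_2_add)
    also have "\<dots> = bd_form W (vector [c1, c2]) (vector [c3, c2]) + ?v"
      by (rule bd_form_add)
    also have "\<dots> = 0"
      using c by (simp add: f_def c_eq vec_eq_iff forall_2)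
    finally show ?thesis .
  qed
  note Ec = ac_on_continuous[OF ac(1)] ac_on_continuous[OF ac(2)] ac_on_continuous[OF ac(3)]
  have E2c: "continuous_on {a..0} E2" "continuous_on {0..b} E2"
    using ab by (auto intro: continuous_on_subset[OF Ec(3)])
  \<comment> \<open>The state is recovered from the effort as x = S e on each side.\<close>
  define x1 where "x1 z = indicator {a..<0} z * (minus.s1 z * Em z + minus.s2 z * E2 z)
    + indicator {0<..b} z * (plus.s1 z * Ep z + plus.s2 z * E2 z)" for z
  define x2 where "x2 z = indicator {a..<0} z * (minus.s2 z * Em z + minus.s3 z * E2 z)
    + indicator {0<..b} z * (plus.s2 z * Ep z + plus.s3 z * E2 z)" for z
  have sqi: "sqi (\<lambda>z. indicator {a..<0} z * F z + indicator {0<..b} z * G z)"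
    if "continuous_on {a..0} F" "continuous_on {0..b} G" for F G
    by (rule sqi_add[OF sqi_continuous[OF that(1)] sqi_continuous[OF that(2)]]) auto
  have "sqi x1" "sqi x2"
    unfolding x1_def[abs_def] x2_def[abs_def]
    by (rule sqi; intro continuous_intros Ec E2c minus.s_continuous plus.s_continuous)+
  note sq = sq_integrable_vector[OF this]
  define x where "x = abs_L2R2 (\<lambda>z. vector [x1 z, x2 z])"
  have x: "AE z in lborel. component x 1 z = x1 z" "AE z in lborel. component x 2 z = x2 z"
    using component_abs[OF sq, of 1] component_abs[OF sq, of 2] by (simp_all add: x_def)
  have xX: "x \<in> X"
    unfolding L2_space_iff using x by eventually_elim (use ab in \<open>auto simp: x1_def x2_def\<close>)
  have minus: "Em z = q 1 1 z * x1 z + q 1 2 z * x2 z" "E2 z = q 1 2 z * x1 z + q 2 2 z * x2 z"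
    if z: "z \<in> {a<..<0}" for z
  proof -
    have z': "z \<in> {a..<0}" "z \<in> {a..0}"
      using z by auto
    have "x1 z = minus.s1 z * Em z + minus.s2 z * E2 z" "x2 z = minus.s2 z * Em z + minus.s3 z * E2 z"
      using z by (auto simp: x1_def x2_def)
    from minus.Q_S[OF z'(2) this] show "Em z = q 1 1 z * x1 z + q 1 2 z * x2 z" "E2 z = q 1 2 z * x1 z + q 2 2 z * x2 z"
      unfolding q_minus[OF z'(1)] .
  qed
  have plus: "Ep z = q 1 1 z * x1 z + q 1 2 z * x2 z" "E2 z = q 1 2 z * x1 z + q 2 2 z * x2 z"
    if z: "z \<in> {0<..<b}" for z
  proof -
    have z': "z \<in> {0<..b}" "z \<in> {0..b}"
      using z by auto
    have "x1 z = plus.s1 z * Ep z + plus.s2 z * E2 z" "x2 z = plus.s2 z * Ep z + plus.s3 z * E2 z"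
      using z by (auto simp: x1_def x2_def)
    from plus.Q_S[OF z'(2) this] show "Ep z = q 1 1 z * x1 z + q 1 2 z * x2 z" "E2 z = q 1 2 z * x1 z + q 2 2 z * x2 z"
      unfolding q_plus[OF z'(1)] .
  qed
  have "AE z in lborel. z \<in> {a<..<0} \<longrightarrow> Em z = q 1 1 z * component x 1 z + q 1 2 z * component x 2 z"
    using x by eventually_elim (simp add: minus)
  moreover have "AE z in lborel. z \<in> {0<..<b} \<longrightarrow> Ep z = q 1 1 z * component x 1 z + q 1 2 z * component x 2 z"
    using x by eventually_elim (simp add: plus)
  moreover have "AE z in lborel. z \<in> {a<..<b} \<longrightarrow> E2 z = q 2 1 z * component x 1 z + q 2 2 z * component x 2 z"
    using x AE_nonzero
  proof eventually_elim
    case (elim z)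
    then have "z \<in> {a<..<b} \<longrightarrow> z \<in> {a<..<0} \<or> z \<in> {0<..<b}"
      by auto
    then show ?case
      unfolding q_sym elim(1,2) using minus(2)[of z] plus(2)[of z] by blast
  qed
  ultimately have "graph x y Em Ep E2"
    unfolding graph_def using xX y ac bc1 bc2 by blast
  then show ?thesis
    using graph_imp_dom_A by blast
qed

section \<open>Comparison with the energy norm, and generation\<close>

lemma energy_eq: "energy_inner a b Q x x = wip lp (lq 0) ls x x"
proof -
  have "energy_inner a b Q x x = (LINT z|lborel. 1/2 * (indicator {a..b} z *\<^sub>R (rep_L2R2 x z \<bullet> (Q z *v rep_L2R2 x z))))"
    by (simp add: energy_inner_def set_lebesgue_integral_def)
  also have "\<dots> = wip lp (lq 0) ls x x"
    unfolding wip_def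
  proof (intro Bochner_Integration.integral_cong refl)
    fix z
    have "rep_L2R2 x z \<bullet> (Q z *v rep_L2R2 x z) = q 1 1 z * (component x 1 z * component x 1 z)
        + q 1 2 z * (component x 1 z * component x 2 z + component x 2 z * component x 1 z)
        + q 2 2 z * (component x 2 z * component x 2 z)"
      using q_sym[of z]
      by (simp add: inner_vec_def sum_2 matrix_vector_mult_def q_def component_def algebra_simps)
    then show "1/2 * (indicator {a..b} z *\<^sub>R (rep_L2R2 x z \<bullet> (Q z *v rep_L2R2 x z))) =
        lp z * (component x 1 z * component x 1 z)
        + lq 0 z * (component x 1 z * component x 2 z + component x 2 z * component x 1 z)
        + ls z * (component x 2 z * component x 2 z)"
      using ab by (cases "z \<in> {a..b}") (auto simp: lp_def lq_def ls_def q_eq field_simps)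
  qed
  finally show ?thesis .
qed

lemma generates_stable:
  "\<exists>T. generates X (energy_norm a b Q) D A T \<and> exponentially_stable X (energy_norm a b Q) T"
proof -
  obtain \<kappa> where \<kappa>: "0 < \<kappa>" "\<And>u v. bd_form W u v = 0 \<Longrightarrow>
      u $ 1 * u $ 2 - v $ 1 * v $ 2 \<le> - \<kappa> * ((u $ 1)\<^sup>2 + (u $ 2)\<^sup>2 + (v $ 1)\<^sup>2 + (v $ 2)\<^sup>2)"
    using boundary_dissipation[OF W] by blast
  \<comment> \<open>The first entry of the minimum keeps the Lyapunov form equivalent to the L^2
    norm; the second is the bound that \<open>graph_dissipative\<close> requires.\<close>
  define \<epsilon> where "\<epsilon> = min (m / 4) (\<kappa> * m) / wt_max"
  have \<epsilon>: "0 < \<epsilon>" "\<epsilon> * wt_max \<le> m / 4" "\<epsilon> * wt_max \<le> \<kappa> * m"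
    using m \<kappa>(1) wt_max_pos by (simp_all add: \<epsilon>_def)
  define lo where "lo = m / 4"
  define hi where "hi = M / 2 + m / 4"
  \<comment> \<open>Testing the two bounds with the vector (1, 0) gives m \<le> M, hence hi >
    0.\<close>
  have "m * (1\<^sup>2 + 0\<^sup>2) \<le> M * (1\<^sup>2 + 0\<^sup>2)"
    using lower(1)[of a 1 0] upper(1)[of a 1 0] ab by simp
  then have lh: "0 < lo" "0 < hi"
    using m by (auto simp: lo_def hi_def)
  let ?ip = "wip lp (lq \<epsilon>) ls"
  note bounds = lyapunov_bounds[OF less_imp_le[OF \<epsilon>(1)] \<epsilon>(2), folded lo_def hi_def]
  have e0: "(0::real) \<le> 0" "0 * wt_max \<le> m / 4"
    using m by auto
  note ebounds = lyapunov_bounds[OF e0, folded lo_def hi_def]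
  obtain B where bw: "bounded_weight lp (lq \<epsilon>) ls B"
    using bounded_weight by blast
  interpret H: hilbert_subspace ?ip X
    using hilbert_subspace_wip[OF bw lh(1) lyapunov_nonneg[OF less_imp_le[OF \<epsilon>(1)] \<epsilon>(2)] bounds] .
  \<comment> \<open>\<open>graph_dissipative\<close> gives decay relative to \<open>sqn\<close>;
    dividing by \<open>hi\<close> expresses it relative to the Lyapunov form.\<close>
  interpret H: dissipative_operator ?ip X D A "\<epsilon> / 2 / hi"
  proof
    show "0 < \<epsilon> / 2 / hi"
      using \<epsilon>(1) lh by simp
    show "?ip (A x) x \<le> - (\<epsilon> / 2 / hi) * ?ip x x" if x: "x \<in> D" for x
    proof -
      obtain Em Ep E2 where g: "graph x (A x) Em Ep E2"
        using graphE[OF x] .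
      have "x \<in> X"
        using A_linear(4) x by blast
      then have "(\<epsilon> / 2 / hi) * ?ip x x \<le> (\<epsilon> / 2 / hi) * (hi * sqn x)"
        using bounds(2) \<epsilon>(1) lh by (intro mult_left_mono) auto
      also have "\<dots> = \<epsilon> / 2 * sqn x"
        using lh by simp
      finally show ?thesis
        using graph_dissipative[OF g \<kappa>(2) less_imp_le[OF \<epsilon>(1)] \<epsilon>(3)] by simp
    qed
    show "\<exists>x\<in>D. A x = y" if "y \<in> X" for y
      using A_surj[OF that] .
  qed (use A_linear in blast)+
  have nrm: "H.nrm x = sqrt (?ip x x)" for x
    by (rule H.nrm_def)
  have en: "energy_norm a b Q x = sqrt (wip lp (lq 0) ls x x)" for x
    by (simp add: energy_norm_def energy_eq)
  have "generates X (energy_norm a b Q) D A H.semi \<and> exponentially_stable X (energy_norm a b Q) H.semi"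
  proof (rule H.generates_stable_semigroup)
    \<comment> \<open>Both squared norms lie between \<open>lo * sqn x\<close> and
      \<open>hi * sqn x\<close>, which bounds their quotient from either side.\<close>
    show "0 < sqrt (lo / hi)" "0 < sqrt (hi / lo)"
      using lh by simp_all
    fix x assume x: "x \<in> X"
    have "lo / hi * ?ip x x \<le> lo / hi * (hi * sqn x)"
      using bounds(2)[OF x] lh by (intro mult_left_mono) auto
    then have "lo / hi * ?ip x x \<le> wip lp (lq 0) ls x x"
      using ebounds(1)[OF x] lh by simp
    then show "sqrt (lo / hi) * H.nrm x \<le> energy_norm a b Q x"
      unfolding nrm en real_sqrt_mult[symmetric] by (rule real_sqrt_le_mono)
    have "hi / lo * (lo * sqn x) \<le> hi / lo * ?ip x x"
      using bounds(1)[OF x] lh by (intro mult_left_mono) auto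
    then have "wip lp (lq 0) ls x x \<le> hi / lo * ?ip x x"
      using ebounds(2)[OF x] lh by simp
    then show "energy_norm a b Q x \<le> sqrt (hi / lo) * H.nrm x"
      unfolding nrm en real_sqrt_mult[symmetric] by (rule real_sqrt_le_mono)
  qed
  then show ?thesis
    by blast
qed

end

section \<open>From almost everywhere hypotheses to pointwise bounds\<close>

lemma AE_nonneg_imp_nonneg:
  fixes h :: "real \<Rightarrow> real"
  assumes h: "continuous_on {a..b} h" and ab: "a < b"
    and ae: "AE z in lborel. z \<in> {a..b} \<longrightarrow> 0 \<le> h z" and z: "z \<in> {a..b}"
  shows "0 \<le> h z"
proof -
  \<comment> \<open>A continuous function that agrees almost everywhere with its absolute value
    agrees with it everywhere.\<close>
  have "AE z in lborel. z \<in> {a<..<b} \<longrightarrow> h z = \<bar>h z\<bar>"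
    using ae by eventually_elim auto
  then have "h z = \<bar>h z\<bar>"
    using continuous_AE_eq[OF h continuous_on_rabs[OF h] ab _ z] by blast
  then show ?thesis
    by simp
qed

lemma quadratic_form_mat2:
  "vector [x, y] \<bullet> ((A :: real^2^2) *v vector [x, y]) =
    A $ 1 $ 1 * x\<^sup>2 + A $ 1 $ 2 * x * y + A $ 2 $ 1 * x * y + A $ 2 $ 2 * y\<^sup>2"
  by (simp add: inner_vec_def sum_2 matrix_vector_mult_def algebra_simps power2_eq_square)

text \<open>For fixed (x, y) the quadratic forms are continuous in z, so the almost everywhere
  inequalities hold at every point of the interval, endpoints included.\<close>

lemma form_bounds:
  fixes Q :: "real \<Rightarrow> real^2^2"
  assumes ab: "a < b" and sym: "\<And>z. z \<in> {a..b} \<Longrightarrow> transpose (Q z) = Q z"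
    and ae: "AE z in lborel. z \<in> {a..b} \<longrightarrow> pos_semidef (Q z - m *\<^sub>R mat 1) \<and> pos_semidef (M *\<^sub>R mat 1 - Q z)"
    and cont: "\<And>i j. continuous_on {a..b} (\<lambda>z. Q z $ i $ j)" and z: "z \<in> {a..b}"
  shows "Q z $ 2 $ 1 = Q z $ 1 $ 2"
    and "m * (x\<^sup>2 + y\<^sup>2) \<le> Q z $ 1 $ 1 * x\<^sup>2 + 2 * Q z $ 1 $ 2 * x * y + Q z $ 2 $ 2 * y\<^sup>2"
    and "Q z $ 1 $ 1 * x\<^sup>2 + 2 * Q z $ 1 $ 2 * x * y + Q z $ 2 $ 2 * y\<^sup>2 \<le> M * (x\<^sup>2 + y\<^sup>2)"
proof -
  have s: "Q z $ 2 $ 1 = Q z $ 1 $ 2" if "z \<in> {a..b}" for z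
    using arg_cong[OF sym[OF that], of "\<lambda>A. A $ 1 $ 2"] by (simp add: transpose_def)
  show "Q z $ 2 $ 1 = Q z $ 1 $ 2"
    by (rule s[OF z])
  have "0 \<le> Q z $ 1 $ 1 * x\<^sup>2 + 2 * Q z $ 1 $ 2 * x * y + Q z $ 2 $ 2 * y\<^sup>2 - m * (x\<^sup>2 + y\<^sup>2)"
  proof (rule AE_nonneg_imp_nonneg[OF _ ab _ z])
    show "AE z in lborel. z \<in> {a..b} \<longrightarrow> 0 \<le> Q z $ 1 $ 1 * x\<^sup>2 + 2 * Q z $ 1 $ 2 * x * y + Q z $ 2 $ 2 * y\<^sup>2 - m * (x\<^sup>2 + y\<^sup>2)"
      using ae
    proof eventually_elim
      case (elim z)
      show ?case
      proof
        assume z: "z \<in> {a..b}"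
        then have "0 \<le> vector [x, y] \<bullet> ((Q z - m *\<^sub>R mat 1) *v vector [x, y])"
          using elim unfolding pos_semidef_def by blast
        then show "0 \<le> Q z $ 1 $ 1 * x\<^sup>2 + 2 * Q z $ 1 $ 2 * x * y + Q z $ 2 $ 2 * y\<^sup>2 - m * (x\<^sup>2 + y\<^sup>2)"
          using s[OF z] by (simp add: quadratic_form_mat2 mat_def algebra_simps)
      qed
    qed
  qed (intro continuous_intros cont)
  then show "m * (x\<^sup>2 + y\<^sup>2) \<le> Q z $ 1 $ 1 * x\<^sup>2 + 2 * Q z $ 1 $ 2 * x * y + Q z $ 2 $ 2 * y\<^sup>2"
    by simp
  have "0 \<le> M * (x\<^sup>2 + y\<^sup>2) - (Q z $ 1 $ 1 * x\<^sup>2 + 2 * Q z $ 1 $ 2 * x * y + Q z $ 2 $ 2 * y\<^sup>2)"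
  proof (rule AE_nonneg_imp_nonneg[OF _ ab _ z])
    show "AE z in lborel. z \<in> {a..b} \<longrightarrow> 0 \<le> M * (x\<^sup>2 + y\<^sup>2) - (Q z $ 1 $ 1 * x\<^sup>2 + 2 * Q z $ 1 $ 2 * x * y + Q z $ 2 $ 2 * y\<^sup>2)"
      using ae
    proof eventually_elim
      case (elim z)
      show ?case
      proof
        assume z: "z \<in> {a..b}"
        then have "0 \<le> vector [x, y] \<bullet> ((M *\<^sub>R mat 1 - Q z) *v vector [x, y])"
          using elim unfolding pos_semidef_def by blast
        then show "0 \<le> M * (x\<^sup>2 + y\<^sup>2) - (Q z $ 1 $ 1 * x\<^sup>2 + 2 * Q z $ 1 $ 2 * x * y + Q z $ 2 $ 2 * y\<^sup>2)"
          using s[OF z] by (simp add: quadratic_form_mat2 mat_def algebra_simps)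
      qed
    qed
  qed (intro continuous_intros cont)
  then show "Q z $ 1 $ 1 * x\<^sup>2 + 2 * Q z $ 1 $ 2 * x * y + Q z $ 2 $ 2 * y\<^sup>2 \<le> M * (x\<^sup>2 + y\<^sup>2)"
    by simp
qed

lemma C1_onE:
  assumes "C1_on a b Q"
  obtains Q' L where "\<And>z. z \<in> {a..b} \<Longrightarrow> (Q has_vector_derivative Q' z) (at z within {a..b})"
    "continuous_on {a..b} Q'" "\<And>z i j. z \<in> {a..b} \<Longrightarrow> \<bar>Q' z $ i $ j\<bar> \<le> L"
    "\<And>i j. continuous_on {a..b} (\<lambda>z. Q z $ i $ j)"
proof -
  obtain Q' where Q': "\<forall>z\<in>{a..b}. (Q has_vector_derivative Q' z) (at z within {a..b})" "continuous_on {a..b} Q'"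
    using assms by (auto simp: C1_on_def)
  obtain L where L: "\<forall>y\<in>Q' ` {a..b}. norm y \<le> L"
    using compact_imp_bounded[OF compact_continuous_image[OF Q'(2) compact_Icc]]
    unfolding bounded_iff by blast
  show thesis
  proof (rule that[of Q' L])
    show "\<bar>Q' z $ i $ j\<bar> \<le> L" if "z \<in> {a..b}" for z i j
    proof -
      have "\<bar>Q' z $ i $ j\<bar> \<le> norm (Q' z $ i)"
        by (rule component_le_norm_cart)
      also have "\<dots> \<le> norm (Q' z)"
        by (rule Finite_Cartesian_Product.norm_nth_le)
      finally show ?thesis
        using L that by force
    qed
    show "continuous_on {a..b} (\<lambda>z. Q z $ i $ j)" for i j
      using DERIV_continuous_on[OF entry_deriv[OF bspec[OF Q'(1)]]] by blast
  qed (use Q' in blast)+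
qed

theorem theorem5p19:
  fixes a b m M r :: real
    and Qm Qp :: "real \<Rightarrow> real^2^2"
    and W :: "real^4^2"
  assumes "a < 0" "0 < b"
    and "0 < m" "m \<le> M"
    and "\<And>z. z \<in> {a..b} \<Longrightarrow> transpose (Qm z) = Qm z"
    and "\<And>z. z \<in> {a..b} \<Longrightarrow> transpose (Qp z) = Qp z"
    and "AE z in lborel. z \<in> {a..b} \<longrightarrow>
           pos_semidef (Qm z - m *\<^sub>R mat 1) \<and> pos_semidef (M *\<^sub>R mat 1 - Qm z)"
    and "AE z in lborel. z \<in> {a..b} \<longrightarrow>
           pos_semidef (Qp z - m *\<^sub>R mat 1) \<and> pos_semidef (M *\<^sub>R mat 1 - Qp z)"
    and "C1_on a b Qm" "C1_on a b Qp"
    and "0 \<le> r"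
    and "rank W = 2"
    and "pos_semidef (W ** Sigma_mat ** transpose W)"
    and "pos_def (W ** Sigma_mat ** transpose W)"
  shows "\<exists>T. generates (L2_space a b) (energy_norm a b (Q0 a b Qm Qp))
               (dom_A a b Qm Qp r W) (op_A a b Qm Qp) T \<and>
             exponentially_stable (L2_space a b) (energy_norm a b (Q0 a b Qm Qp)) T"
proof -
  have ab: "a < b"
    using assms(1,2) by simp
  obtain Qm' Lm where m': "\<And>z. z \<in> {a..b} \<Longrightarrow> (Qm has_vector_derivative Qm' z) (at z within {a..b})"
    "continuous_on {a..b} Qm'" "\<And>z i j. z \<in> {a..b} \<Longrightarrow> \<bar>Qm' z $ i $ j\<bar> \<le> Lm"
    "\<And>i j. continuous_on {a..b} (\<lambda>z. Qm z $ i $ j)"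
    using C1_onE[OF assms(9)] by blast
  obtain Qp' Lp where p': "\<And>z. z \<in> {a..b} \<Longrightarrow> (Qp has_vector_derivative Qp' z) (at z within {a..b})"
    "continuous_on {a..b} Qp'" "\<And>z i j. z \<in> {a..b} \<Longrightarrow> \<bar>Qp' z $ i $ j\<bar> \<le> Lp"
    "\<And>i j. continuous_on {a..b} (\<lambda>z. Qp z $ i $ j)"
    using C1_onE[OF assms(10)] by blast
  note bm = form_bounds[OF ab assms(5) assms(7) m'(4)]
  note bp = form_bounds[OF ab assms(6) assms(8) p'(4)]
  interpret port_hamiltonian a b m M "max Lm Lp" r Qm Qp Qm' Qp' W
  proof
    show "\<bar>Qm' z $ i $ j\<bar> \<le> max Lm Lp" "\<bar>Qp' z $ i $ j\<bar> \<le> max Lm Lp" if "z \<in> {a..b}" for z i j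
      using m'(3)[OF that, of i j] p'(3)[OF that, of i j] by linarith+
  qed (rule assms bm bp m' p'; assumption)+
  show ?thesis
    by (rule generates_stable)
qed

end
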